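(* Let $n\ge 1$. Let $q\in[1,\infty)$, $c\in(0,\infty]$, $\mathbf{B}=(\beta_0,\beta_\infty)\in\mathbb{R}^2$ be such that either $q=c=1$ and $\mathbf{B}=(0,0)$, or $1<q<\infty$ and $0<c\le\infty$ (with $\mathbf{B}\in\mathbb{R}^2$ arbitrary). Let $-\infty<\sigma,\gamma<\infty$, $0<u\le\infty$, $0<c\le b\le\infty$, and $\mathbf{A}=(\alpha_0,\alpha_\infty)\in\mathbb{R}^2$ with $\alpha_\infty<\beta_\infty$ and $\alpha_0\ge\beta_0$. Then $$B_{(q,c;\mathbf{B}),u}^{\sigma,\,\gamma+(\alpha_0-\beta_0)}\subset B_{(q,b;\mathbf{A}),u}^{\sigma,\gamma}.$$
   Context: Convention: $1/\infty=0$. For a pair $\mathbf{A}=(\alpha_0,\alpha_\infty)\in\mathbb{R}^2$ the broken-logarithmic function is $l^{\mathbf{A}}(t)=(1+|\ln t|)^{\alpha_0}$ for $0<t\le 1$ and $l^{\mathbf{A}}(t)=(1+|\ln t|)^{\alpha_\infty}$ for $t>1$. For a complex-valued measurable $f$ on $\mathbb{R}^n$, $f^*$ is its non-increasing rearrangement. For $0<p,b\le\infty$, the Lorentz–Zygmund space $L_{p,b;\mathbf{A}}=L_{p,b;\mathbf{A}}(\mathbb{R}^n)$ consists of all measurable $f$ with $\|f\|_{p,b;\mathbf{A}}:=\left\|t^{\frac1p-\frac1b}l^{\mathbf{A}}(t)f^*(t)\right\|_{L_b(0,\infty)}<\infty$. $S$ and $S'$ are the Schwartz space and the space of tempered distributions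 on $\mathbb{R}^n$; $\mathcal{F}$ is the Fourier transform, $\mathcal{F}f(\xi)=\int e^{-2\pi i x\xi}f(x)\,dx$, extended to $S'$. Fix $\varphi\in S$ with $\operatorname{supp}\varphi=\{\xi:2^{-1}\le|\xi|\le2\}$, $\varphi(\xi)>0$ for $2^{-1}<|\xi|<2$, and $\sum_{k=-\infty}^\infty\varphi(2^{-k}\xi)=1$ for $\xi\ne0$. Put $\varphi_k(\xi)=\varphi(2^{-k}\xi)$ ($k\in\mathbb{Z}$) and $\psi(\xi)=1-\sum_{k=1}^\infty\varphi(2^{-k}\xi)$. For $\sigma,\gamma\in\mathbb{R}$, $0<p,b,u\le\infty$ and $\mathbf{A}\in\mathbb{R}^2$ with $L_{p,b;\mathbf{A}}\neq\{0\}$, the Besov-type space $B^{\sigma,\gamma}_{(p,b;\mathbf{A}),u}$ consists of all $f\in S'$ with finite quasi-norm $$\|f\|_{B^{\sigma,\gamma}_{(p,b;\mathbf{A}),u}}=\|\mathcal{F}^{-1}(\psi\mathcal{F}f)\|_{p,b;\mathbf{A}}+\left\{\sum_{k=1}^\infty\left(2^{\sigma k}(1+k)^\gamma\|\mathcal{F}^{-1}(\varphi_k\mathcal{F}f)\|_{p,b;\mathbf{A}}\right)^u\right\}^{1/u}$$ (supremum over $k\ge 1$ if $u=\infty$). $X\subset Y$ means continuous embedding: every $f\in X$ is in $Y$ and $\|f\|_Y\le C\|f\|_X$ with $C$ independent of $f$. *)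

theory Defs
  imports "HOL-Analysis.Analysis" "HOL-Probability.Essential_Supremum"
begin

section \<open>Schwartz functions and tempered distributions\<close>

definition partial_deriv ::
    "'a::euclidean_space \<Rightarrow> ('a \<Rightarrow> complex) \<Rightarrow> 'a \<Rightarrow> complex" where
  "partial_deriv e f x = frechet_derivative f (at x) e"

definition iter_deriv ::
    "'a::euclidean_space list \<Rightarrow> ('a \<Rightarrow> complex) \<Rightarrow> 'a \<Rightarrow> complex" where
  "iter_deriv es f = foldr partial_deriv es f"

definition smooth :: "('a::euclidean_space \<Rightarrow> complex) \<Rightarrow> bool" where
  "smooth f \<longleftrightarrow> (\<forall>es \<in> lists Basis. \<forall>x. iter_deriv es f differentiable at x)"

definition schwartz_seminorm :: "nat \<Rightarrow> ('a::euclidean_space \<Rightarrow> complex) \<Rightarrow> ennreal" where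
  "schwartz_seminorm N f =
     (SUP es \<in> {es \<in> lists Basis. length es \<le> N}. SUP x.
        ennreal ((1 + norm x) ^ N * norm (iter_deriv es f x)))"

definition schwartz :: "('a::euclidean_space \<Rightarrow> complex) set" where
  "schwartz = {f. smooth f \<and> (\<forall>N. schwartz_seminorm N f < \<infinity>)}"

text \<open>
  A functional on Schwartz functions is a total function on \<open>'a \<Rightarrow> complex\<close> that takes the value
  \<open>undefined\<close> off \<open>schwartz\<close>, so that equality of functionals is equality on \<open>schwartz\<close>.
  Continuity with respect to the increasing family \<open>schwartz_seminorm\<close> means being bounded by a
  multiple of one of its members.
\<close>

definition tempered :: "(('a::euclidean_space \<Rightarrow> complex) \<Rightarrow> complex) set" where
  "tempered = {T \<in> extensional schwartz.
     (\<forall>f\<in>schwartz. \<forall>g\<in>schwartz. T (\<lambda>x. f x + g x) = T f + T g) \<and>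
     (\<forall>c. \<forall>f\<in>schwartz. T (\<lambda>x. c * f x) = c * T f) \<and>
     (\<exists>N C. \<forall>f\<in>schwartz. ennreal (norm (T f)) \<le> ennreal C * schwartz_seminorm N f)}"

definition fourier :: "('a::euclidean_space \<Rightarrow> complex) \<Rightarrow> 'a \<Rightarrow> complex" where
  "fourier f \<xi> = (LINT x|lborel. cis (- (2 * pi * (x \<bullet> \<xi>))) * f x)"

definition inv_fourier :: "('a::euclidean_space \<Rightarrow> complex) \<Rightarrow> 'a \<Rightarrow> complex" where
  "inv_fourier f x = (LINT \<xi>|lborel. cis (2 * pi * (x \<bullet> \<xi>)) * f \<xi>)"

definition fourier_dist ::
    "(('a::euclidean_space \<Rightarrow> complex) \<Rightarrow> complex) \<Rightarrow> ('a \<Rightarrow> complex) \<Rightarrow> complex" where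
  "fourier_dist T = (\<lambda>f\<in>schwartz. T (fourier f))"

definition inv_fourier_dist ::
    "(('a::euclidean_space \<Rightarrow> complex) \<Rightarrow> complex) \<Rightarrow> ('a \<Rightarrow> complex) \<Rightarrow> complex" where
  "inv_fourier_dist T = (\<lambda>f\<in>schwartz. T (inv_fourier f))"

definition mult_dist ::
    "('a::euclidean_space \<Rightarrow> real) \<Rightarrow> (('a \<Rightarrow> complex) \<Rightarrow> complex) \<Rightarrow>
     ('a \<Rightarrow> complex) \<Rightarrow> complex" where
  "mult_dist \<eta> T = (\<lambda>f\<in>schwartz. T (\<lambda>x. complex_of_real (\<eta> x) * f x))"

definition represents ::
    "('a::euclidean_space \<Rightarrow> complex) \<Rightarrow> (('a \<Rightarrow> complex) \<Rightarrow> complex) \<Rightarrow> bool" where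
  "represents g T \<longleftrightarrow> g \<in> borel_measurable lebesgue \<and>
     (\<forall>f\<in>schwartz. integrable lebesgue (\<lambda>x. g x * f x) \<and>
        T f = (LINT x|lebesgue. g x * f x))"

section \<open>Lorentz--Zygmund quasi-norms\<close>

text \<open>
  Exponents in \<open>(0,\<infinity>]\<close> have type \<^typ>\<open>ennreal\<close>; since \<open>inverse \<infinity> = 0\<close>, the convention
  \<open>1 / \<infinity> = 0\<close> is built into the next definition.
\<close>

definition recip :: "ennreal \<Rightarrow> real" where
  "recip p = enn2real (inverse p)"

text \<open>Powers of extended nonnegative reals, used for positive real exponents only.\<close>

definition epowr :: "ennreal \<Rightarrow> real \<Rightarrow> ennreal" where
  "epowr x a = (if x = \<infinity> then \<infinity> else ennreal (enn2real x powr a))"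

definition Lb_qnorm :: "ennreal \<Rightarrow> 'm measure \<Rightarrow> ('m \<Rightarrow> ennreal) \<Rightarrow> ennreal" where
  "Lb_qnorm b M g =
     (if b = \<infinity> then esssup M g
      else epowr (\<integral>\<^sup>+ t. epowr (g t) (enn2real b) \<partial>M) (recip b))"

text \<open>The sequence is indexed by \<open>k \<ge> 1\<close>.\<close>

definition lu_qnorm :: "ennreal \<Rightarrow> (nat \<Rightarrow> ennreal) \<Rightarrow> ennreal" where
  "lu_qnorm u a =
     (if u = \<infinity> then (SUP k\<in>{1..}. a k)
      else epowr (\<Sum>k. epowr (a (Suc k)) (enn2real u)) (recip u))"

definition broken_log :: "real \<times> real \<Rightarrow> real \<Rightarrow> real" where
  "broken_log A t = (1 + \<bar>ln t\<bar>) powr (if t \<le> 1 then fst A else snd A)"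

definition rearrangement :: "('a::euclidean_space \<Rightarrow> complex) \<Rightarrow> real \<Rightarrow> ennreal" where
  "rearrangement f t =
     Inf {s::ennreal. emeasure lebesgue {x. s < ennreal (norm (f x))} \<le> ennreal t}"

definition LZ_qnorm ::
    "ennreal \<Rightarrow> ennreal \<Rightarrow> real \<times> real \<Rightarrow> ('a::euclidean_space \<Rightarrow> complex) \<Rightarrow> ennreal" where
  "LZ_qnorm p b A f =
     Lb_qnorm b (restrict_space lborel {0<..})
       (\<lambda>t. ennreal (t powr (recip p - recip b) * broken_log A t) * rearrangement f t)"

text \<open>
  Quasi-norm of a distribution: that of the function representing it, which is unique almost
  everywhere and hence has a unique rearrangement, and \<open>\<infinity>\<close> (the infimum of the empty set) if
  there is none.
\<close>

definition LZ_qnorm_dist ::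
    "ennreal \<Rightarrow> ennreal \<Rightarrow> real \<times> real \<Rightarrow>
     (('a::euclidean_space \<Rightarrow> complex) \<Rightarrow> complex) \<Rightarrow> ennreal" where
  "LZ_qnorm_dist p b A T = (INF g \<in> {g. represents g T}. LZ_qnorm p b A g)"

section \<open>Besov-type spaces\<close>

definition dyadic :: "('a::euclidean_space \<Rightarrow> real) \<Rightarrow> int \<Rightarrow> 'a \<Rightarrow> real" where
  "dyadic \<phi> k \<xi> = \<phi> (2 powi (- k) *\<^sub>R \<xi>)"

definition dyadic_resolution :: "('a::euclidean_space \<Rightarrow> real) \<Rightarrow> bool" where
  "dyadic_resolution \<phi> \<longleftrightarrow>
     (\<lambda>\<xi>. complex_of_real (\<phi> \<xi>)) \<in> schwartz \<and>
     closure {\<xi>. \<phi> \<xi> \<noteq> 0} = {\<xi>. 1/2 \<le> norm \<xi> \<and> norm \<xi> \<le> 2} \<and>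
     (\<forall>\<xi>. 1/2 < norm \<xi> \<and> norm \<xi> < 2 \<longrightarrow> \<phi> \<xi> > 0) \<and>
     (\<forall>\<xi>. \<xi> \<noteq> 0 \<longrightarrow> ((\<lambda>k. dyadic \<phi> k \<xi>) has_sum 1) UNIV)"

definition low_freq :: "('a::euclidean_space \<Rightarrow> real) \<Rightarrow> 'a \<Rightarrow> real" where
  "low_freq \<phi> \<xi> = 1 - (\<Sum>k. dyadic \<phi> (int (Suc k)) \<xi>)"

definition freq_piece ::
    "('a::euclidean_space \<Rightarrow> real) \<Rightarrow> (('a \<Rightarrow> complex) \<Rightarrow> complex) \<Rightarrow>
     ('a \<Rightarrow> complex) \<Rightarrow> complex" where
  "freq_piece \<eta> f = inv_fourier_dist (mult_dist \<eta> (fourier_dist f))"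

definition besov_qnorm ::
    "('a::euclidean_space \<Rightarrow> real) \<Rightarrow> real \<Rightarrow> real \<Rightarrow>
     ennreal \<Rightarrow> ennreal \<Rightarrow> real \<times> real \<Rightarrow> ennreal \<Rightarrow>
     (('a \<Rightarrow> complex) \<Rightarrow> complex) \<Rightarrow> ennreal" where
  "besov_qnorm \<phi> \<sigma> \<gamma> p b A u f =
     LZ_qnorm_dist p b A (freq_piece (low_freq \<phi>) f) +
     lu_qnorm u (\<lambda>k. ennreal (2 powr (\<sigma> * real k) * (1 + real k) powr \<gamma>) *
                      LZ_qnorm_dist p b A (freq_piece (dyadic \<phi> (int k)) f))"

text \<open>
  The usual proviso that the underlying Lorentz--Zygmund space is not \<open>{0}\<close> is not imposed: it
  holds automatically for \<open>p < \<infinity>\<close> (consider the indicator function of a ball).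
\<close>

definition besov ::
    "('a::euclidean_space \<Rightarrow> real) \<Rightarrow> real \<Rightarrow> real \<Rightarrow>
     ennreal \<Rightarrow> ennreal \<Rightarrow> real \<times> real \<Rightarrow> ennreal \<Rightarrow>
     (('a \<Rightarrow> complex) \<Rightarrow> complex) set" where
  "besov \<phi> \<sigma> \<gamma> p b A u = {f \<in> tempered. besov_qnorm \<phi> \<sigma> \<gamma> p b A u f < \<infinity>}"

definition continuously_embedded ::
    "'v set \<Rightarrow> ('v \<Rightarrow> ennreal) \<Rightarrow> 'v set \<Rightarrow> ('v \<Rightarrow> ennreal) \<Rightarrow> bool" where
  "continuously_embedded X NX Y NY \<longleftrightarrow>
     X \<subseteq> Y \<and> (\<exists>C::real. \<forall>f\<in>X. NY f \<le> ennreal C * NX f)"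

end

theory Submission
  imports Defs "HOL-Probability.Probability"
begin

text \<open>
  A function \<open>g\<close> whose Fourier transform vanishes for \<open>\<bar>\<xi>\<bar> > 2\<^sup>m\<close> is reproduced by convolution with
  an \<open>L\<^sub>1\<close>-normalised dilate of a fixed Schwartz kernel at scale \<open>2\<^sup>-\<^sup>m\<close>. Splitting \<open>g\<close> at the height
  \<open>g\<^sup>*(\<tau>)\<close>, \<open>\<tau> = 2\<^sup>-\<^sup>m\<^sup>n\<close>, this bounds \<open>\<parallel>g\<parallel>\<^sub>\<infinity>\<close> by a multiple of the mean of \<open>g\<^sup>*\<close> over \<open>(0, \<tau>)\<close>, hence by
  \<open>\<tau> powr (-1/q) * (1 + \<bar>ln \<tau>\<bar>) powr (-\<beta>\<^sub>0)\<close> times the source norm (here \<open>q > 1\<close>, or \<open>L\<^sub>1\<close>, is needed). In the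
  target norm, the range \<open>t < \<tau>\<close> is controlled by this sup bound. For \<open>t \<ge> \<tau>\<close> the quotient of the two
  logarithmic weights is at most \<open>(1 + \<bar>ln \<tau>\<bar>) powr (\<alpha>\<^sub>0 - \<beta>\<^sub>0)\<close>, which is of order
  \<open>(1 + m) powr (\<alpha>\<^sub>0 - \<beta>\<^sub>0)\<close>, and passing from \<open>c\<close> to \<open>b \<ge> c\<close> costs only a constant because \<open>g\<^sup>*\<close> is
  monotone.

  The reproducing formula needs no regularity of the cut-offs: testing the distribution with
  Schwartz functions whose inverse Fourier transform is a modulated dilate of \<open>low_freq \<phi>\<close> shows
  that its averages against the dilated kernels do not depend on the (fine) scale, and letting the
  scale tend to zero recovers \<open>g\<close>.
\<close>


section \<open>Smooth and compactly supported functions\<close>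

text \<open>The height of the split and the scale of the kernel share one \<tau> because their costs
  then agree. Let I be the integral of the rearrangement over (0, \<tau>). The part of g above the
  level \<sigma> taken by the rearrangement at \<tau> has L_1 norm at most I, and a kernel at scale
  2^-m has sup norm of order 2^(mn) = 1 / \<tau>. The part below \<sigma> meets the L_1 norm of the
  kernel, which does not depend on the scale, and \<sigma> is at most I / \<tau>. Each part thus
  contributes a multiple of I / \<tau>.

  The split also gives meaning to the averages: a finite source norm puts g into L_1 +
  L_\<infinity>, so they converge absolutely and Fubini applies.

  The Fourier analysis is confined to compactly supported smooth functions. The kernel is the
  transform of such a function, and so is every function against which a frequency piece is tested,
  so inversion is only required there.

  Since \<tau> \<le> 1, the range t < \<tau> only sees the exponents of the logarithm near 0. As |ln
  \<tau>| is proportional to m, a logarithmic loss in \<tau> becomes a power of 1 + m, which is the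
  shift of the smoothness parameter \<gamma>.\<close>

fun diff_upto :: "nat \<Rightarrow> ('a::euclidean_space \<Rightarrow> complex) \<Rightarrow> bool" where
  "diff_upto 0 f \<longleftrightarrow> (\<forall>x. f differentiable at x)"
| "diff_upto (Suc n) f \<longleftrightarrow> (\<forall>x. f differentiable at x) \<and> (\<forall>e\<in>Basis. diff_upto n (partial_deriv e f))"

lemma diff_upto_differentiable: "diff_upto n f \<Longrightarrow> f differentiable at x"
  by (cases n) auto

lemma iter_deriv_Nil [simp]: "iter_deriv [] f = f"
  by (simp add: iter_deriv_def)

lemma iter_deriv_append: "iter_deriv (es @ es') f = iter_deriv es (iter_deriv es' f)"
  by (simp add: iter_deriv_def)

lemma iter_deriv_single [simp]: "iter_deriv [e] f = partial_deriv e f"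
  by (simp add: iter_deriv_def)

text \<open>\<open>iter_deriv\<close> folds from the right, so the last entry of the list is the
  derivative taken first; hence the induction peels lists from the end. The recursive form makes the
  product, dilation and Fourier rules plain inductions on the order, with the function
  generalised.\<close>

lemma diff_upto_iff_iter_deriv:
  "diff_upto n f \<longleftrightarrow> (\<forall>es \<in> lists Basis. length es \<le> n \<longrightarrow> (\<forall>x. iter_deriv es f differentiable at x))"
proof (induction n arbitrary: f)
  case (Suc n)
  show ?case (is "?l = ?r")
  proof
    assume l: ?l
    show ?r
    proof (intro ballI impI allI)
      fix es :: "'a list" and x assume es: "es \<in> lists Basis" "length es \<le> Suc n"
      show "iter_deriv es f differentiable at x"
      proof (cases es rule: rev_cases)
        case (snoc es' e)
        with es l have "diff_upto n (partial_deriv e f)" "es' \<in> lists Basis" "length es' \<le> n" by auto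
        then show ?thesis using Suc by (auto simp: snoc iter_deriv_append)
      qed (use l in auto)
    qed
  next
    assume r: ?r
    have "iter_deriv es (partial_deriv e f) differentiable at x"
      if "e \<in> Basis" "es \<in> lists Basis" "length es \<le> n" for e es x
      using r[rule_format, of "es @ [e]" x] that by (auto simp: iter_deriv_append)
    moreover have "f differentiable at x" for x
      using r[rule_format, of "[]" x] by simp
    ultimately show ?l using Suc by auto
  qed
qed auto

lemma smooth_iff_Ck: "smooth f \<longleftrightarrow> (\<forall>n. diff_upto n f)"
  unfolding smooth_def diff_upto_iff_iter_deriv by blast

lemma smooth_differentiable: "smooth f \<Longrightarrow> f differentiable at x"
  using diff_upto_differentiable smooth_iff_Ck by blast

lemma smooth_partial_deriv: "smooth f \<Longrightarrow> e \<in> Basis \<Longrightarrow> smooth (partial_deriv e f)"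
  unfolding smooth_iff_Ck by (meson diff_upto.simps(2))

lemma smooth_imp_continuous: "smooth f \<Longrightarrow> continuous_on S f"
  by (meson continuous_at_imp_continuous_on differentiable_imp_continuous_within smooth_differentiable)

lemma partial_derivI: "(f has_derivative f') (at x) \<Longrightarrow> partial_deriv e f x = f' e"
  unfolding partial_deriv_def by (metis frechet_derivative_at)

lemma has_derivative_frechet:
  "f differentiable at x \<Longrightarrow> (f has_derivative frechet_derivative f (at x)) (at x)"
  by (simp add: frechet_derivative_works)

lemma partial_deriv_cong_open:
  assumes "open S" "x \<in> S" "\<And>y. y \<in> S \<Longrightarrow> f y = g y" "g differentiable at x"
  shows "f differentiable at x" "partial_deriv e f x = partial_deriv e g x"
proof -
  have d: "(f has_derivative frechet_derivative g (at x)) (at x)"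
    by (rule has_derivative_transform_within_open[OF has_derivative_frechet[OF assms(4)] assms(1,2)])
       (use assms(3) in auto)
  then show "f differentiable at x" by (auto simp: differentiable_def)
  show "partial_deriv e f x = partial_deriv e g x"
    using partial_derivI[OF d] by (simp add: partial_deriv_def)
qed

section \<open>Differentiation rules and closure properties of smooth functions\<close>

lemma partial_deriv_add:
  assumes "\<And>x. f differentiable at x" "\<And>x. g differentiable at x"
  shows "partial_deriv e (\<lambda>x. f x + g x) = (\<lambda>x. partial_deriv e f x + partial_deriv e g x)"
proof
  fix x
  have "((\<lambda>x. f x + g x) has_derivative
          (\<lambda>h. frechet_derivative f (at x) h + frechet_derivative g (at x) h)) (at x)"
    by (intro has_derivative_add has_derivative_frechet assms)
  from partial_derivI[OF this]
  show "partial_deriv e (\<lambda>x. f x + g x) x = partial_deriv e f x + partial_deriv e g x"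
    by (simp add: partial_deriv_def)
qed

lemma partial_deriv_mult:
  fixes f g :: "'a::euclidean_space \<Rightarrow> complex"
  assumes "\<And>x. f differentiable at x" "\<And>x. g differentiable at x"
  shows "partial_deriv e (\<lambda>x. f x * g x) =
    (\<lambda>x. f x * partial_deriv e g x + partial_deriv e f x * g x)"
proof
  fix x
  have "((\<lambda>x. f x * g x) has_derivative
          (\<lambda>h. f x * frechet_derivative g (at x) h + frechet_derivative f (at x) h * g x)) (at x)"
    by (intro has_derivative_mult has_derivative_frechet assms)
  from partial_derivI[OF this]
  show "partial_deriv e (\<lambda>x. f x * g x) x = f x * partial_deriv e g x + partial_deriv e f x * g x"
    by (simp add: partial_deriv_def)
qed

lemma partial_deriv_dilation:
  fixes f :: "'a::euclidean_space \<Rightarrow> complex"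
  assumes "\<And>x. f differentiable at x"
  shows "(\<lambda>x. f (c *\<^sub>R x)) differentiable at x"
    and "partial_deriv e (\<lambda>x. f (c *\<^sub>R x)) = (\<lambda>x. complex_of_real c * partial_deriv e f (c *\<^sub>R x))"
proof -
  have d: "((\<lambda>x. f (c *\<^sub>R x)) has_derivative
          (\<lambda>h. frechet_derivative f (at (c *\<^sub>R x)) (c *\<^sub>R h))) (at x)" for x
    by (rule has_derivative_compose[OF _ has_derivative_frechet[OF assms]])
       (auto intro!: derivative_eq_intros)
  then show "(\<lambda>x. f (c *\<^sub>R x)) differentiable at x"
    by (auto simp: differentiable_def)
  show "partial_deriv e (\<lambda>x. f (c *\<^sub>R x)) = (\<lambda>x. complex_of_real c * partial_deriv e f (c *\<^sub>R x))"
  proof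
    fix x
    have "frechet_derivative f (at (c *\<^sub>R x)) (c *\<^sub>R e) =
        c *\<^sub>R frechet_derivative f (at (c *\<^sub>R x)) e"
      by (rule linear_scale)
         (rule linear_frechet_derivative[OF assms])
    then show "partial_deriv e (\<lambda>x. f (c *\<^sub>R x)) x = complex_of_real c * partial_deriv e f (c *\<^sub>R x)"
      using partial_derivI[OF d] by (simp add: partial_deriv_def scaleR_conv_of_real)
  qed
qed

lemma diff_upto_const: "diff_upto n (\<lambda>x. c)"
proof (induction n arbitrary: c)
  case (Suc n)
  have "partial_deriv e (\<lambda>x::'a. c) = (\<lambda>x. 0)" for e
    using partial_derivI[OF has_derivative_const] by blast
  then show ?case using Suc by auto
qed auto

lemma diff_upto_mono: "diff_upto (Suc n) f \<Longrightarrow> diff_upto n f"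
  by (auto simp: diff_upto_iff_iter_deriv)

lemma diff_upto_add: "diff_upto n f \<Longrightarrow> diff_upto n g \<Longrightarrow> diff_upto n (\<lambda>x. f x + g x)"
proof (induction n arbitrary: f g)
  case (Suc n)
  then show ?case by (auto simp: partial_deriv_add)
qed auto

lemma diff_upto_mult: "diff_upto n f \<Longrightarrow> diff_upto n g \<Longrightarrow> diff_upto n (\<lambda>x. f x * g x)"
proof (induction n arbitrary: f g)
  case (Suc n)
  have "diff_upto n f" "diff_upto n g" using Suc.prems diff_upto_mono by blast+
  then have "diff_upto n (\<lambda>x. f x * partial_deriv e g x + partial_deriv e f x * g x)"
    if "e \<in> Basis" for e
    using Suc that by (intro diff_upto_add) auto
  then show ?case using Suc.prems by (auto simp: partial_deriv_mult)
qed (auto intro: differentiable_mult)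

lemma smooth_const: "smooth (\<lambda>x. c)"
  by (simp add: smooth_iff_Ck diff_upto_const)

lemma smooth_add: "smooth f \<Longrightarrow> smooth g \<Longrightarrow> smooth (\<lambda>x. f x + g x)"
  by (simp add: smooth_iff_Ck diff_upto_add)

lemma smooth_mult: "smooth f \<Longrightarrow> smooth g \<Longrightarrow> smooth (\<lambda>x. f x * g x)"
  by (simp add: smooth_iff_Ck diff_upto_mult)

lemma smooth_dilation:
  assumes "smooth f"
  shows "smooth (\<lambda>x. f (c *\<^sub>R x))"
proof -
  have "diff_upto n f \<Longrightarrow> diff_upto n (\<lambda>x. f (c *\<^sub>R x))" for n and f :: "'a \<Rightarrow> complex"
  proof (induction n arbitrary: f)
    case 0
    then show ?case by (auto intro: partial_deriv_dilation(1))
  next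
    case (Suc n)
    then show ?case
      by (auto simp: partial_deriv_dilation intro!: diff_upto_mult diff_upto_const)
  qed
  then show ?thesis using assms by (simp add: smooth_iff_Ck)
qed

lemma smooth_inner: "smooth (\<lambda>x. complex_of_real (x \<bullet> a))"
proof -
  have d: "((\<lambda>x. complex_of_real (x \<bullet> a)) has_derivative (\<lambda>h. complex_of_real (h \<bullet> a))) (at x)" for x
    by (auto intro!: derivative_eq_intros)
  have "partial_deriv e (\<lambda>x. complex_of_real (x \<bullet> a)) = (\<lambda>x. complex_of_real (e \<bullet> a))" for e
    using partial_derivI[OF d] by blast
  then have "diff_upto n (\<lambda>x. complex_of_real (x \<bullet> a))" for n
    using d by (cases n) (auto simp: differentiable_def intro: diff_upto_const)
  then show ?thesis by (simp add: smooth_iff_Ck)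
qed

lemma has_derivative_character:
  "((\<lambda>x. cis (c * (x \<bullet> a))) has_derivative
     (\<lambda>h. \<i> * complex_of_real (c * (h \<bullet> a)) * cis (c * (x \<bullet> a)))) (at x)"
proof -
  have "((\<lambda>x. \<i> * complex_of_real (c * (x \<bullet> a))) has_derivative
      (\<lambda>h. \<i> * complex_of_real (c * (h \<bullet> a)))) (at x)"
    by (auto intro!: derivative_eq_intros)
  from has_derivative_compose[OF this has_field_derivative_imp_has_derivative[OF DERIV_exp]]
  show ?thesis
    by (simp add: cis_conv_exp mult_ac)
qed

lemma partial_deriv_character:
  "partial_deriv e (\<lambda>x. cis (c * (x \<bullet> a))) =
     (\<lambda>x. \<i> * complex_of_real (c * (e \<bullet> a)) * cis (c * (x \<bullet> a)))"
  using partial_derivI[OF has_derivative_character] by blast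

lemma smooth_character: "smooth (\<lambda>x. cis (c * (x \<bullet> a)))"
proof -
  have d: "(\<lambda>x. cis (c * (x \<bullet> a))) differentiable at x" for x
    using has_derivative_character differentiable_def by blast
  have "diff_upto n (\<lambda>x. cis (c * (x \<bullet> a)))" for n
    by (induction n) (auto simp: partial_deriv_character d intro!: diff_upto_mult diff_upto_const)
  then show ?thesis by (simp add: smooth_iff_Ck)
qed

text \<open>Derivatives depend only on the germ of a function. The local witness \<open>g\<close> is
  smooth to all orders, so the hypothesis passes to each partial derivative and the induction
  closes. It is used for \<open>low_freq\<close>, which is given by different formulas on two
  overlapping open sets.\<close>

lemma smooth_local:
  assumes "\<And>x. \<exists>S g. open S \<and> x \<in> S \<and> smooth g \<and> (\<forall>y\<in>S. f y = g y)"
  shows "smooth f"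
proof -
  have "diff_upto n f" if "\<And>x. \<exists>S g. open S \<and> x \<in> S \<and> smooth g \<and> (\<forall>y\<in>S. f y = g y)"
    for n and f :: "'a \<Rightarrow> complex"
    using that
  proof (induction n arbitrary: f)
    case 0
    have "f differentiable at x" for x
    proof -
      obtain S g where "open S" "x \<in> S" "smooth g" "\<forall>y\<in>S. f y = g y" using "0" by blast
      then show ?thesis
        by (intro partial_deriv_cong_open(1)[of S x f g]) (auto simp: smooth_differentiable)
    qed
    then show ?case by auto
  next
    case (Suc n)
    have "f differentiable at x" for x
    proof -
      obtain S g where "open S" "x \<in> S" "smooth g" "\<forall>y\<in>S. f y = g y" using Suc.prems by blast
      then show ?thesis
        by (intro partial_deriv_cong_open(1)[of S x f g]) (auto simp: smooth_differentiable)
    qed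
    moreover have "diff_upto n (partial_deriv e f)" if e: "e \<in> Basis" for e
    proof (rule Suc.IH)
      fix x
      obtain S g where S: "open S" "x \<in> S" "smooth g" "\<forall>y\<in>S. f y = g y" using Suc.prems by blast
      have "\<forall>y\<in>S. partial_deriv e f y = partial_deriv e g y"
        using S by (intro ballI partial_deriv_cong_open(2)[of S]) (auto simp: smooth_differentiable)
      then show "\<exists>S g. open S \<and> x \<in> S \<and> smooth g \<and> (\<forall>y\<in>S. partial_deriv e f y = g y)"
        using S smooth_partial_deriv[OF S(3) e] by blast
    qed
    ultimately show ?case by auto
  qed
  then show ?thesis using assms by (simp add: smooth_iff_Ck)
qed

text \<open>The class of smooth functions with bounded support: closed under partial derivatives and
  under multiplication by any smooth function, in particular by polynomials and characters.
  Boundedness and integrability come from compactness.\<close>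

definition test_fun :: "('a::euclidean_space \<Rightarrow> complex) \<Rightarrow> bool" where
  "test_fun w \<longleftrightarrow> smooth w \<and> (\<exists>R. \<forall>x. norm x > R \<longrightarrow> w x = 0)"

lemma test_fun_partial_deriv:
  assumes "test_fun w" "e \<in> Basis"
  shows "test_fun (partial_deriv e w)"
proof -
  obtain R where R: "\<And>x. norm x > R \<Longrightarrow> w x = 0" using assms by (auto simp: test_fun_def)
  have "partial_deriv e w x = 0" if "norm x > R" for x
  proof -
    have "partial_deriv e w x = partial_deriv e (\<lambda>x. 0) x"
      by (rule partial_deriv_cong_open(2)[of "- cball 0 R"]) (use R that in auto)
    then show ?thesis using partial_derivI[OF has_derivative_const] by metis
  qed
  then show ?thesis using assms by (auto simp: test_fun_def intro!: smooth_partial_deriv exI[of _ R])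
qed

lemma test_fun_mult: "smooth f \<Longrightarrow> test_fun w \<Longrightarrow> test_fun (\<lambda>x. f x * w x)"
  by (fastforce simp: test_fun_def intro: smooth_mult)

lemma test_fun_iter_deriv: "test_fun w \<Longrightarrow> es \<in> lists Basis \<Longrightarrow> test_fun (iter_deriv es w)"
  by (induction es) (auto simp: iter_deriv_def intro: test_fun_partial_deriv)

lemma test_fun_continuous: "test_fun w \<Longrightarrow> continuous_on S w"
  by (simp add: test_fun_def smooth_imp_continuous)

lemma test_fun_bounded:
  fixes w :: "'a::euclidean_space \<Rightarrow> complex"
  assumes "test_fun w"
  obtains C where "\<And>x. norm (w x) \<le> C"
proof -
  obtain R where R: "\<And>x. norm x > R \<Longrightarrow> w x = 0" using assms by (auto simp: test_fun_def)
  have "bounded (w ` cball 0 R)"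
    by (intro compact_imp_bounded compact_continuous_image test_fun_continuous assms) auto
  then obtain C where C: "\<And>x. norm x \<le> R \<Longrightarrow> norm (w x) \<le> C"
    unfolding bounded_iff by (metis imageI mem_cball_0)
  have "norm (w x) \<le> max C 0" for x
    using C[of x] R[of x] by (cases "norm x \<le> R") auto
  then show ?thesis using that by blast
qed

text \<open>Only finitely many lists of basis vectors have length at most \<open>N\<close>, so
  separate bounds for each list combine into one by taking a maximum.\<close>

lemma schwartzI:
  assumes "smooth f"
    and "\<And>N es. es \<in> lists Basis \<Longrightarrow> \<exists>C. \<forall>x. (1 + norm x) ^ N * norm (iter_deriv es f x) \<le> C"
  shows "f \<in> schwartz"
proof -
  have "schwartz_seminorm N f < \<infinity>" for N
  proof -
    let ?E = "{es \<in> lists (Basis :: 'a set). length es \<le> N}"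
    have fin: "finite ?E"
      using finite_lists_length_le[of "Basis :: 'a set" N] by (simp add: lists_eq_set)
    obtain C where C: "\<And>es x. es \<in> ?E \<Longrightarrow> (1 + norm x) ^ N * norm (iter_deriv es f x) \<le> C es"
      using assms(2)[of _ N] by (atomize_elim, intro choice) auto
    have "schwartz_seminorm N f \<le> ennreal (Max (C ` ?E))"
      unfolding schwartz_seminorm_def
      using fin by (intro SUP_least ennreal_leI) (auto intro!: order_trans[OF C Max_ge])
    also have "\<dots> < \<infinity>" by simp
    finally show ?thesis .
  qed
  with assms(1) show ?thesis by (simp add: schwartz_def)
qed

lemma test_fun_schwartz:
  assumes "test_fun w"
  shows "w \<in> schwartz"
proof (rule schwartzI)
  show "smooth w" using assms by (simp add: test_fun_def)
  fix N and es :: "'a list" assume "es \<in> lists Basis"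
  then have t: "test_fun (iter_deriv es w)" using assms test_fun_iter_deriv by blast
  then obtain R where R: "\<And>x. norm x > R \<Longrightarrow> iter_deriv es w x = 0" by (auto simp: test_fun_def)
  obtain C where C: "\<And>x. norm (iter_deriv es w x) \<le> C" using test_fun_bounded[OF t] by metis
  have C0: "0 \<le> C" using C[of 0] norm_ge_zero order_trans by blast
  have "(1 + norm x) ^ N * norm (iter_deriv es w x) \<le> (1 + \<bar>R\<bar>) ^ N * C" for x
  proof (cases "norm x \<le> R")
    case True
    then show ?thesis using C by (intro mult_mono power_mono) auto
  next
    case False
    then show ?thesis using R[of x] C0 by auto
  qed
  then show "\<exists>C. \<forall>x. (1 + norm x) ^ N * norm (iter_deriv es w x) \<le> C" by blast
qed

section \<open>Fourier transforms of compactly supported smooth functions\<close>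

lemma borel_measurable_cis [measurable (raw)]:
  "f \<in> borel_measurable M \<Longrightarrow> (\<lambda>x. cis (f x)) \<in> borel_measurable M"
  by (rule borel_measurable_continuous_on) (intro continuous_intros)

lemma test_fun_borel: "test_fun w \<Longrightarrow> w \<in> borel_measurable borel"
  by (intro borel_measurable_continuous_onI test_fun_continuous)

lemma test_fun_integrable:
  fixes w :: "'a::euclidean_space \<Rightarrow> complex"
  assumes "test_fun w"
  shows "integrable lborel w"
proof -
  obtain R where R: "\<And>x. norm x > R \<Longrightarrow> w x = 0" using assms by (auto simp: test_fun_def)
  have "integrable lborel (\<lambda>x. indicator (cball 0 R) x *\<^sub>R w x)"
    by (intro borel_integrable_compact test_fun_continuous assms) auto
  also have "(\<lambda>x. indicator (cball 0 R) x *\<^sub>R w x) = w"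
    using R by (auto simp: fun_eq_iff indicator_def not_le)
  finally show ?thesis .
qed

lemma lborel_integral_affine:
  fixes f :: "'a::euclidean_space \<Rightarrow> 'b::{banach, second_countable_topology}" and t :: 'a
  assumes [measurable]: "f \<in> borel_measurable borel" and "c \<noteq> 0"
  shows "(LINT x|lborel. f x) = \<bar>c\<bar> ^ DIM('a) *\<^sub>R (LINT x|lborel. f (t + c *\<^sub>R x))"
proof -
  have "(LINT x|lborel. f x) =
      (LINT x|density (distr lborel borel (\<lambda>x. t + c *\<^sub>R x)) (\<lambda>_. \<bar>c\<bar> ^ DIM('a)). f x)"
    using lborel_affine[OF \<open>c \<noteq> 0\<close>, of t] by simp
  also have "\<dots> = (LINT x|distr lborel borel (\<lambda>x. t + c *\<^sub>R x). (\<bar>c\<bar> ^ DIM('a)) *\<^sub>R f x)"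
    by (subst integral_density) auto
  also have "\<dots> = (LINT x|lborel. (\<bar>c\<bar> ^ DIM('a)) *\<^sub>R f (t + c *\<^sub>R x))"
    by (subst integral_distr) auto
  finally show ?thesis by simp
qed

lemma integrable_character_mult:
  fixes w :: "'a::euclidean_space \<Rightarrow> complex"
  assumes "integrable lborel w"
  shows "integrable lborel (\<lambda>x. cis (c * (x \<bullet> a)) * w x)"
    and "integrable lborel (\<lambda>x. cis (- (c * (x \<bullet> a))) * w x)"
proof -
  note [measurable] = borel_measurable_integrable[OF assms]
  show "integrable lborel (\<lambda>x. cis (c * (x \<bullet> a)) * w x)"
    by (rule Bochner_Integration.integrable_bound[OF assms]) (auto simp: norm_mult)
  show "integrable lborel (\<lambda>x. cis (- (c * (x \<bullet> a))) * w x)"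
    by (rule Bochner_Integration.integrable_bound[OF assms]) (auto simp: norm_mult)
qed

lemma norm_fourier_le: "norm (fourier w \<xi>) \<le> (LINT x|lborel. norm (w x))"
  unfolding fourier_def
  by (rule order_trans[OF integral_norm_bound]) (simp add: norm_mult)

text \<open>Prepares differentiation under the integral sign: an integrable second-order remainder
  replaces a limit argument for difference quotients.\<close>

lemma has_derivative_quadratic:
  fixes f :: "'a::real_normed_vector \<Rightarrow> 'b::real_normed_vector"
  assumes "bounded_linear L" "\<And>y. norm (f y - f x - L (y - x)) \<le> C * (norm (y - x))\<^sup>2"
  shows "(f has_derivative L) (at x)"
  unfolding has_derivative_iff_norm
proof (intro conjI assms(1))
  have "((\<lambda>y. C * norm (y - x)) \<longlongrightarrow> C * norm (x - x)) (at x)"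
    by (intro tendsto_intros)
  then have lim: "((\<lambda>y. C * norm (y - x)) \<longlongrightarrow> 0) (at x)" by simp
  show "((\<lambda>y. norm (f y - f x - L (y - x)) / norm (y - x)) \<longlongrightarrow> 0) (at x)"
  proof (rule tendsto_sandwich[OF _ _ tendsto_const lim])
    show "\<forall>\<^sub>F y in at x. norm (f y - f x - L (y - x)) / norm (y - x) \<le> C * norm (y - x)"
      unfolding eventually_at_filter
    proof (intro always_eventually allI impI)
      fix y assume "y \<noteq> x"
      then have "0 < norm (y - x)" by simp
      then show "norm (f y - f x - L (y - x)) / norm (y - x) \<le> C * norm (y - x)"
        using assms(2)[of y] by (simp add: pos_divide_le_eq power2_eq_square mult.assoc)
    qed
  qed auto
qed

lemma norm_cis_minus_linear: "norm (cis s - 1 - \<i> * complex_of_real s) \<le> s\<^sup>2 / 2"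
  using iexp_approx1[of s 1]
  by (simp add: cis_conv_exp power2_eq_square diff_diff_eq)

lemma test_fun_mult_inner:
  "test_fun w \<Longrightarrow> test_fun (\<lambda>x. c * complex_of_real (x \<bullet> a) * w x)"
  by (intro test_fun_mult smooth_mult smooth_const smooth_inner)

text \<open>The Taylor estimate for \<open>cis\<close> bounds the remainder by a constant times
  |x|^2 |w x| |y - \<xi>|^2, and |x|^2 w is again a test function, hence integrable.\<close>

lemma fourier_has_derivative:
  fixes w :: "'a::euclidean_space \<Rightarrow> complex"
  assumes w: "test_fun w"
  shows "(fourier w has_derivative
    (\<lambda>h. fourier (\<lambda>x. - (2 * pi * \<i>) * complex_of_real (x \<bullet> h) * w x) \<xi>)) (at \<xi>)"
proof -
  note [measurable] = test_fun_borel[OF w]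
  define k where "k = (\<lambda>h (x::'a). - (2 * pi * \<i>) * complex_of_real (x \<bullet> h) * w x)"
  have tk: "test_fun (k h)" for h
    unfolding k_def by (rule test_fun_mult_inner[OF w])
  have int: "integrable lborel (\<lambda>x. cis (- (2 * pi * (x \<bullet> y))) * v x)" if "test_fun v" for y and v :: "'a \<Rightarrow> complex"
    by (rule integrable_character_mult(2)[OF test_fun_integrable[OF that]])
  have t2: "test_fun (\<lambda>x. complex_of_real (norm x ^ 2) * w x)"
  proof -
    have "smooth (\<lambda>x::'a. \<Sum>b\<in>B. complex_of_real (x \<bullet> b) * complex_of_real (x \<bullet> b))" if "finite B" for B
      using that by (induction B) (auto intro!: smooth_add smooth_mult smooth_const smooth_inner)
    moreover have "complex_of_real (norm x ^ 2) =
        (\<Sum>b\<in>Basis. complex_of_real (x \<bullet> b) * complex_of_real (x \<bullet> b))" for x :: 'a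
      by (subst power2_norm_eq_inner, subst euclidean_inner) simp
    ultimately have "smooth (\<lambda>x::'a. complex_of_real (norm x ^ 2))" by simp
    then show ?thesis by (rule test_fun_mult[OF _ w])
  qed
  define C where "C = (LINT x|lborel. 2 * pi\<^sup>2 * norm (complex_of_real (norm x ^ 2) * w x))"
  have "(fourier w has_derivative (\<lambda>h. fourier (k h) \<xi>)) (at \<xi>)"
  proof (rule has_derivative_quadratic)
    have add: "fourier (k (h + h')) \<xi> = fourier (k h) \<xi> + fourier (k h') \<xi>" for h h'
      unfolding fourier_def
      by (subst Bochner_Integration.integral_add[symmetric, OF int[OF tk] int[OF tk]])
         (simp add: k_def algebra_simps)
    have scale: "fourier (k (r *\<^sub>R h)) \<xi> = r *\<^sub>R fourier (k h) \<xi>" for r h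
      unfolding fourier_def
      by (subst integral_scaleR_right[symmetric])
         (simp add: k_def algebra_simps scaleR_conv_of_real)
    show "bounded_linear (\<lambda>h. fourier (k h) \<xi>)"
      by (intro linear_conv_bounded_linear[THEN iffD1] linearI add scale)
    fix y
    have "fourier w y - fourier w \<xi> - fourier (k (y - \<xi>)) \<xi> =
       (LINT x|lborel. cis (- (2 * pi * (x \<bullet> y))) * w x - cis (- (2 * pi * (x \<bullet> \<xi>))) * w x
          - cis (- (2 * pi * (x \<bullet> \<xi>))) * k (y - \<xi>) x)"
      unfolding fourier_def
      by (subst Bochner_Integration.integral_diff)
         (auto intro!: int tk w Bochner_Integration.integrable_diff simp: Bochner_Integration.integral_diff int tk w)
    also have "norm \<dots> \<le> (LINT x|lborel. 2 * pi\<^sup>2 * norm (complex_of_real (norm x ^ 2) * w x) * (norm (y - \<xi>))\<^sup>2)"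
    proof (rule Bochner_Integration.integral_norm_bound_integral)
      show "integrable lborel (\<lambda>x. 2 * pi\<^sup>2 * norm (complex_of_real (norm x ^ 2) * w x) * (norm (y - \<xi>))\<^sup>2)"
        by (intro integrable_mult_left integrable_mult_right integrable_norm test_fun_integrable t2)
      fix x :: 'a
      \<comment> \<open>The change of phase from \<xi> to \<open>y\<close>. Its first-order term
        \<i> s w(x) is exactly \<open>k (y - \<xi>) x\<close>, so only the remainder of
        \<open>cis s\<close> survives.\<close>
      define s where "s = - (2 * pi * (x \<bullet> (y - \<xi>)))"
      have c: "cis (- (2 * pi * (x \<bullet> y))) = cis (- (2 * pi * (x \<bullet> \<xi>))) * cis s"
        by (simp add: cis_mult s_def algebra_simps inner_diff_right)
      have "cis (- (2 * pi * (x \<bullet> y))) * w x - cis (- (2 * pi * (x \<bullet> \<xi>))) * w x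
          - cis (- (2 * pi * (x \<bullet> \<xi>))) * k (y - \<xi>) x
        = cis (- (2 * pi * (x \<bullet> \<xi>))) * w x * (cis s - 1 - \<i> * complex_of_real s)"
        unfolding c k_def by (simp add: s_def algebra_simps)
      also have "norm \<dots> \<le> norm (w x) * (s\<^sup>2 / 2)"
        using mult_left_mono[OF norm_cis_minus_linear[of s], of "norm (w x)"] by (simp add: norm_mult)
      also have "\<dots> \<le> norm (w x) * (2 * pi\<^sup>2 * ((norm x)\<^sup>2 * (norm (y - \<xi>))\<^sup>2))"
      proof -
        have "s\<^sup>2 = (2 * pi)\<^sup>2 * \<bar>x \<bullet> (y - \<xi>)\<bar>\<^sup>2"
          by (simp add: s_def power_mult_distrib)
        also have "\<dots> \<le> (2 * pi)\<^sup>2 * (norm x * norm (y - \<xi>))\<^sup>2"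
          by (intro mult_left_mono power_mono Cauchy_Schwarz_ineq2) auto
        finally show ?thesis by (intro mult_left_mono) (auto simp: power_mult_distrib)
      qed
      finally show "norm (cis (- (2 * pi * (x \<bullet> y))) * w x - cis (- (2 * pi * (x \<bullet> \<xi>))) * w x
          - cis (- (2 * pi * (x \<bullet> \<xi>))) * k (y - \<xi>) x)
          \<le> 2 * pi\<^sup>2 * norm (complex_of_real (norm x ^ 2) * w x) * (norm (y - \<xi>))\<^sup>2"
        by (simp add: norm_mult norm_power mult_ac)
    qed (auto intro!: int tk w Bochner_Integration.integrable_diff)
    also have "\<dots> = C * (norm (y - \<xi>))\<^sup>2"
      by (simp add: C_def)
    finally show "norm (fourier w y - fourier w \<xi> - fourier (k (y - \<xi>)) \<xi>) \<le> C * (norm (y - \<xi>))\<^sup>2" .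
  qed
  then show ?thesis by (simp add: k_def)
qed

lemma partial_deriv_fourier:
  "test_fun w \<Longrightarrow> partial_deriv e (fourier w) =
     fourier (\<lambda>x. - (2 * pi * \<i>) * complex_of_real (x \<bullet> e) * w x)"
  using partial_derivI[OF fourier_has_derivative] by blast

lemma fourier_differentiable: "test_fun w \<Longrightarrow> fourier w differentiable at \<xi>"
  using fourier_has_derivative differentiable_def by blast

text \<open>A derivative of a transform is the transform of a polynomial multiple of
  \<open>w\<close>, which is again a test function; the induction therefore runs over all
  \<open>w\<close> at once.\<close>

lemma smooth_fourier:
  fixes w :: "'a::euclidean_space \<Rightarrow> complex"
  assumes "test_fun w"
  shows "smooth (fourier w)"
proof -
  have "test_fun w \<Longrightarrow> diff_upto n (fourier w)" for n and w :: "'a \<Rightarrow> complex"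
  proof (induction n arbitrary: w)
    case (Suc n)
    show ?case
      unfolding diff_upto.simps partial_deriv_fourier[OF Suc.prems]
      by (intro conjI allI ballI fourier_differentiable Suc.prems Suc.IH test_fun_mult_inner)
  qed (simp add: fourier_differentiable)
  then show ?thesis using assms by (simp add: smooth_iff_Ck)
qed

lemma integral_lborel_eq_integral_cbox:
  fixes f :: "'a::euclidean_space \<Rightarrow> complex"
  assumes "integrable lborel f" "\<And>x. x \<notin> cbox a b \<Longrightarrow> f x = 0"
  shows "(LINT x|lborel. f x) = integral (cbox a b) f"
proof -
  have "(\<lambda>x. if x \<in> cbox a b then f x else 0) = f" using assms(2) by auto
  then have "integral (cbox a b) f = integral UNIV f"
    by (metis integral_restrict_UNIV)
  then show ?thesis using integral_lborel[OF assms(1)] by simp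
qed

text \<open>In place of integration by parts, the translates of \<open>w\<close> along
  \<open>e\<close> are used: by a change of variables the transform of w(x + t e) is the character
  cis(2 pi t (e \<bullet> \<xi>)) times that of \<open>w\<close>, and both expressions are
  differentiated at t = 0.\<close>

lemma fourier_of_partial_deriv:
  fixes w :: "'a::euclidean_space \<Rightarrow> complex"
  assumes w: "test_fun w" and e: "e \<in> Basis"
  shows "fourier (partial_deriv e w) \<xi> = 2 * pi * \<i> * complex_of_real (e \<bullet> \<xi>) * fourier w \<xi>"
proof -
  note [measurable] = test_fun_borel[OF w] test_fun_borel[OF test_fun_partial_deriv[OF w e]]
  obtain R where R: "\<And>x. norm x > R \<Longrightarrow> w x = 0" using w by (auto simp: test_fun_def)
  \<comment> \<open>The margin 1 allows for shifts by \<open>t *\<^sub>R e\<close> with |t| < 1: one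
    box contains all shifted supports, so the rule for differentiating a parametric integral over a
    fixed box applies.\<close>
  obtain c where c: "cball (0::'a) (R + 1) \<subseteq> cbox (- c) c"
    using bounded_subset_cbox_symmetric[of "cball (0::'a) (R + 1)"] by auto
  define f where "f = (\<lambda>t x. cis (- (2 * pi * (x \<bullet> \<xi>))) * w (x + t *\<^sub>R e))"
  define f' where "f' = (\<lambda>t x. cis (- (2 * pi * (x \<bullet> \<xi>))) * partial_deriv e w (x + t *\<^sub>R e))"
  have zero: "w (x + t *\<^sub>R e) = 0" "partial_deriv e w (x + t *\<^sub>R e) = 0"
    if "x \<notin> cbox (- c) c" "t \<in> ball 0 1" for x t
  proof -
    have "norm x > R + 1" using c that(1) by force
    moreover have "norm x \<le> norm (x + t *\<^sub>R e) + norm (t *\<^sub>R e)"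
      by (metis add_diff_cancel norm_triangle_ineq4)
    moreover have "norm (t *\<^sub>R e) < 1" using that(2) e by simp
    ultimately have n: "norm (x + t *\<^sub>R e) > R" by simp
    then show "w (x + t *\<^sub>R e) = 0" by (rule R)
    have "partial_deriv e w (x + t *\<^sub>R e) = partial_deriv e (\<lambda>x. 0) (x + t *\<^sub>R e)"
      by (rule partial_deriv_cong_open(2)[of "- cball 0 R"]) (use R n in auto)
    then show "partial_deriv e w (x + t *\<^sub>R e) = 0"
      using partial_derivI[OF has_derivative_const] by metis
  qed
  have trans: "integrable lborel (\<lambda>x. v (x + t *\<^sub>R e))"
    if "integrable lborel v" for v :: "'a \<Rightarrow> complex" and t
    using that by (subst (asm) lborel_distr_plus[of "t *\<^sub>R e", symmetric], subst (asm) integrable_distr_eq)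
       (auto simp: add.commute)
  have int: "integrable lborel (f t)" "integrable lborel (f' t)" for t
    unfolding f_def f'_def
    by (intro integrable_character_mult(2) trans test_fun_integrable w test_fun_partial_deriv e)+
  have cw: "continuous_on UNIV w" "continuous_on UNIV (partial_deriv e w)"
    using w e by (auto intro: test_fun_continuous test_fun_partial_deriv)
  have "((\<lambda>t. integral (cbox (- c) c) (f t)) has_vector_derivative integral (cbox (- c) c) (f' 0))
      (at 0 within ball 0 1)"
  proof (rule leibniz_rule_vector_derivative)
    fix t x
    have "((\<lambda>t. w (x + t *\<^sub>R e)) has_derivative (\<lambda>h. frechet_derivative w (at (x + t *\<^sub>R e)) (h *\<^sub>R e))) (at t)"
      by (rule has_derivative_compose[OF _ has_derivative_frechet])
         (use w in \<open>auto intro!: derivative_eq_intros smooth_differentiable simp: test_fun_def\<close>)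
    moreover have "frechet_derivative w (at (x + t *\<^sub>R e)) (h *\<^sub>R e) = h *\<^sub>R partial_deriv e w (x + t *\<^sub>R e)" for h
      unfolding partial_deriv_def
      by (rule linear_scale, rule linear_frechet_derivative)
         (use w in \<open>auto intro!: smooth_differentiable simp: test_fun_def\<close>)
    ultimately have "((\<lambda>t. w (x + t *\<^sub>R e)) has_vector_derivative partial_deriv e w (x + t *\<^sub>R e)) (at t)"
      by (simp add: has_vector_derivative_def)
    then have "((\<lambda>t. f t x) has_vector_derivative f' t x) (at t)"
      unfolding f_def f'_def by (rule has_vector_derivative_mult_right)
    then show "((\<lambda>t. f t x) has_vector_derivative f' t x) (at t within ball 0 1)"
      by (rule has_vector_derivative_at_within)
  next
    show "f t integrable_on cbox (- c) c" for t
      unfolding f_def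
      by (intro integrable_continuous continuous_intros continuous_on_compose2[OF cw(1)]) auto
    show "continuous_on (ball 0 1 \<times> cbox (- c) c) (\<lambda>(t, x). f' t x)"
      unfolding f'_def case_prod_beta
      by (intro continuous_intros continuous_on_compose2[OF cw(2)]) auto
  qed auto
  then have "((\<lambda>t. integral (cbox (- c) c) (f t)) has_vector_derivative integral (cbox (- c) c) (f' 0)) (at 0)"
    by (subst (asm) at_within_open) auto
  moreover have eq: "integral (cbox (- c) c) (f t) = cis (2 * pi * t * (e \<bullet> \<xi>)) * fourier w \<xi>"
    if "t \<in> ball 0 1" for t
  proof -
    have "integral (cbox (- c) c) (f t) = (LINT x|lborel. f t x)"
      by (rule integral_lborel_eq_integral_cbox[symmetric]) (use int zero that in \<open>auto simp: f_def\<close>)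
    also have "\<dots> = (LINT x|lborel. f t (- t *\<^sub>R e + 1 *\<^sub>R x))"
      by (subst lborel_integral_affine[of _ 1 "- t *\<^sub>R e"]) (auto simp: f_def)
    also have "\<dots> = (LINT x|lborel. cis (2 * pi * t * (e \<bullet> \<xi>)) * (cis (- (2 * pi * (x \<bullet> \<xi>))) * w x))"
    proof (intro Bochner_Integration.integral_cong refl)
      fix x
      have "cis (- (2 * pi * ((- t *\<^sub>R e + 1 *\<^sub>R x) \<bullet> \<xi>))) =
          cis (2 * pi * t * (e \<bullet> \<xi>)) * cis (- (2 * pi * (x \<bullet> \<xi>)))"
        by (simp add: cis_mult inner_add_left inner_diff_left algebra_simps)
      then show "f t (- t *\<^sub>R e + 1 *\<^sub>R x) =
          cis (2 * pi * t * (e \<bullet> \<xi>)) * (cis (- (2 * pi * (x \<bullet> \<xi>))) * w x)"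
        unfolding f_def by (simp only: mult.assoc) simp
    qed
    finally show ?thesis by (simp add: fourier_def)
  qed
  have "((\<lambda>t. cis (2 * pi * t * (e \<bullet> \<xi>)) * fourier w \<xi>) has_vector_derivative integral (cbox (- c) c) (f' 0)) (at 0)"
    by (rule has_vector_derivative_transform_within_open[OF calculation, of "ball 0 1"]) (use eq in auto)
  moreover have "((\<lambda>t. cis (2 * pi * t * (e \<bullet> \<xi>)) * fourier w \<xi>) has_vector_derivative
      2 * pi * \<i> * complex_of_real (e \<bullet> \<xi>) * fourier w \<xi>) (at 0)"
  proof -
    have "((\<lambda>t. cis ((2 * pi * (e \<bullet> \<xi>)) * (t \<bullet> 1)) * fourier w \<xi>) has_derivative
       (\<lambda>h. \<i> * complex_of_real ((2 * pi * (e \<bullet> \<xi>)) * (h \<bullet> 1)) * cis ((2 * pi * (e \<bullet> \<xi>)) * ((0::real) \<bullet> 1)) * fourier w \<xi>)) (at (0::real))"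
      by (intro has_derivative_mult_left has_derivative_character)
    then show ?thesis
      by (simp add: has_vector_derivative_def scaleR_conv_of_real mult_ac)
  qed
  ultimately have "integral (cbox (- c) c) (f' 0) = 2 * pi * \<i> * complex_of_real (e \<bullet> \<xi>) * fourier w \<xi>"
    using vector_derivative_unique_at by blast
  moreover have "integral (cbox (- c) c) (f' 0) = fourier (partial_deriv e w) \<xi>"
    unfolding fourier_def
    by (subst integral_lborel_eq_integral_cbox[of _ "- c" c])
       (use int(2)[of 0] zero(2)[of _ 0] in \<open>auto simp: f'_def\<close>)
  ultimately show ?thesis by simp
qed

text \<open>Each further factor |\<xi>| is at most the sum of the |\<xi> \<bullet> e|, and each of
  these is absorbed by passing from \<open>w\<close> to its partial derivative along
  \<open>e\<close>. The induction hypothesis is needed for those derivatives too, so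
  \<open>w\<close> varies.\<close>

lemma fourier_decay:
  fixes w :: "'a::euclidean_space \<Rightarrow> complex"
  assumes "test_fun w"
  shows "\<exists>C. \<forall>\<xi>. (1 + norm \<xi>) ^ N * norm (fourier w \<xi>) \<le> C"
  using assms
proof (induction N arbitrary: w)
  case 0
  then show ?case using norm_fourier_le by auto
next
  case (Suc N)
  obtain C where C: "\<And>\<xi>. (1 + norm \<xi>) ^ N * norm (fourier w \<xi>) \<le> C"
    using Suc by blast
  have "\<exists>D. \<forall>\<xi>. (1 + norm \<xi>) ^ N * norm (fourier (partial_deriv e w) \<xi>) \<le> D" if "e \<in> Basis" for e
    using Suc.IH[OF test_fun_partial_deriv[OF Suc.prems that]] .
  then obtain D where D: "\<And>e \<xi>. e \<in> Basis \<Longrightarrow> (1 + norm \<xi>) ^ N * norm (fourier (partial_deriv e w) \<xi>) \<le> D e"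
    by metis
  have "(1 + norm \<xi>) ^ Suc N * norm (fourier w \<xi>) \<le> C + (\<Sum>e\<in>Basis. D e)" for \<xi>
  proof -
    have "norm \<xi> * norm (fourier w \<xi>) \<le> (\<Sum>e\<in>Basis. \<bar>\<xi> \<bullet> e\<bar>) * norm (fourier w \<xi>)"
      by (intro mult_right_mono norm_le_l1) auto
    also have "\<dots> = (\<Sum>e\<in>Basis. \<bar>\<xi> \<bullet> e\<bar> * norm (fourier w \<xi>))"
      by (rule sum_distrib_right)
    also have "\<dots> \<le> (\<Sum>e\<in>Basis. norm (fourier (partial_deriv e w) \<xi>))"
    proof (rule sum_mono)
      fix e :: 'a assume e: "e \<in> Basis"
      have "\<bar>\<xi> \<bullet> e\<bar> * norm (fourier w \<xi>) * 1 \<le> \<bar>\<xi> \<bullet> e\<bar> * norm (fourier w \<xi>) * (2 * pi)"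
        using pi_ge_two by (intro mult_left_mono) auto
      also have "\<dots> = norm (fourier (partial_deriv e w) \<xi>)"
        by (simp add: fourier_of_partial_deriv[OF Suc.prems e] norm_mult inner_commute)
      finally show "\<bar>\<xi> \<bullet> e\<bar> * norm (fourier w \<xi>) \<le> norm (fourier (partial_deriv e w) \<xi>)" by simp
    qed
    finally have "(1 + norm \<xi>) ^ N * (norm \<xi> * norm (fourier w \<xi>)) \<le>
        (1 + norm \<xi>) ^ N * (\<Sum>e\<in>Basis. norm (fourier (partial_deriv e w) \<xi>))"
      by (intro mult_left_mono) auto
    also have "\<dots> = (\<Sum>e\<in>Basis. (1 + norm \<xi>) ^ N * norm (fourier (partial_deriv e w) \<xi>))"
      by (rule sum_distrib_left)
    also have "\<dots> \<le> (\<Sum>e\<in>Basis. D e)"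
      by (intro sum_mono D)
    finally show ?thesis using C[of \<xi>] by (simp add: algebra_simps)
  qed
  then show ?case by blast
qed

text \<open>Derivatives of the transform are transforms of polynomial multiples of \<open>w\<close>,
  so decay of transforms of test functions settles all seminorms. The list is again consumed from
  its end, where the first derivative sits.\<close>

lemma fourier_schwartz:
  fixes w :: "'a::euclidean_space \<Rightarrow> complex"
  assumes "test_fun w"
  shows "fourier w \<in> schwartz"
proof (rule schwartzI[OF smooth_fourier[OF assms]])
  fix N and es :: "'a list" assume "es \<in> lists Basis"
  then show "\<exists>C. \<forall>x. (1 + norm x) ^ N * norm (iter_deriv es (fourier w) x) \<le> C"
    using assms
  proof (induction es arbitrary: w rule: rev_induct)
    case Nil
    then show ?case using fourier_decay by simp
  next
    case (snoc e es)
    then have "es \<in> lists Basis" by simp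
    then show ?case
      unfolding iter_deriv_append iter_deriv_single partial_deriv_fourier[OF snoc.prems(2)]
      by (rule snoc.IH[OF _ test_fun_mult_inner[OF snoc.prems(2)]])
  qed
qed

section \<open>Gaussian regularisation and Fourier inversion\<close>

lemma lborel_integrable_affine:
  fixes f :: "'a::euclidean_space \<Rightarrow> 'b::{banach, second_countable_topology}" and t :: 'a
  assumes f: "integrable lborel f" and "c \<noteq> 0"
  shows "integrable lborel (\<lambda>x. f (t + c *\<^sub>R x))"
proof -
  have [measurable]: "f \<in> borel_measurable borel" using borel_measurable_integrable[OF f] by simp
  have "integrable (density (distr lborel borel (\<lambda>x. t + c *\<^sub>R x)) (\<lambda>_. \<bar>c\<bar> ^ DIM('a))) f"
    using f lborel_affine[OF \<open>c \<noteq> 0\<close>, of t] by metis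
  then have "integrable lborel (\<lambda>x. \<bar>c\<bar> ^ DIM('a) *\<^sub>R f (t + c *\<^sub>R x))"
    by (subst (asm) integrable_density) (auto simp: integrable_distr_eq)
  then have "integrable lborel (\<lambda>x. inverse (\<bar>c\<bar> ^ DIM('a)) *\<^sub>R \<bar>c\<bar> ^ DIM('a) *\<^sub>R f (t + c *\<^sub>R x))"
    by (rule integrable_scaleR_right)
  then show ?thesis using \<open>c \<noteq> 0\<close> by simp
qed

lemma lborel_integral_prod_Basis:
  fixes f :: "'a::euclidean_space \<Rightarrow> real \<Rightarrow> 'b::{real_normed_field,banach,second_countable_topology}"
  assumes int: "\<And>b. b \<in> Basis \<Longrightarrow> integrable lborel (f b)"
  shows "integrable lborel (\<lambda>x::'a. \<Prod>b\<in>Basis. f b (x \<bullet> b))"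
    and "(LINT x|lborel. (\<Prod>b\<in>Basis. f b (x \<bullet> b))) = (\<Prod>b\<in>Basis. LINT t|lborel. f b t)"
proof -
  interpret product_sigma_finite "\<lambda>_::'a. lborel :: real measure" ..
  have m[measurable]: "(\<lambda>x::'a. \<Prod>b\<in>Basis. f b (x \<bullet> b)) \<in> borel_measurable borel"
  proof (intro borel_measurable_prod)
    fix b :: 'a assume "b \<in> Basis"
    then have [measurable]: "f b \<in> borel_measurable borel"
      using borel_measurable_integrable[OF int] by simp
    show "(\<lambda>x::'a. f b (x \<bullet> b)) \<in> borel_measurable borel" by measurable
  qed
  let ?P = "\<Pi>\<^sub>M b\<in>(Basis::'a set). (lborel :: real measure)"
  let ?T = "\<lambda>g::'a \<Rightarrow> real. \<Sum>b\<in>Basis. g b *\<^sub>R b"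
  have T: "?T \<in> ?P \<rightarrow>\<^sub>M borel" by measurable
  have eq: "(\<Prod>b\<in>Basis. f b (?T g \<bullet> b)) = (\<Prod>b\<in>Basis. f b (g b))" for g
    by (intro prod.cong) (auto simp: inner_sum_left_Basis)
  have "integrable ?P (\<lambda>g. \<Prod>b\<in>Basis. f b (g b))"
    by (rule product_integrable_prod) (use int in auto)
  then show "integrable lborel (\<lambda>x::'a. \<Prod>b\<in>Basis. f b (x \<bullet> b))"
    by (subst lborel_eq, subst integrable_distr_eq[OF T m]) (simp only: eq)
  show "(LINT x|lborel. (\<Prod>b\<in>Basis. f b (x \<bullet> b))) = (\<Prod>b\<in>Basis. LINT t|lborel. f b t)"
    by (subst lborel_eq, subst integral_distr[OF T m], unfold eq, rule product_integral_prod)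
       (use int in auto)
qed

text \<open>Decay of order 2n suffices: (1 + |x|)^(2n) dominates the product over the coordinates of
  1 + (x \<bullet> b)^2, whose reciprocal is a tensor product of integrable functions of one
  variable.\<close>

lemma integrable_fourier:
  fixes w :: "'a::euclidean_space \<Rightarrow> complex"
  assumes w: "test_fun w"
  shows "integrable lborel (fourier w)"
proof -
  have [measurable]: "fourier w \<in> borel_measurable borel"
    by (intro borel_measurable_continuous_onI smooth_imp_continuous smooth_fourier w)
  obtain C where C: "\<And>\<xi>. (1 + norm \<xi>) ^ (2 * DIM('a)) * norm (fourier w \<xi>) \<le> C"
    using fourier_decay[OF w] by blast
  have "integrable lborel (\<lambda>t::real. inverse (1 + t\<^sup>2))"
    using integrable_inverse_1_plus_square by (simp add: set_integrable_def einterval_def)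
  then have int: "integrable lborel (\<lambda>x::'a. C * (\<Prod>b\<in>Basis. inverse (1 + (x \<bullet> b)\<^sup>2)))"
    by (intro integrable_mult_right lborel_integral_prod_Basis)
  show ?thesis
  proof (rule Bochner_Integration.integrable_bound[OF int])
    have "norm (fourier w x) \<le> C * (\<Prod>b\<in>Basis. inverse (1 + (x \<bullet> b)\<^sup>2))" for x
    proof -
      have "(\<Prod>b\<in>Basis. 1 + (x \<bullet> b)\<^sup>2) \<le> (\<Prod>b\<in>(Basis::'a set). (1 + norm x)\<^sup>2)"
      proof (intro prod_mono conjI)
        fix b :: 'a assume "b \<in> Basis"
        then have "(x \<bullet> b)\<^sup>2 \<le> (norm x)\<^sup>2" by (simp add: Basis_le_norm abs_le_square_iff[symmetric])
        then show "1 + (x \<bullet> b)\<^sup>2 \<le> (1 + norm x)\<^sup>2"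
          using norm_ge_zero[of x] unfolding power2_sum by (smt (verit) mult_nonneg_nonneg one_power2)
      qed auto
      also have "\<dots> = (1 + norm x) ^ (2 * DIM('a))" by (simp add: power_mult)
      finally have "(\<Prod>b\<in>Basis. 1 + (x \<bullet> b)\<^sup>2) * norm (fourier w x) \<le> (1 + norm x) ^ (2 * DIM('a)) * norm (fourier w x)"
        by (rule mult_right_mono) simp
      also note C
      finally have le: "(\<Prod>b\<in>Basis. 1 + (x \<bullet> b)\<^sup>2) * norm (fourier w x) \<le> C" .
      have "0 < (\<Prod>b\<in>Basis. 1 + (x \<bullet> b)\<^sup>2)"
        by (intro prod_pos) (simp add: add_pos_nonneg)
      moreover have "(\<Prod>b\<in>Basis. inverse (1 + (x \<bullet> b)\<^sup>2)) = inverse (\<Prod>b\<in>Basis. 1 + (x \<bullet> b)\<^sup>2)"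
        by (simp add: prod_inversef[symmetric])
      ultimately show ?thesis using le by (simp add: field_simps)
    qed
    then show "AE x in lborel. norm (fourier w x) \<le> norm (C * (\<Prod>b\<in>Basis. inverse (1 + (x \<bullet> b)\<^sup>2)))"
      by (intro AE_I2) (metis abs_ge_self order_trans real_norm_def)
  qed simp
qed

text \<open>Read off from the characteristic function of the standard normal law at -2 pi t. With 2
  pi in the exponent of the transform, the result is the normal density of standard deviation 1 / (2
  pi), so its total mass 1 comes for free.\<close>

lemma gaussian_fourier_1d:
  fixes t :: real
  shows "integrable lborel (\<lambda>s. cis (- (2 * pi * (t * s))) * exp (- s\<^sup>2 / 2))"
    and "(LINT s|lborel. cis (- (2 * pi * (t * s))) * exp (- s\<^sup>2 / 2)) =
      complex_of_real (normal_density 0 (1 / (2 * pi)) t)"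
proof -
  have eq: "exp (- s\<^sup>2 / 2) = sqrt (2 * pi) * std_normal_density s" for s :: real
    by (simp add: std_normal_density_def)
  have i: "integrable lborel (\<lambda>s. complex_of_real (sqrt (2 * pi) * std_normal_density s))"
    by (intro integrable_of_real integrable_mult_right) (auto intro: integrable_normal_density)
  show "integrable lborel (\<lambda>s. cis (- (2 * pi * (t * s))) * exp (- s\<^sup>2 / 2))"
    by (rule Bochner_Integration.integrable_bound[OF i]) (simp_all add: norm_mult std_normal_density_def)
  have "complex_of_real (exp (- ((- (2 * pi * t))\<^sup>2) / 2)) = char std_normal_distribution (- (2 * pi * t))"
    by (simp add: char_std_normal_distribution)
  also have "\<dots> = (LINT s|lborel. std_normal_density s *\<^sub>R iexp (- (2 * pi * t) * s))"
    unfolding char_def by (subst integral_density) (auto simp: normal_density_nonneg)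
  finally have "(LINT s|lborel. std_normal_density s *\<^sub>R iexp (- (2 * pi * t) * s)) =
      complex_of_real (exp (- ((2 * pi * t)\<^sup>2) / 2))" by simp
  then have "(LINT s|lborel. complex_of_real (sqrt (2 * pi)) * (std_normal_density s *\<^sub>R iexp (- (2 * pi * t) * s))) =
      complex_of_real (sqrt (2 * pi) * exp (- ((2 * pi * t)\<^sup>2) / 2))"
    by (subst integral_mult_right_zero) simp
  also have "(\<lambda>s. complex_of_real (sqrt (2 * pi)) * (std_normal_density s *\<^sub>R iexp (- (2 * pi * t) * s))) =
      (\<lambda>s. cis (- (2 * pi * (t * s))) * exp (- s\<^sup>2 / 2))"
    unfolding eq by (auto simp: cis_conv_exp scaleR_conv_of_real mult_ac)
  also have "sqrt (2 * pi) * exp (- ((2 * pi * t)\<^sup>2) / 2) = normal_density 0 (1 / (2 * pi)) t"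
  proof -
    have "sqrt (2 * pi * (1 / (2 * pi))\<^sup>2) = sqrt (1 / (2 * pi))"
      by (simp add: power2_eq_square field_simps)
    also have "1 / \<dots> = sqrt (2 * pi)"
      by (simp add: real_sqrt_divide)
    finally show ?thesis
      by (simp add: normal_density_def power2_eq_square field_simps)
  qed
  finally show "(LINT s|lborel. cis (- (2 * pi * (t * s))) * exp (- s\<^sup>2 / 2)) =
      complex_of_real (normal_density 0 (1 / (2 * pi)) t)" .
qed

definition gauss :: "'a::euclidean_space \<Rightarrow> complex" where
  "gauss \<xi> = (\<Prod>b\<in>Basis. complex_of_real (exp (- (\<xi> \<bullet> b)\<^sup>2 / 2)))"

text \<open>The Fourier transform of \<open>gauss\<close>, written as a product of normal densities;
  the product form reduces both the transform and the mass to one variable.\<close>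

definition gauss_dual :: "'a::euclidean_space \<Rightarrow> complex" where
  "gauss_dual x = (\<Prod>b\<in>Basis. complex_of_real (normal_density 0 (1 / (2 * pi)) (x \<bullet> b)))"

lemma gauss_borel [measurable]: "gauss \<in> borel_measurable borel"
  unfolding gauss_def by measurable

lemma norm_gauss_le: "norm (gauss \<xi>) \<le> 1"
  unfolding gauss_def by (auto simp: prod_norm[symmetric] intro!: prod_le_1)

lemma integrable_gauss: "integrable lborel gauss"
  unfolding gauss_def
  by (rule lborel_integral_prod_Basis) (use gaussian_fourier_1d(1)[of 0] in simp)

lemma integrable_gauss_dual: "integrable lborel gauss_dual"
  and integral_gauss_dual: "(LINT x|lborel. gauss_dual x) = 1"
proof -
  have i: "integrable lborel (\<lambda>t. complex_of_real (normal_density 0 (1 / (2 * pi)) t))"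
    by (intro integrable_of_real) simp
  show "integrable lborel gauss_dual"
    unfolding gauss_dual_def by (rule lborel_integral_prod_Basis) (rule i)
  show "(LINT x|lborel. gauss_dual x) = 1"
    unfolding gauss_dual_def
    by (subst lborel_integral_prod_Basis(2)[OF i]) simp
qed

lemma fourier_gauss: "fourier gauss x = gauss_dual x"
proof -
  have eq: "cis (- (2 * pi * (\<xi> \<bullet> x))) * gauss \<xi> =
      (\<Prod>b\<in>Basis. cis (- (2 * pi * ((x \<bullet> b) * (\<xi> \<bullet> b)))) * complex_of_real (exp (- (\<xi> \<bullet> b)\<^sup>2 / 2)))" for \<xi> :: 'a
  proof -
    have "cis (\<Sum>b\<in>B. g b) = (\<Prod>b\<in>B. cis (g b))" if "finite B" for B and g :: "'a \<Rightarrow> real"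
      using that by (induction B) (auto simp: cis_mult[symmetric])
    then have "(\<Prod>b\<in>Basis. cis (- (2 * pi * ((x \<bullet> b) * (\<xi> \<bullet> b))))) =
        cis (\<Sum>b\<in>Basis. - (2 * pi * ((x \<bullet> b) * (\<xi> \<bullet> b))))" by simp
    also have "(\<Sum>b\<in>Basis. - (2 * pi * ((x \<bullet> b) * (\<xi> \<bullet> b)))) = - (2 * pi * (\<xi> \<bullet> x))"
      unfolding sum_negf sum_distrib_left[symmetric] euclidean_inner[of \<xi> x] by (simp add: mult.commute)
    finally show ?thesis unfolding gauss_def prod.distrib by simp
  qed
  show ?thesis
    unfolding fourier_def eq gauss_dual_def
    by (subst lborel_integral_prod_Basis(2)) (use gaussian_fourier_1d in auto)
qed

text \<open>The double integral hidden in the inversion formula is not absolutely convergent. The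
  Gaussian factor makes it so, and Fubini then moves the transform from \<open>w\<close> to the
  Gaussian.\<close>

lemma gauss_regularization:
  fixes w :: "'a::euclidean_space \<Rightarrow> complex"
  assumes w: "test_fun w" and eps: "\<epsilon> > 0"
  shows "(LINT \<xi>|lborel. cis (2 * pi * (x \<bullet> \<xi>)) * (gauss (\<epsilon> *\<^sub>R \<xi>) * fourier w \<xi>)) =
    (LINT z|lborel. w (x + \<epsilon> *\<^sub>R z) * gauss_dual z)"
proof -
  note [measurable] = test_fun_borel[OF w]
  define K where "K = (\<lambda>y. LINT \<xi>|lborel. cis (2 * pi * ((x - y) \<bullet> \<xi>)) * gauss (\<epsilon> *\<^sub>R \<xi>))"
  define F where "F = (\<lambda>(\<xi>, y). cis (2 * pi * ((x - y) \<bullet> \<xi>)) * gauss (\<epsilon> *\<^sub>R \<xi>) * w y)"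
  have [measurable]: "F \<in> borel_measurable (lborel \<Otimes>\<^sub>M lborel)"
    unfolding F_def by measurable
  have ig: "integrable lborel (\<lambda>\<xi>::'a. gauss (\<epsilon> *\<^sub>R \<xi>))"
    using lborel_integrable_affine[OF integrable_gauss, of \<epsilon> 0] eps by simp
  have iF: "integrable (lborel \<Otimes>\<^sub>M lborel) F"
  proof (rule lborel_pair.Fubini_integrable)
    have "(\<lambda>\<xi>. LINT y|lborel. norm (F (\<xi>, y))) = (\<lambda>\<xi>. norm (gauss (\<epsilon> *\<^sub>R \<xi>)) * (LINT y|lborel. norm (w y)))"
      by (auto simp: F_def norm_mult fun_eq_iff)
    then show "integrable lborel (\<lambda>\<xi>. LINT y|lborel. norm (F (\<xi>, y)))"
      using ig by simp
    show "AE \<xi> in lborel. integrable lborel (\<lambda>y. F (\<xi>, y))"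
    proof (intro AE_I2)
      fix \<xi>
      show "integrable lborel (\<lambda>y. F (\<xi>, y))"
      proof (rule Bochner_Integration.integrable_bound)
        show "integrable lborel (\<lambda>y. gauss (\<epsilon> *\<^sub>R \<xi>) * w y)"
          by (intro integrable_mult_right test_fun_integrable w)
      qed (auto simp: F_def norm_mult)
    qed
  qed measurable
  have "(LINT \<xi>|lborel. cis (2 * pi * (x \<bullet> \<xi>)) * (gauss (\<epsilon> *\<^sub>R \<xi>) * fourier w \<xi>)) =
      (LINT \<xi>|lborel. LINT y|lborel. F (\<xi>, y))"
  proof (intro Bochner_Integration.integral_cong refl)
    fix \<xi>
    have "cis (2 * pi * (x \<bullet> \<xi>)) * (gauss (\<epsilon> *\<^sub>R \<xi>) * fourier w \<xi>) =
        (LINT y|lborel. cis (2 * pi * (x \<bullet> \<xi>)) * (gauss (\<epsilon> *\<^sub>R \<xi>) * (cis (- (2 * pi * (y \<bullet> \<xi>))) * w y)))"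
      unfolding fourier_def by simp
    also have "\<dots> = (LINT y|lborel. F (\<xi>, y))"
    proof (intro Bochner_Integration.integral_cong refl)
      fix y
      have "cis (2 * pi * ((x - y) \<bullet> \<xi>)) = cis (2 * pi * (x \<bullet> \<xi>)) * cis (- (2 * pi * (y \<bullet> \<xi>)))"
        by (simp add: cis_mult inner_diff_left algebra_simps)
      then show "cis (2 * pi * (x \<bullet> \<xi>)) * (gauss (\<epsilon> *\<^sub>R \<xi>) * (cis (- (2 * pi * (y \<bullet> \<xi>))) * w y)) = F (\<xi>, y)"
        by (simp add: F_def)
    qed
    finally show "cis (2 * pi * (x \<bullet> \<xi>)) * (gauss (\<epsilon> *\<^sub>R \<xi>) * fourier w \<xi>) = (LINT y|lborel. F (\<xi>, y))" .
  qed
  also have "\<dots> = (LINT y|lborel. LINT \<xi>|lborel. F (\<xi>, y))"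
    using lborel_pair.Fubini_integral[of "\<lambda>\<xi> y. F (\<xi>, y)"] iF by simp
  also have "\<dots> = (LINT y|lborel. K y * w y)"
    by (simp add: F_def K_def)
  also have "\<dots> = \<bar>\<epsilon>\<bar> ^ DIM('a) *\<^sub>R (LINT z|lborel. K (x + \<epsilon> *\<^sub>R z) * w (x + \<epsilon> *\<^sub>R z))"
    by (subst lborel_integral_affine[of _ \<epsilon> x]) (use eps in \<open>auto simp: K_def\<close>)
  also have "\<dots> = (LINT z|lborel. \<bar>\<epsilon>\<bar> ^ DIM('a) *\<^sub>R (K (x + \<epsilon> *\<^sub>R z) * w (x + \<epsilon> *\<^sub>R z)))"
    by simp
  also have "\<dots> = (LINT z|lborel. w (x + \<epsilon> *\<^sub>R z) * gauss_dual z)"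
  proof (intro Bochner_Integration.integral_cong refl)
    fix z :: 'a
    have "gauss_dual z = \<bar>\<epsilon>\<bar> ^ DIM('a) *\<^sub>R
        (LINT \<xi>|lborel. cis (- (2 * pi * ((0 + \<epsilon> *\<^sub>R \<xi>) \<bullet> z))) * gauss (0 + \<epsilon> *\<^sub>R \<xi>))"
      unfolding fourier_gauss[symmetric] fourier_def
      by (rule lborel_integral_affine[of "\<lambda>\<xi>. cis (- (2 * pi * (\<xi> \<bullet> z))) * gauss \<xi>" \<epsilon> 0])
         (use eps in auto)
    also have "(LINT \<xi>|lborel. cis (- (2 * pi * ((0 + \<epsilon> *\<^sub>R \<xi>) \<bullet> z))) * gauss (0 + \<epsilon> *\<^sub>R \<xi>)) = K (x + \<epsilon> *\<^sub>R z)"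
      unfolding K_def by (simp add: inner_commute)
    finally show "\<bar>\<epsilon>\<bar> ^ DIM('a) *\<^sub>R (K (x + \<epsilon> *\<^sub>R z) * w (x + \<epsilon> *\<^sub>R z)) = w (x + \<epsilon> *\<^sub>R z) * gauss_dual z"
      by simp
  qed
  finally show ?thesis .
qed

text \<open>Both sides of the regularised identity are sent to \<epsilon> = 0 by dominated
  convergence, with majorants \<open>norm (fourier w \<xi>)\<close> on the frequency side and a
  multiple of \<open>gauss_dual\<close> on the space side. The mass 1 of \<open>gauss_dual\<close>
  leaves w(x).\<close>

theorem inv_fourier_fourier:
  fixes w :: "'a::euclidean_space \<Rightarrow> complex"
  assumes w: "test_fun w"
  shows "inv_fourier (fourier w) x = w x"
proof -
  note [measurable] = test_fun_borel[OF w] borel_measurable_integrable[OF integrable_fourier[OF w], simplified]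
    borel_measurable_integrable[OF integrable_gauss_dual, simplified]
  define \<epsilon> where "\<epsilon> = (\<lambda>j. inverse (real (Suc j)))"
  have eps: "\<epsilon> j > 0" for j by (simp add: \<epsilon>_def)
  have eps0: "\<epsilon> \<longlonglongrightarrow> 0" unfolding \<epsilon>_def by (rule LIMSEQ_inverse_real_of_nat)
  have cg: "continuous_on UNIV (gauss :: 'a \<Rightarrow> complex)"
    unfolding gauss_def by (intro continuous_intros) auto
  have g0: "gauss (0::'a) = 1" by (simp add: gauss_def)
  have "(\<lambda>j. LINT \<xi>|lborel. cis (2 * pi * (x \<bullet> \<xi>)) * (gauss (\<epsilon> j *\<^sub>R \<xi>) * fourier w \<xi>))
      \<longlonglongrightarrow> (LINT \<xi>|lborel. cis (2 * pi * (x \<bullet> \<xi>)) * fourier w \<xi>)"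
  proof (rule integral_dominated_convergence)
    show "integrable lborel (\<lambda>\<xi>. norm (fourier w \<xi>))"
      by (intro integrable_norm integrable_fourier w)
    show "AE \<xi> in lborel. (\<lambda>j. cis (2 * pi * (x \<bullet> \<xi>)) * (gauss (\<epsilon> j *\<^sub>R \<xi>) * fourier w \<xi>))
        \<longlonglongrightarrow> cis (2 * pi * (x \<bullet> \<xi>)) * fourier w \<xi>"
    proof (intro AE_I2)
      fix \<xi> :: 'a
      have "(\<lambda>j. \<epsilon> j *\<^sub>R \<xi>) \<longlonglongrightarrow> 0 *\<^sub>R \<xi>" by (intro tendsto_intros eps0)
      then have "(\<lambda>j. gauss (\<epsilon> j *\<^sub>R \<xi>)) \<longlonglongrightarrow> gauss (0 *\<^sub>R \<xi>)"
        by (rule continuous_on_tendsto_compose[OF cg]) auto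
      then have "(\<lambda>j. cis (2 * pi * (x \<bullet> \<xi>)) * (gauss (\<epsilon> j *\<^sub>R \<xi>) * fourier w \<xi>))
        \<longlonglongrightarrow> cis (2 * pi * (x \<bullet> \<xi>)) * (gauss (0 *\<^sub>R \<xi>) * fourier w \<xi>)"
        by (intro tendsto_intros)
      then show "(\<lambda>j. cis (2 * pi * (x \<bullet> \<xi>)) * (gauss (\<epsilon> j *\<^sub>R \<xi>) * fourier w \<xi>))
        \<longlonglongrightarrow> cis (2 * pi * (x \<bullet> \<xi>)) * fourier w \<xi>" by (simp add: g0)
    qed
    show "AE \<xi> in lborel. norm (cis (2 * pi * (x \<bullet> \<xi>)) * (gauss (\<epsilon> j *\<^sub>R \<xi>) * fourier w \<xi>)) \<le> norm (fourier w \<xi>)" for j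
      using mult_right_mono[OF norm_gauss_le norm_ge_zero] by (intro AE_I2) (simp add: norm_mult)
  qed measurable
  moreover have "(\<lambda>j. LINT z|lborel. w (x + \<epsilon> j *\<^sub>R z) * gauss_dual z)
      \<longlonglongrightarrow> (LINT z::'a|lborel. w x * gauss_dual z)"
  proof -
    obtain C where C: "\<And>x. norm (w x) \<le> C" using test_fun_bounded[OF w] by metis
    show ?thesis
    proof (rule integral_dominated_convergence)
      show "integrable lborel (\<lambda>z::'a. C * norm (gauss_dual z :: complex))"
        by (intro integrable_mult_right integrable_norm integrable_gauss_dual)
      show "AE z in lborel. (\<lambda>j. w (x + \<epsilon> j *\<^sub>R z) * gauss_dual z) \<longlonglongrightarrow> w x * gauss_dual z"
      proof (intro AE_I2)
        fix z :: 'a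
        have "(\<lambda>j. x + \<epsilon> j *\<^sub>R z) \<longlonglongrightarrow> x + 0 *\<^sub>R z" by (intro tendsto_intros eps0)
        then have "(\<lambda>j. w (x + \<epsilon> j *\<^sub>R z)) \<longlonglongrightarrow> w (x + 0 *\<^sub>R z)"
          by (rule continuous_on_tendsto_compose[OF test_fun_continuous[OF w, of UNIV]]) auto
        then show "(\<lambda>j. w (x + \<epsilon> j *\<^sub>R z) * gauss_dual z) \<longlonglongrightarrow> w x * gauss_dual z"
          by (auto intro: tendsto_intros)
      qed
      show "AE z in lborel. norm (w (x + \<epsilon> j *\<^sub>R z) * gauss_dual z) \<le> C * norm (gauss_dual z :: complex)" for j
        using C by (intro AE_I2) (simp add: norm_mult mult_right_mono)
    qed measurable
  qed
  ultimately have "(LINT \<xi>|lborel. cis (2 * pi * (x \<bullet> \<xi>)) * fourier w \<xi>) = (LINT z::'a|lborel. w x * gauss_dual z)"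
    unfolding gauss_regularization[OF w eps] by (rule LIMSEQ_unique)
  then show ?thesis by (simp add: inv_fourier_def integral_gauss_dual)
qed

section \<open>Powers of extended reals and rearrangements\<close>

lemma epowr_ennreal [simp]: "0 \<le> r \<Longrightarrow> epowr (ennreal r) a = ennreal (r powr a)"
  by (simp add: epowr_def)

lemma epowr_top [simp]: "epowr \<infinity> a = \<infinity>" "epowr top a = top"
  by (simp_all add: epowr_def)

lemma epowr_mono: "x \<le> y \<Longrightarrow> 0 \<le> a \<Longrightarrow> epowr x a \<le> epowr y a"
  by (cases x; cases y) (auto simp: powr_mono2 ennreal_leI top_unique)

lemma epowr_zero [simp]: "epowr 0 a = 0"
  by (simp add: epowr_def)

lemma epowr_eq_0_iff [simp]: "epowr x a = 0 \<longleftrightarrow> x = 0"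
  by (cases x) auto

lemma epowr_mult: "epowr (x * y) a = epowr x a * epowr y a"
proof (cases x; cases y)
  fix r s :: real assume "x = ennreal r" "0 \<le> r" "y = ennreal s" "0 \<le> s"
  then show ?thesis by (simp add: ennreal_mult[symmetric] powr_mult)
qed (auto simp: ennreal_mult_top ennreal_top_mult)

lemma epowr_epowr: "epowr (epowr x a) b = epowr x (a * b)"
  by (cases x) (auto simp: powr_powr)

lemma epowr_one [simp]: "epowr x 1 = x"
  by (cases x) auto

text \<open>As \<open>0 powr 0 = 0\<close> and infinity is fixed by every exponent, the law has no
  exceptional cases. This matters for the exponent b - c below, which is 0 when the two second
  indices coincide.\<close>

lemma epowr_add: "epowr x (a + b) = epowr x a * epowr x b"
  by (cases x) (auto simp: powr_add ennreal_mult)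

lemma epowr_inverse_cancel: "0 < a \<Longrightarrow> epowr (epowr x a) (1 / a) = x"
  by (simp add: epowr_epowr)

lemma borel_measurable_epowr [measurable (raw)]:
  assumes [measurable]: "f \<in> borel_measurable M"
  shows "(\<lambda>x. epowr (f x) a) \<in> borel_measurable M"
  unfolding epowr_def by measurable

lemma recip_finite: "q < \<infinity> \<Longrightarrow> 0 < q \<Longrightarrow> recip q = 1 / enn2real q"
  by (cases q) (auto simp: recip_def inverse_ennreal inverse_eq_divide)

lemma recip_infinity [simp]: "recip \<infinity> = 0" "recip top = 0"
  by (simp_all add: recip_def)

lemma borel_measurable_broken_log [measurable]: "broken_log A \<in> borel_measurable borel"
  unfolding broken_log_def[abs_def] by measurable

lemma broken_log_pos: "0 < broken_log A t"
  by (simp add: broken_log_def)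

section \<open>Distribution functions and nonincreasing rearrangements\<close>

lemma superlevel_set_lebesgue:
  fixes g :: "'a::euclidean_space \<Rightarrow> complex"
  assumes [measurable]: "g \<in> borel_measurable lebesgue"
  shows "{x. s < ennreal (norm (g x))} \<in> sets lebesgue"
proof -
  have "{x \<in> space lebesgue. s < ennreal (norm (g x))} \<in> sets lebesgue" by measurable
  then show ?thesis by simp
qed

text \<open>The infimum defining the rearrangement is attained: along a decreasing sequence of
  levels the superlevel sets increase, and continuity from below keeps the bound on their measure.
  The resulting duality between rearrangement and distribution function carries all later facts
  about rearrangements.\<close>

lemma rearrangement_le_iff:
  fixes g :: "'a::euclidean_space \<Rightarrow> complex"
  assumes [measurable]: "g \<in> borel_measurable lebesgue"
  shows "rearrangement g t \<le> s \<longleftrightarrow> emeasure lebesgue {x. s < ennreal (norm (g x))} \<le> ennreal t"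
proof
  show "rearrangement g t \<le> s" if "emeasure lebesgue {x. s < ennreal (norm (g x))} \<le> ennreal t"
    unfolding rearrangement_def by (rule Inf_lower) (use that in simp)
next
  assume le: "rearrangement g t \<le> s"
  let ?S = "{s. emeasure lebesgue {x. s < ennreal (norm (g x))} \<le> ennreal t}"
  note m = superlevel_set_lebesgue[OF assms]
  have "top \<in> ?S" by simp
  then obtain f where f: "decseq f" "range f \<subseteq> ?S" "Inf ?S = (INF i::nat. f i)"
    using ennreal_Inf_countable_INF[of ?S] by blast
  let ?A = "\<lambda>i. {x. f i < ennreal (norm (g x))}"
  have "{x. s < ennreal (norm (g x))} \<subseteq> (\<Union>i. ?A i)"
  proof
    fix x assume "x \<in> {x. s < ennreal (norm (g x))}"
    then have "(INF i. f i) < ennreal (norm (g x))"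
      using le f(3) by (auto simp: rearrangement_def)
    then show "x \<in> (\<Union>i. ?A i)" by (auto simp: Inf_less_iff)
  qed
  then have "emeasure lebesgue {x. s < ennreal (norm (g x))} \<le> emeasure lebesgue (\<Union>i. ?A i)"
    using m by (intro emeasure_mono) auto
  also have "\<dots> = (SUP i. emeasure lebesgue (?A i))"
    using f(1) m by (intro SUP_emeasure_incseq[symmetric])
      (auto simp: incseq_def decseq_def intro: order.strict_trans1)
  also have "\<dots> \<le> ennreal t"
    using f(2) by (intro SUP_least) auto
  finally show "emeasure lebesgue {x. s < ennreal (norm (g x))} \<le> ennreal t" .
qed

lemma rearrangement_antimono: "t \<le> t' \<Longrightarrow> rearrangement g t' \<le> rearrangement g t"
  unfolding rearrangement_def by (intro Inf_superset_mono) (auto intro: order_trans ennreal_leI)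

lemma borel_measurable_rearrangement:
  fixes g :: "'a::euclidean_space \<Rightarrow> complex"
  assumes "g \<in> borel_measurable lebesgue"
  shows "rearrangement g \<in> borel_measurable borel"
proof (rule borel_measurableI_greater)
  fix s
  have "{t \<in> space borel. s < rearrangement g t} =
      {t \<in> space borel. ennreal t < emeasure lebesgue {x. s < ennreal (norm (g x))}}"
    using rearrangement_le_iff[OF assms] by (auto simp: not_le[symmetric])
  also have "\<dots> \<in> sets borel" by measurable
  finally show "{t \<in> space borel. s < rearrangement g t} \<in> sets borel" .
qed

lemma rearrangement_le_bound:
  fixes g :: "'a::euclidean_space \<Rightarrow> complex"
  assumes "g \<in> borel_measurable lebesgue" "AE x in lebesgue. ennreal (norm (g x)) \<le> M"
  shows "rearrangement g t \<le> M"
proof -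
  have "emeasure lebesgue {x. M < ennreal (norm (g x))} = 0"
    using assms(2) emeasure_eq_0_AE[of "\<lambda>x. M < ennreal (norm (g x))" lebesgue] by (simp add: not_less)
  then show ?thesis using rearrangement_le_iff[OF assms(1)] by simp
qed

lemma rearrangement_cong_AE:
  fixes g :: "'a::euclidean_space \<Rightarrow> complex"
  assumes [measurable]: "g \<in> borel_measurable lebesgue" "g' \<in> borel_measurable lebesgue"
    and eq: "AE x in lebesgue. g x = g' x"
  shows "rearrangement g = rearrangement g'"
proof -
  note m = superlevel_set_lebesgue[OF assms(1)] superlevel_set_lebesgue[OF assms(2)]
  have "emeasure lebesgue {x. s < ennreal (norm (g x))} = emeasure lebesgue {x. s < ennreal (norm (g' x))}" for s
    by (rule emeasure_eq_AE) (use eq m in auto)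
  then show ?thesis by (simp add: rearrangement_def fun_eq_iff)
qed

text \<open>Writing a value as the length of an interval turns integrals of values into double
  integrals of indicators, ready for Tonelli. The value may be infinite, as a rearrangement can
  be.\<close>

lemma ennreal_layer_cake:
  "(\<integral>\<^sup>+ s. indicator {s. 0 < s \<and> ennreal s < X} s \<partial>lborel) = X"
proof (cases X)
  case (real r)
  have "{s. 0 < s \<and> ennreal s < X} = {0<..<r}"
    using real by (auto simp: ennreal_less_iff)
  then show ?thesis using real by simp
next
  case top
  have "{s. 0 < s \<and> ennreal s < X} = {0<..}" using top by auto
  moreover have "emeasure lborel {0::real<..} = \<infinity>"
  proof (rule ccontr)
    assume "\<not> ?thesis"
    then obtain r where r: "emeasure lborel {0::real<..} = ennreal r" "0 \<le> r"
      by (cases "emeasure lborel {0::real<..}") auto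
    have "emeasure lborel {0::real<..<r + 1} \<le> emeasure lborel {0::real<..}"
      by (intro emeasure_mono) auto
    then show False using r by simp
  qed
  ultimately show ?thesis using top by simp
qed

text \<open>Layer cake on both sides. With \<open>d\<close> the distribution function and
  \<open>\<sigma>\<close> the level at \<tau>, the slice at height s is d(max s \<sigma>) \<le> min
  (d s) \<tau>, and by duality min (d s) \<tau> is the length of the set of t in (0, \<tau>) at
  which the rearrangement exceeds s.\<close>

lemma nn_integral_above_rearrangement_le:
  fixes g :: "'a::euclidean_space \<Rightarrow> complex"
  assumes [measurable]: "g \<in> borel_measurable borel" and "0 < \<tau>"
  shows "(\<integral>\<^sup>+ x. ennreal (norm (g x)) * indicator {x. rearrangement g \<tau> < ennreal (norm (g x))} x \<partial>lborel)
    \<le> (\<integral>\<^sup>+ t. rearrangement g t * indicator {0<..<\<tau>} t \<partial>lborel)"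
proof -
  define d where "d = (\<lambda>s. emeasure lborel {x. s < ennreal (norm (g x))})"
  have gl: "g \<in> borel_measurable lebesgue"
    using assms(1) by (intro measurable_completion) simp
  note [measurable] = borel_measurable_rearrangement[OF gl]
  have leb: "emeasure lebesgue {x. s < ennreal (norm (g x))} = d s" for s
    unfolding d_def by simp
  have dmono: "s \<le> s' \<Longrightarrow> d s' \<le> d s" for s s'
    unfolding d_def by (intro emeasure_mono) auto
  define \<sigma> where "\<sigma> = rearrangement g \<tau>"
  have "(\<integral>\<^sup>+ x. ennreal (norm (g x)) * indicator {x. \<sigma> < ennreal (norm (g x))} x \<partial>lborel) =
      (\<integral>\<^sup>+ x. (\<integral>\<^sup>+ s. indicator {s. 0 < s \<and> ennreal s < ennreal (norm (g x))} s
         * indicator {x. \<sigma> < ennreal (norm (g x))} x \<partial>lborel) \<partial>lborel)"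
    by (subst nn_integral_multc) (auto simp: ennreal_layer_cake)
  also have "\<dots> = (\<integral>\<^sup>+ s. (\<integral>\<^sup>+ x. indicator {s. 0 < s \<and> ennreal s < ennreal (norm (g x))} s
         * indicator {x. \<sigma> < ennreal (norm (g x))} x \<partial>lborel) \<partial>lborel)"
    by (intro lborel_pair.Fubini') (simp add: case_prod_beta indicator_def)
  also have "\<dots> = (\<integral>\<^sup>+ s. (\<integral>\<^sup>+ x. indicator {0<..} s * indicator {x. max (ennreal s) \<sigma> < ennreal (norm (g x))} x \<partial>lborel) \<partial>lborel)"
    by (intro nn_integral_cong) (auto simp: indicator_def)
  also have "\<dots> = (\<integral>\<^sup>+ s. indicator {0<..} s * d (max (ennreal s) \<sigma>) \<partial>lborel)"
    by (intro nn_integral_cong) (auto simp: d_def nn_integral_cmult)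
  also have "\<dots> \<le> (\<integral>\<^sup>+ s. (\<integral>\<^sup>+ t. indicator {s. 0 < s \<and> ennreal s < rearrangement g t} s * indicator {0<..<\<tau>} t \<partial>lborel) \<partial>lborel)"
  proof (intro nn_integral_mono)
    fix s :: real
    show "indicator {0<..} s * d (max (ennreal s) \<sigma>) \<le>
        (\<integral>\<^sup>+ t. indicator {s. 0 < s \<and> ennreal s < rearrangement g t} s * indicator {0<..<\<tau>} t \<partial>lborel)"
    proof (cases "0 < s")
      case True
      \<comment> \<open>The attained infimum: the level \<open>\<sigma>\<close> itself satisfies the
        bound.\<close>
      have "d \<sigma> \<le> ennreal \<tau>"
        using rearrangement_le_iff[OF gl, of \<tau> \<sigma>] by (simp add: \<sigma>_def leb)
      then have "d (max (ennreal s) \<sigma>) \<le> min (d (ennreal s)) (ennreal \<tau>)"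
        using dmono[of "ennreal s" "max (ennreal s) \<sigma>"] dmono[of \<sigma> "max (ennreal s) \<sigma>"] by auto
      also have "\<dots> = (\<integral>\<^sup>+ t. indicator {t. 0 < t \<and> ennreal t < min (d (ennreal s)) (ennreal \<tau>)} t \<partial>lborel)"
        by (rule ennreal_layer_cake[symmetric])
      also have "\<dots> = (\<integral>\<^sup>+ t. indicator {s. 0 < s \<and> ennreal s < rearrangement g t} s * indicator {0<..<\<tau>} t \<partial>lborel)"
      proof (intro nn_integral_cong)
        fix t :: real
        have "ennreal s < rearrangement g t \<longleftrightarrow> ennreal t < d (ennreal s)"
          using rearrangement_le_iff[OF gl, of t "ennreal s"] unfolding leb by (meson linorder_not_le)
        then have "(0 < t \<and> ennreal t < min (d (ennreal s)) (ennreal \<tau>)) \<longleftrightarrow>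
            (0 < s \<and> ennreal s < rearrangement g t) \<and> (0 < t \<and> t < \<tau>)"
          using True by (auto simp: ennreal_less_iff)
        then show "indicator {t. 0 < t \<and> ennreal t < min (d (ennreal s)) (ennreal \<tau>)} t =
            (indicator {s. 0 < s \<and> ennreal s < rearrangement g t} s * indicator {0<..<\<tau>} t :: ennreal)"
          unfolding indicator_def mem_Collect_eq greaterThanLessThan_iff by auto
      qed
      finally have "d (max (ennreal s) \<sigma>) \<le> \<dots>" .
      moreover have "indicator {0<..} s * d (max (ennreal s) \<sigma>) = d (max (ennreal s) \<sigma>)"
        using True by simp
      ultimately show ?thesis by (simp only:)
    qed simp
  qed
  also have "\<dots> = (\<integral>\<^sup>+ t. (\<integral>\<^sup>+ s. indicator {s. 0 < s \<and> ennreal s < rearrangement g t} s * indicator {0<..<\<tau>} t \<partial>lborel) \<partial>lborel)"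
  proof (rule lborel_pair.Fubini')
    show "(\<lambda>(t, s). indicator {s. 0 < s \<and> ennreal s < rearrangement g t} s * indicator {0<..<\<tau>} t :: ennreal)
        \<in> borel_measurable (lborel \<Otimes>\<^sub>M lborel)"
      unfolding indicator_def mem_Collect_eq greaterThanLessThan_iff case_prod_beta by measurable
  qed
  also have "\<dots> = (\<integral>\<^sup>+ t. rearrangement g t * indicator {0<..<\<tau>} t \<partial>lborel)"
    by (subst nn_integral_multc) (auto simp: ennreal_layer_cake)
  finally show ?thesis unfolding \<sigma>_def .
qed

text \<open>A logarithmic weight grows more slowly than any power, uniformly relative to its value
  at \<tau>. This lets an arbitrarily small power of t / \<tau> pay for replacing the logarithm at t
  by the one at \<tau>.\<close>

lemma log_weight_comparison:
  fixes \<alpha> \<delta> :: real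
  assumes "0 < \<delta>"
  obtains K where "0 < K" "\<And>t \<tau>. 0 < t \<Longrightarrow> t \<le> \<tau> \<Longrightarrow> \<tau> \<le> 1 \<Longrightarrow>
    (1 + \<bar>ln t\<bar>) powr \<alpha> \<le> K * (\<tau> / t) powr \<delta> * (1 + \<bar>ln \<tau>\<bar>) powr \<alpha>"
proof (cases "\<alpha> \<le> 0")
  case True
  have "(1 + \<bar>ln t\<bar>) powr \<alpha> \<le> 1 * (\<tau> / t) powr \<delta> * (1 + \<bar>ln \<tau>\<bar>) powr \<alpha>"
    if t: "0 < t" "t \<le> \<tau>" "\<tau> \<le> 1" for t \<tau> :: real
  proof -
    have "ln t \<le> ln \<tau>" "ln \<tau> \<le> 0" using t by auto
    then have "(1 + \<bar>ln t\<bar>) powr \<alpha> \<le> 1 * (1 + \<bar>ln \<tau>\<bar>) powr \<alpha>"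
      using True by (auto intro!: powr_mono2')
    also have "\<dots> \<le> (\<tau> / t) powr \<delta> * (1 + \<bar>ln \<tau>\<bar>) powr \<alpha>"
      using t assms by (intro mult_right_mono ge_one_powr_ge_zero) auto
    finally show ?thesis by simp
  qed
  then show ?thesis using that[of 1] by simp
next
  case False
  \<comment> \<open>For r = \<tau> / t, the bound ln x \<le> x at x = r^(\<delta>/\<alpha>) gives 1
    + ln r \<le> (1 + \<alpha>/\<delta>) r^(\<delta>/\<alpha>); raising this to the power \<alpha>
    gives K times r^\<delta>.\<close>
  define K where "K = (1 + \<alpha> / \<delta>) powr \<alpha>"
  have "(1 + \<bar>ln t\<bar>) powr \<alpha> \<le> K * (\<tau> / t) powr \<delta> * (1 + \<bar>ln \<tau>\<bar>) powr \<alpha>"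
    if t: "0 < t" "t \<le> \<tau>" "\<tau> \<le> 1" for t \<tau> :: real
  proof -
    define r where "r = \<tau> / t"
    have r: "1 \<le> r" using t by (simp add: r_def)
    have "ln t = ln \<tau> - ln r" using t by (simp add: r_def ln_div)
    moreover have "ln \<tau> \<le> 0" "0 \<le> ln r" using t r by auto
    ultimately have "1 + \<bar>ln t\<bar> \<le> (1 + ln r) * (1 + \<bar>ln \<tau>\<bar>)"
      by (simp add: algebra_simps mult_nonpos_nonneg)
    also have "\<dots> \<le> ((1 + \<alpha> / \<delta>) * r powr (\<delta> / \<alpha>)) * (1 + \<bar>ln \<tau>\<bar>)"
    proof (intro mult_right_mono)
      have "ln r = (\<alpha> / \<delta>) * ln (r powr (\<delta> / \<alpha>))"
        using r False assms by (simp add: ln_powr)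
      also have "\<dots> \<le> (\<alpha> / \<delta>) * r powr (\<delta> / \<alpha>)"
        using r False assms ln_bound[of "r powr (\<delta> / \<alpha>)"] by (intro mult_left_mono) auto
      finally have "ln r \<le> (\<alpha> / \<delta>) * r powr (\<delta> / \<alpha>)" .
      moreover have "1 \<le> r powr (\<delta> / \<alpha>)"
        using r False assms by (intro ge_one_powr_ge_zero) auto
      ultimately show "1 + ln r \<le> (1 + \<alpha> / \<delta>) * r powr (\<delta> / \<alpha>)"
        by (simp add: algebra_simps)
    qed auto
    finally have "(1 + \<bar>ln t\<bar>) powr \<alpha> \<le> (((1 + \<alpha> / \<delta>) * r powr (\<delta> / \<alpha>)) * (1 + \<bar>ln \<tau>\<bar>)) powr \<alpha>"
      using False by (intro powr_mono2) auto
    also have "\<dots> = K * r powr \<delta> * (1 + \<bar>ln \<tau>\<bar>) powr \<alpha>"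
      using False assms by (simp add: K_def powr_mult powr_powr)
    finally show ?thesis by (simp add: r_def)
  qed
  moreover have "0 < K"
  proof -
    have "0 < \<alpha> / \<delta>" using False assms by simp
    then show ?thesis by (simp add: K_def)
  qed
  ultimately show ?thesis using that by blast
qed

section \<open>Weighted norms of monotone functions\<close>

definition lz_weight :: "real \<Rightarrow> real \<times> real \<Rightarrow> real \<Rightarrow> real" where
  "lz_weight p A t = t powr p * broken_log A t"

lemma lz_weight_pos: "0 < t \<Longrightarrow> 0 < lz_weight p A t"
  by (simp add: lz_weight_def broken_log_pos)

lemma lz_weight_nonneg: "0 \<le> lz_weight p A t"
  using broken_log_pos[of A t] by (simp add: lz_weight_def)

lemma borel_measurable_lz_weight [measurable]: "lz_weight p A \<in> borel_measurable borel"
  unfolding lz_weight_def[abs_def] by measurable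

text \<open>Here \<open>p\<close> is the reciprocal of the Lebesgue exponent and \<open>h\<close>
  takes the place of a rearrangement, so that the weighted inequalities concern nonincreasing
  functions on the half-line alone.\<close>

definition LZ_norm :: "real \<Rightarrow> ennreal \<Rightarrow> real \<times> real \<Rightarrow> (real \<Rightarrow> ennreal) \<Rightarrow> ennreal" where
  "LZ_norm p b A h = Lb_qnorm b (restrict_space lborel {0<..}) (\<lambda>t. ennreal (lz_weight (p - recip b) A t) * h t)"

lemma LZ_qnorm_eq: "LZ_qnorm q b A g = LZ_norm (recip q) b A (rearrangement g)"
  by (simp add: LZ_qnorm_def LZ_norm_def lz_weight_def)

lemma LZ_norm_finite:
  assumes "0 < c" "h \<in> borel_measurable borel"
  shows "epowr (LZ_norm p (ennreal c) A h) c =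
    (\<integral>\<^sup>+ t. epowr (ennreal (lz_weight (p - 1 / c) A t) * h t) c * indicator {0<..} t \<partial>lborel)"
proof -
  have "recip (ennreal c) = 1 / c" using assms by (subst recip_finite) auto
  then show ?thesis
    using assms by (simp add: LZ_norm_def Lb_qnorm_def epowr_epowr nn_integral_restrict_space)
qed

text \<open>On [t/2, t] the power varies by at most the factor 2^|a|, and 1 + |ln t| by at most the
  factor 2 because ln 2 < 1.\<close>

lemma lz_weight_half:
  obtains k where "0 < k" "\<And>s t. 0 < t \<Longrightarrow> t / 2 \<le> s \<Longrightarrow> s \<le> t \<Longrightarrow> k * lz_weight a A t \<le> lz_weight a A s"
proof -
  have pw: "(1/2) powr \<bar>a\<bar> * t powr a \<le> s powr a" if "0 < t" "t / 2 \<le> s" "s \<le> t" for s t :: real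
  proof -
    have r: "1/2 \<le> s / t" "s / t \<le> 1" "0 < s / t" "0 \<le> s / t" using that by (auto simp: field_simps)
    have "(1/2) powr \<bar>a\<bar> \<le> (s / t) powr \<bar>a\<bar>" using r by (intro powr_mono2) auto
    also have "\<dots> \<le> (s / t) powr a" using r by (intro powr_mono') auto
    finally have "(1/2) powr \<bar>a\<bar> * t powr a \<le> (s / t) powr a * t powr a"
      by (rule mult_right_mono) simp
    also have "\<dots> = s powr a" using that by (simp add: powr_divide)
    finally show ?thesis .
  qed
  define m where "m = \<bar>fst A\<bar> + \<bar>snd A\<bar>"
  have lg: "2 powr (- m) * broken_log A t \<le> broken_log A s" if st: "0 < t" "t / 2 \<le> s" "s \<le> t" for s t :: real
  proof -
    have s0: "0 < s" using st by simp
    have "ln (t / 2) \<le> ln s" "ln s \<le> ln t" using st s0 by (auto simp del: ln_div)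
    moreover have "ln (t / 2) = ln t - ln 2" using st by (simp add: ln_div)
    moreover have "ln (2::real) \<le> 1" using ln_2_less_1 by simp
    ultimately have d: "\<bar>ln t - ln s\<bar> \<le> 1" by simp
    define x y where "x = 1 + \<bar>ln t\<bar>" and "y = 1 + \<bar>ln s\<bar>"
    have xy: "1 \<le> x" "1 \<le> y" "x \<le> 2 * y" "y \<le> 2 * x" using d by (auto simp: x_def y_def)
    have same: "2 powr (- m) * x powr e \<le> y powr e" if "\<bar>e\<bar> \<le> m" for e
    proof (cases "0 \<le> e")
      case True
      have "x powr e \<le> (2 * y) powr e" using True xy by (intro powr_mono2) auto
      also have "\<dots> = 2 powr e * y powr e" using xy by (simp add: powr_mult)
      also have "\<dots> \<le> 2 powr m * y powr e" using that True by (intro mult_right_mono powr_mono) auto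
      finally show ?thesis by (simp add: powr_minus field_simps)
    next
      case False
      have "(2 * x) powr e \<le> y powr e" using False xy by (intro powr_mono2') auto
      moreover have "(2 * x) powr e = 2 powr e * x powr e" using xy by (simp add: powr_mult)
      moreover have "2 powr (- m) * x powr e \<le> 2 powr e * x powr e"
        using that False by (intro mult_right_mono powr_mono) auto
      ultimately show ?thesis by simp
    qed
    consider "t \<le> 1" | "1 < s" | "s \<le> 1" "1 < t" using st by linarith
    then show ?thesis
    proof cases
      case 1
      then show ?thesis using same[of "fst A"] st by (simp add: broken_log_def m_def x_def y_def)
    next
      case 2
      then show ?thesis using same[of "snd A"] st by (simp add: broken_log_def m_def x_def y_def)
    next
      \<comment> \<open>The exponent of the logarithm switches between \<open>s\<close> and
        \<open>t\<close>. Both points are then so close to 1 that both logarithmic factors lie in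
        [1, 2], and each exponent costs at most a fixed power of 2.\<close>
      case 3
      then have "0 \<le> ln t" "ln s \<le> 0" using s0 by auto
      then have x2: "x \<le> 2" and y2: "y \<le> 2" using d by (auto simp: x_def y_def)
      have up: "z powr e \<le> 2 powr \<bar>e\<bar>" and lo: "2 powr (- \<bar>e\<bar>) \<le> z powr e" if "1 \<le> z" "z \<le> 2" for z e :: real
      proof -
        have "z powr e \<le> z powr \<bar>e\<bar>" using that by (intro powr_mono) auto
        also have "\<dots> \<le> 2 powr \<bar>e\<bar>" using that by (intro powr_mono2) auto
        finally show "z powr e \<le> 2 powr \<bar>e\<bar>" .
        have "2 powr (- \<bar>e\<bar>) \<le> z powr (- \<bar>e\<bar>)" using that by (intro powr_mono2') auto
        also have "\<dots> \<le> z powr e" using that by (intro powr_mono) auto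
        finally show "2 powr (- \<bar>e\<bar>) \<le> z powr e" .
      qed
      have "2 powr (- m) * x powr snd A \<le> 2 powr (- m) * 2 powr \<bar>snd A\<bar>"
        using up[of x "snd A"] x2 xy by (intro mult_left_mono) auto
      also have "\<dots> = 2 powr (- \<bar>fst A\<bar>)" by (simp add: m_def powr_add[symmetric])
      also have "\<dots> \<le> y powr fst A" using lo[of y "fst A"] y2 xy by auto
      finally show ?thesis using 3 by (simp add: broken_log_def x_def y_def)
    qed
  qed
  have "((1/2) powr \<bar>a\<bar> * 2 powr (- m)) * lz_weight a A t \<le> lz_weight a A s"
    if "0 < t" "t / 2 \<le> s" "s \<le> t" for s t
  proof -
    have "((1/2) powr \<bar>a\<bar> * t powr a) * (2 powr (- m) * broken_log A t) \<le> s powr a * broken_log A s"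
      using broken_log_pos[of A t] by (intro mult_mono pw lg that) (auto intro: mult_nonneg_nonneg less_imp_le)
    then show ?thesis by (simp add: lz_weight_def mult_ac)
  qed
  then show ?thesis using that[of "(1/2) powr \<bar>a\<bar> * 2 powr (- m)"] by simp
qed

lemma ennreal_cancel_left:
  assumes "0 < k" "0 \<le> r" "ennreal (k * r) * x \<le> y"
  shows "ennreal r * x \<le> ennreal (1 / k) * y"
proof -
  have "ennreal r * x = ennreal (1 / k) * (ennreal (k * r) * x)"
    using assms(1,2) by (simp add: ennreal_mult[symmetric] mult.assoc[symmetric])
  also have "\<dots> \<le> ennreal (1 / k) * y" by (intro mult_left_mono assms(3)) auto
  finally show ?thesis .
qed

text \<open>The embedding into the space with second index \<infinity>. On [t/2, t] a nonincreasing
  function is at least h(t) and the weight is comparable to its value at t, so this interval alone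
  already contributes the required amount to the norm.\<close>

lemma LZ_norm_weak:
  assumes "0 < c"
  obtains K where "0 < K" "\<And>h t. antimono h \<Longrightarrow> h \<in> borel_measurable borel \<Longrightarrow> 0 < t \<Longrightarrow>
    ennreal (lz_weight p A t) * h t \<le> ennreal K * LZ_norm p c A h"
proof -
  obtain k where k: "0 < k" "\<And>s t. 0 < t \<Longrightarrow> t / 2 \<le> s \<Longrightarrow> s \<le> t \<Longrightarrow> k * lz_weight (p - recip c) A t \<le> lz_weight (p - recip c) A s"
    using lz_weight_half by blast
  have pt: "ennreal (k * lz_weight (p - recip c) A t) * h t \<le> ennreal (lz_weight (p - recip c) A s) * h s"
    if "antimono h" "0 < t" "t / 2 \<le> s" "s \<le> t" for h :: "real \<Rightarrow> ennreal" and s t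
    using that k(2) by (intro mult_mono ennreal_leI) (auto dest: antimonoD)
  show ?thesis
  proof (cases "c = \<infinity>")
    case True
    have "ennreal (lz_weight p A t) * h t \<le> ennreal (1 / k) * LZ_norm p c A h"
      if h: "antimono h" "h \<in> borel_measurable borel" "0 < t" for h t
    proof -
      have "AE s in restrict_space lborel {0<..}. ennreal (lz_weight (p - recip c) A s) * h s \<le> LZ_norm p c A h"
        using esssup_AE[of "\<lambda>s. ennreal (lz_weight (p - recip c) A s) * h s" "restrict_space lborel {0<..}"]
        by (simp add: LZ_norm_def Lb_qnorm_def True)
      then have ae: "AE s in lborel. s \<in> {0<..} \<longrightarrow> ennreal (lz_weight (p - recip c) A s) * h s \<le> LZ_norm p c A h"
        by (subst (asm) AE_restrict_space_iff) auto
      \<comment> \<open>The essential supremum controls almost every point only, but the interval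
        has positive length, so some point in it obeys the bound.\<close>
      have "\<exists>s\<in>{t/2..t}. ennreal (lz_weight (p - recip c) A s) * h s \<le> LZ_norm p c A h"
      proof (rule ccontr)
        assume no: "\<not> ?thesis"
        have "AE s in lborel. s \<notin> {t/2..t}"
          using ae by eventually_elim (use no h in auto)
        then have "emeasure lborel {t/2..t} = 0" by (subst AE_iff_measurable[symmetric, of _ _ "\<lambda>s. s \<notin> {t/2..t}"]) auto
        then show False using h by simp
      qed
      then obtain s where s: "t/2 \<le> s" "s \<le> t" "ennreal (lz_weight (p - recip c) A s) * h s \<le> LZ_norm p c A h" by auto
      have "ennreal (k * lz_weight p A t) * h t \<le> LZ_norm p c A h"
        using order_trans[OF pt[OF h(1) h(3) s(1,2)] s(3)] by (simp add: True)
      then show ?thesis by (intro ennreal_cancel_left k(1) lz_weight_nonneg)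
    qed
    then show ?thesis using that[of "1 / k"] k by simp
  next
    case False
    then obtain c' where c: "c = ennreal c'" "0 < c'" using assms by (cases c) auto
    have rc: "recip c = 1 / c'" using c by (subst recip_finite) auto
    \<comment> \<open>The extra factor is what remains of the length t/2 of the interval after the
      root of order c': (t/2)^(1/c') restores the power of t missing from the integrand.\<close>
    define k' where "k' = (1/2) powr (1 / c') * k"
    have "0 < k'" using k by (simp add: k'_def)
    have "ennreal (lz_weight p A t) * h t \<le> ennreal (1 / k') * LZ_norm p c A h"
      if h: "antimono h" "h \<in> borel_measurable borel" "0 < t" for h t
    proof -
      have [measurable]: "h \<in> borel_measurable borel" by fact
      have "epowr (ennreal (k' * lz_weight p A t) * h t) c' =
          epowr (ennreal ((t / 2) powr (1 / c')) * (ennreal (k * lz_weight (p - recip c) A t) * h t)) c'"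
      proof -
        have "k' * lz_weight p A t = (t / 2) powr (1 / c') * (k * lz_weight (p - recip c) A t)"
          using h(3) by (simp add: k'_def lz_weight_def rc powr_divide powr_diff mult_ac)
        then show ?thesis using k(1) lz_weight_nonneg by (simp add: ennreal_mult mult.assoc)
      qed
      also have "\<dots> = epowr (ennreal (k * lz_weight (p - recip c) A t) * h t) c' * ennreal (t / 2)"
        using h(3) c(2) by (subst epowr_mult) (simp add: powr_powr mult.commute)
      also have "\<dots> = (\<integral>\<^sup>+ s. epowr (ennreal (k * lz_weight (p - recip c) A t) * h t) c' * indicator {t/2..t} s \<partial>lborel)"
        using h(3) by (simp add: nn_integral_cmult)
      also have "\<dots> \<le> (\<integral>\<^sup>+ s. epowr (ennreal (lz_weight (p - recip c) A s) * h s) c' * indicator {0<..} s \<partial>lborel)"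
      proof (intro nn_integral_mono)
        fix s :: real
        show "epowr (ennreal (k * lz_weight (p - recip c) A t) * h t) c' * indicator {t/2..t} s \<le>
            epowr (ennreal (lz_weight (p - recip c) A s) * h s) c' * indicator {0<..} s"
        proof (cases "s \<in> {t/2..t}")
          case True
          then show ?thesis
            using epowr_mono[OF pt[OF h(1) h(3), of s], of c'] c(2) h(3) by (auto simp: indicator_def)
        qed auto
      qed
      also have "\<dots> = epowr (LZ_norm p c A h) c'"
        using LZ_norm_finite[OF c(2) h(2), of p A] unfolding c(1)[symmetric] rc[symmetric] by simp
      finally have "epowr (epowr (ennreal (k' * lz_weight p A t) * h t) c') (1 / c') \<le> epowr (epowr (LZ_norm p c A h) c') (1 / c')"
        using c(2) by (rule_tac epowr_mono) auto
      then have "ennreal (k' * lz_weight p A t) * h t \<le> LZ_norm p c A h"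
        unfolding epowr_inverse_cancel[OF c(2)] .
      then show ?thesis by (intro ennreal_cancel_left \<open>0 < k'\<close> lz_weight_nonneg)
    qed
    then show ?thesis using that[of "1 / k'"] \<open>0 < k'\<close> by simp
  qed
qed

lemma nn_integral_powr_from_0:
  assumes "-1 < a" "0 \<le> c"
  shows "(\<integral>\<^sup>+ t. ennreal (t powr a) * indicator {0<..<c} t \<partial>lborel) = ennreal (c powr (a + 1) / (a + 1))"
proof -
  have "((\<lambda>x. x powr a) has_integral (c powr (a + 1) / (a + 1))) {0..c}"
    using assms by (rule has_integral_powr_from_0)
  then have "((\<lambda>x. if x \<in> {0..c} then x powr a else 0) has_integral (c powr (a + 1) / (a + 1))) UNIV"
    by (rule has_integral_restrict_UNIV[THEN iffD2])
  then have "(\<integral>\<^sup>+ t. ennreal (if t \<in> {0..c} then t powr a else 0) \<partial>lborel) = ennreal (c powr (a + 1) / (a + 1))"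
    by (intro nn_integral_has_integral_lborel) auto
  also have "(\<integral>\<^sup>+ t. ennreal (if t \<in> {0..c} then t powr a else 0) \<partial>lborel) =
      (\<integral>\<^sup>+ t. ennreal (t powr a) * indicator {0<..<c} t \<partial>lborel)"
  proof (intro nn_integral_cong_AE)
    have "AE t in lborel. t \<noteq> c" "AE t in lborel. t \<noteq> (0::real)"
      by (rule AE_lborel_singleton)+
    then show "AE t in lborel. ennreal (if t \<in> {0..c} then t powr a else 0) = ennreal (t powr a) * indicator {0<..<c} t"
      by eventually_elim (auto simp: indicator_def)
  qed
  finally show ?thesis .
qed

text \<open>The hypothesis on \<open>p\<close>, \<open>c\<close>, \<open>B\<close> is the one on \<open>q = 1 / p\<close> in the theorem.\<close>

lemma nn_integral_le_LZ_norm: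
  assumes "0 < c" "(p = 1 \<and> c = 1 \<and> B = (0, 0)) \<or> p < 1"
  obtains K where "0 < K" "\<And>h \<tau>. antimono h \<Longrightarrow> h \<in> borel_measurable borel \<Longrightarrow> 0 < \<tau> \<Longrightarrow> \<tau> \<le> 1 \<Longrightarrow>
    (\<integral>\<^sup>+ t. h t * indicator {0<..<\<tau>} t \<partial>lborel) \<le>
      ennreal (K * (\<tau> powr (1 - p) * (1 + \<bar>ln \<tau>\<bar>) powr (- fst B))) * LZ_norm p c B h"
proof (cases "p < 1")
  case False
  with assms have eq: "p = 1" "c = ennreal 1" "B = (0, 0)" by auto
  have main: "(\<integral>\<^sup>+ t. h t * indicator {0<..<\<tau>} t \<partial>lborel) \<le>
      ennreal (1 * (\<tau> powr (1 - p) * (1 + \<bar>ln \<tau>\<bar>) powr (- fst B))) * LZ_norm p c B h"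
    if h: "antimono h" "h \<in> borel_measurable borel" "0 < \<tau>" for h \<tau>
  proof -
    have "lz_weight (1 - 1 / 1) (0, 0) t = 1" if "0 < t" for t
    proof -
      have "1 + \<bar>ln t\<bar> > 0" using abs_ge_zero[of "ln t"] by linarith
      then have "(1 + \<bar>ln t\<bar>) powr 0 = 1" by (simp only: powr_zero_eq_one) simp
      then show ?thesis using that by (simp only: lz_weight_def broken_log_def fst_conv snd_conv if_cancel) simp
    qed
    then have "(\<integral>\<^sup>+ t. h t * indicator {0<..<\<tau>} t \<partial>lborel) \<le>
        (\<integral>\<^sup>+ t. epowr (ennreal (lz_weight (1 - 1 / 1) (0, 0) t) * h t) 1 * indicator {0<..} t \<partial>lborel)"
      by (intro nn_integral_mono) (auto simp: indicator_def simp del: diff_self)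
    also have "\<dots> = epowr (LZ_norm p c B h) 1"
      unfolding eq by (rule LZ_norm_finite[symmetric]) (use h in auto)
    finally show ?thesis using h(3) eq by simp
  qed
  show ?thesis by (rule that[OF zero_less_one main])
next
  case True
  \<comment> \<open>Half of the gap 1 - p absorbs the logarithm; the other half keeps
    t^(-p-\<delta>) integrable at 0.\<close>
  define \<delta> where "\<delta> = (1 - p) / 2"
  have \<delta>: "0 < \<delta>" using True by (simp add: \<delta>_def)
  obtain K where K: "0 < K" "\<And>h t. antimono h \<Longrightarrow> h \<in> borel_measurable borel \<Longrightarrow> 0 < t \<Longrightarrow>
    ennreal (lz_weight p B t) * h t \<le> ennreal K * LZ_norm p c B h"
    using LZ_norm_weak[OF assms(1)] by blast
  obtain K' where K': "0 < K'" "\<And>t \<tau>. 0 < t \<Longrightarrow> t \<le> \<tau> \<Longrightarrow> \<tau> \<le> 1 \<Longrightarrow>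
    (1 + \<bar>ln t\<bar>) powr (- fst B) \<le> K' * (\<tau> / t) powr \<delta> * (1 + \<bar>ln \<tau>\<bar>) powr (- fst B)"
    using log_weight_comparison[OF \<delta>] by blast
  have pos: "0 < 1 - p - \<delta>" using True by (simp add: \<delta>_def)
  have main: "(\<integral>\<^sup>+ t. h t * indicator {0<..<\<tau>} t \<partial>lborel) \<le>
      ennreal (K * K' / (1 - p - \<delta>) * (\<tau> powr (1 - p) * (1 + \<bar>ln \<tau>\<bar>) powr (- fst B))) * LZ_norm p c B h"
    if h: "antimono h" "h \<in> borel_measurable borel" "0 < \<tau>" "\<tau> \<le> 1" for h \<tau>
  proof -
    let ?N = "LZ_norm p c B h"
    define L where "L = (1 + \<bar>ln \<tau>\<bar>) powr (- fst B)"
    have L: "0 \<le> L" by (simp add: L_def)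
    have pt: "h t \<le> ennreal (K * K' * \<tau> powr \<delta> * L) * ?N * ennreal (t powr (- p - \<delta>))" if t: "0 < t" "t < \<tau>" for t
    proof -
      have w: "0 < lz_weight p B t" using t lz_weight_pos by blast
      have "h t = ennreal (1 / lz_weight p B t) * (ennreal (lz_weight p B t) * h t)"
        using w by (simp add: ennreal_mult[symmetric] mult.assoc[symmetric])
      also have "\<dots> \<le> ennreal (1 / lz_weight p B t) * (ennreal K * ?N)"
        by (intro mult_left_mono K(2) h t) auto
      also have "\<dots> \<le> ennreal (K' * \<tau> powr \<delta> * L * t powr (- p - \<delta>)) * (ennreal K * ?N)"
      proof (intro mult_right_mono ennreal_leI)
        have "1 / lz_weight p B t = t powr (- p) * (1 + \<bar>ln t\<bar>) powr (- fst B)"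
          using t h(4) by (simp add: lz_weight_def broken_log_def powr_minus field_simps)
        also have "\<dots> \<le> t powr (- p) * (K' * (\<tau> / t) powr \<delta> * (1 + \<bar>ln \<tau>\<bar>) powr (- fst B))"
          using t h by (intro mult_left_mono K'(2)) auto
        also have "\<dots> = K' * \<tau> powr \<delta> * L * t powr (- p - \<delta>)"
          using t h by (simp add: L_def powr_divide powr_diff powr_minus field_simps)
        finally show "1 / lz_weight p B t \<le> K' * \<tau> powr \<delta> * L * t powr (- p - \<delta>)" .
      qed auto
      also have "\<dots> = ennreal (K * K' * \<tau> powr \<delta> * L) * ?N * ennreal (t powr (- p - \<delta>))"
        using K(1) K'(1) L by (simp add: ennreal_mult mult_ac)
      finally show ?thesis .
    qed
    have "(\<integral>\<^sup>+ t. h t * indicator {0<..<\<tau>} t \<partial>lborel) \<le>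
        (\<integral>\<^sup>+ t. ennreal (K * K' * \<tau> powr \<delta> * L) * ?N * (ennreal (t powr (- p - \<delta>)) * indicator {0<..<\<tau>} t) \<partial>lborel)"
      using pt by (intro nn_integral_mono) (auto simp: indicator_def)
    also have "\<dots> = ennreal (K * K' * \<tau> powr \<delta> * L) * ?N * ennreal (\<tau> powr (- p - \<delta> + 1) / (- p - \<delta> + 1))"
      using pos h by (subst nn_integral_cmult, simp, subst nn_integral_powr_from_0) auto
    also have "\<dots> = ennreal (K * K' * \<tau> powr \<delta> * L * (\<tau> powr (- p - \<delta> + 1) / (- p - \<delta> + 1))) * ?N"
      using pos K(1) K'(1) L by (subst ennreal_mult[of "K * K' * \<tau> powr \<delta> * L"]) (auto simp: mult_ac)
    also have "K * K' * \<tau> powr \<delta> * L * (\<tau> powr (- p - \<delta> + 1) / (- p - \<delta> + 1)) =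
        K * K' / (1 - p - \<delta>) * (\<tau> powr (1 - p) * L)"
    proof -
      have "\<tau> powr \<delta> * \<tau> powr (- p - \<delta> + 1) = \<tau> powr (1 - p)"
        by (simp add: powr_add[symmetric])
      then show ?thesis using pos by (simp add: field_simps)
    qed
    finally show ?thesis by (simp add: L_def)
  qed
  have "0 < K * K' / (1 - p - \<delta>)" using K(1) K'(1) pos by simp
  from that[OF this main] show ?thesis .
qed

lemma ennreal_assoc_left:
  assumes "0 \<le> x" "0 \<le> D" "0 \<le> y"
  shows "ennreal x * (ennreal (D * y) * z) = ennreal (D * (x * y)) * z"
proof -
  have "ennreal x * ennreal (D * y) = ennreal (D * (x * y))"
    using assms by (simp add: ennreal_mult[symmetric] mult.left_commute)
  then show ?thesis by (metis mult.assoc)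
qed

text \<open>For finite \<open>b\<close> and t \<ge> \<tau> the weighted value Y is factored as
  Y^(b-c) Y^c: the first factor is at most a power of the source norm by the weak-type bound, the
  second integrates to the source norm. For t < \<tau> the assumed sup bound leaves a positive power
  of t / \<tau>, integrable against dt/t. The total mass of that integral does not depend on
  \<tau>.\<close>

lemma LZ_norm_embedding:
  assumes c: "0 < c" "c \<le> b" and p: "0 < p" and AB: "fst B \<le> fst A" "snd A \<le> snd B" and D: "0 < D"
  obtains K where "0 < K" "\<And>h \<tau>. antimono h \<Longrightarrow> h \<in> borel_measurable borel \<Longrightarrow> 0 < \<tau> \<Longrightarrow> \<tau> \<le> 1 \<Longrightarrow>
    (\<And>t. 0 < t \<Longrightarrow> t < \<tau> \<Longrightarrow>
      h t \<le> ennreal (D * (\<tau> powr (- p) * (1 + \<bar>ln \<tau>\<bar>) powr (- fst B))) * LZ_norm p c B h) \<Longrightarrow>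
    LZ_norm p b A h \<le> ennreal (K * (1 + \<bar>ln \<tau>\<bar>) powr (fst A - fst B)) * LZ_norm p c B h"
proof -
  define \<theta> where "\<theta> = fst A - fst B"
  have \<theta>: "0 \<le> \<theta>" using AB by (simp add: \<theta>_def)
  obtain K1 where K1: "0 < K1" "\<And>h t. antimono h \<Longrightarrow> h \<in> borel_measurable borel \<Longrightarrow> 0 < t \<Longrightarrow>
    ennreal (lz_weight p B t) * h t \<le> ennreal K1 * LZ_norm p c B h"
    using LZ_norm_weak[OF c(1)] by blast
  have p2: "0 < p / 2" using p by simp
  \<comment> \<open>Spending only half of the exponent p on the logarithm leaves (t / \<tau>)^(p/2)
    for convergence at 0.\<close>
  obtain Kw where Kw: "0 < Kw" "\<And>t \<tau>. 0 < t \<Longrightarrow> t \<le> \<tau> \<Longrightarrow> \<tau> \<le> 1 \<Longrightarrow>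
    (1 + \<bar>ln t\<bar>) powr fst A \<le> Kw * (\<tau> / t) powr (p / 2) * (1 + \<bar>ln \<tau>\<bar>) powr fst A"
    using log_weight_comparison[OF p2] by blast
  define L where "L = (\<lambda>\<tau>. (1 + \<bar>ln \<tau>\<bar>) powr \<theta>)"
  have L1: "1 \<le> L \<tau>" for \<tau> using \<theta> by (simp add: L_def ge_one_powr_ge_zero)
  have L0: "0 \<le> L \<tau>" for \<tau> using L1[of \<tau>] by simp
  \<comment> \<open>For \<tau> \<le> t \<le> 1 the quotient of the weights is (1 + |ln t|)^\<theta>,
    which is largest at \<tau>; for t > 1 it is at most 1, by the order of the exponents at
    infinity.\<close>
  have large: "lz_weight p A t \<le> L \<tau> * lz_weight p B t" if t: "0 < \<tau>" "\<tau> \<le> t" for t \<tau>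
  proof -
    have "broken_log A t \<le> L \<tau> * broken_log B t"
    proof (cases "t \<le> 1")
      case True
      have "ln \<tau> \<le> ln t" "ln t \<le> 0" using t True by auto
      then have "(1 + \<bar>ln t\<bar>) powr \<theta> \<le> L \<tau>" using \<theta> unfolding L_def by (intro powr_mono2) auto
      then have "(1 + \<bar>ln t\<bar>) powr \<theta> * (1 + \<bar>ln t\<bar>) powr fst B \<le> L \<tau> * (1 + \<bar>ln t\<bar>) powr fst B"
        by (rule mult_right_mono) simp
      then show ?thesis using True by (simp add: broken_log_def \<theta>_def powr_add[symmetric])
    next
      case False
      have "broken_log A t \<le> 1 * broken_log B t"
        using False AB unfolding broken_log_def by (auto intro!: powr_mono)
      also have "\<dots> \<le> L \<tau> * broken_log B t"
        using L1 broken_log_pos[of B t] by (intro mult_right_mono) auto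
      finally show ?thesis .
    qed
    then show ?thesis unfolding lz_weight_def
      by (metis mult.left_commute mult_left_mono powr_ge_zero)
  qed
  have small: "lz_weight p A t * (\<tau> powr (- p) * (1 + \<bar>ln \<tau>\<bar>) powr (- fst B)) \<le> Kw * L \<tau> * (t / \<tau>) powr (p / 2)"
    if t: "0 < t" "t \<le> \<tau>" "\<tau> \<le> 1" for t \<tau>
  proof -
    have "lz_weight p A t = t powr p * (1 + \<bar>ln t\<bar>) powr fst A"
      using t by (simp add: lz_weight_def broken_log_def)
    also have "\<dots> \<le> t powr p * (Kw * (\<tau> / t) powr (p / 2) * (1 + \<bar>ln \<tau>\<bar>) powr fst A)"
      by (intro mult_left_mono Kw(2) t) auto
    finally have "lz_weight p A t * (\<tau> powr (- p) * (1 + \<bar>ln \<tau>\<bar>) powr (- fst B)) \<le>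
       t powr p * (Kw * (\<tau> / t) powr (p / 2) * (1 + \<bar>ln \<tau>\<bar>) powr fst A) *
         (\<tau> powr (- p) * (1 + \<bar>ln \<tau>\<bar>) powr (- fst B))"
      by (rule mult_right_mono) simp
    also have "\<dots> = Kw * ((1 + \<bar>ln \<tau>\<bar>) powr fst A * (1 + \<bar>ln \<tau>\<bar>) powr (- fst B)) *
        (t powr p * (\<tau> / t) powr (p / 2) * \<tau> powr (- p))"
      by (simp only: mult_ac)
    also have "(1 + \<bar>ln \<tau>\<bar>) powr fst A * (1 + \<bar>ln \<tau>\<bar>) powr (- fst B) = L \<tau>"
      by (simp add: L_def \<theta>_def powr_add[symmetric])
    also have "t powr p * (\<tau> / t) powr (p / 2) * \<tau> powr (- p) = (t / \<tau>) powr (p / 2)"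
    proof -
      have "t powr p = t powr (p / 2) * t powr (p / 2)" "\<tau> powr (- p) = \<tau> powr (- (p / 2)) * \<tau> powr (- (p / 2))"
        by (simp_all add: powr_add[symmetric])
      then show ?thesis using t by (simp add: powr_divide powr_minus field_simps)
    qed
    finally show ?thesis .
  qed
  show ?thesis
  proof (cases "b = \<infinity>")
    case True
    define K where "K = K1 + Kw * D"
    have main: "LZ_norm p b A h \<le> ennreal (K * (1 + \<bar>ln \<tau>\<bar>) powr (fst A - fst B)) * LZ_norm p c B h"
      if h: "antimono h" "h \<in> borel_measurable borel" "0 < \<tau>" "\<tau> \<le> 1"
       "\<And>t. 0 < t \<Longrightarrow> t < \<tau> \<Longrightarrow>
        h t \<le> ennreal (D * (\<tau> powr (- p) * (1 + \<bar>ln \<tau>\<bar>) powr (- fst B))) * LZ_norm p c B h" for h \<tau>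
    proof -
      let ?N = "LZ_norm p c B h"
      note [measurable] = h(2)
      have "ennreal (lz_weight p A t) * h t \<le> ennreal (K * L \<tau>) * ?N" if t: "0 < t" for t
      proof (cases "t < \<tau>")
        case True
        have "ennreal (lz_weight p A t) * h t \<le> ennreal (lz_weight p A t) * (ennreal (D * (\<tau> powr (- p) * (1 + \<bar>ln \<tau>\<bar>) powr (- fst B))) * ?N)"
          by (intro mult_left_mono h(5) t True) auto
        also have "\<dots> = ennreal (D * (lz_weight p A t * (\<tau> powr (- p) * (1 + \<bar>ln \<tau>\<bar>) powr (- fst B)))) * ?N"
          using D by (intro ennreal_assoc_left) (auto simp: lz_weight_nonneg)
        also have "\<dots> \<le> ennreal (K * L \<tau>) * ?N"
        proof (intro mult_right_mono ennreal_leI)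
          have "lz_weight p A t * (\<tau> powr (- p) * (1 + \<bar>ln \<tau>\<bar>) powr (- fst B)) \<le> Kw * L \<tau> * (t / \<tau>) powr (p / 2)"
            using small t True h by auto
          also have "\<dots> \<le> Kw * L \<tau> * 1"
            using t True p Kw(1) L0 by (intro mult_left_mono powr_le1) auto
          finally have "D * (lz_weight p A t * (\<tau> powr (- p) * (1 + \<bar>ln \<tau>\<bar>) powr (- fst B))) \<le> D * (Kw * L \<tau> * 1)"
            using D by (intro mult_left_mono) auto
          also have "\<dots> \<le> K * L \<tau>" using K1(1) L0[of \<tau>] by (simp add: K_def algebra_simps)
          finally show "D * (lz_weight p A t * (\<tau> powr (- p) * (1 + \<bar>ln \<tau>\<bar>) powr (- fst B))) \<le> K * L \<tau>" .
        qed auto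
        finally show ?thesis .
      next
        case False
        have "ennreal (lz_weight p A t) * h t \<le> ennreal (L \<tau> * lz_weight p B t) * h t"
          using large False h by (intro mult_right_mono ennreal_leI) auto
        also have "\<dots> = ennreal (L \<tau>) * (ennreal (lz_weight p B t) * h t)"
          using L0 lz_weight_nonneg by (simp add: ennreal_mult mult.assoc)
        also have "\<dots> \<le> ennreal (L \<tau>) * (ennreal K1 * ?N)"
          by (intro mult_left_mono K1(2) h t) auto
        also have "\<dots> = ennreal (K1 * L \<tau>) * ?N"
          using L0 K1(1) by (simp add: ennreal_mult mult_ac)
        also have "\<dots> \<le> ennreal (K * L \<tau>) * ?N"
          using L0 Kw(1) D by (intro mult_right_mono ennreal_leI) (auto simp: K_def)
        finally show ?thesis .
      qed
      then have "esssup (restrict_space lborel {0<..}) (\<lambda>t. ennreal (lz_weight p A t) * h t) \<le> ennreal (K * L \<tau>) * ?N"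
        by (intro esssup_I AE_I2) (auto simp: space_restrict_space intro!: measurable_restrict_space1)
      then show ?thesis by (simp add: LZ_norm_def Lb_qnorm_def True L_def \<theta>_def)
    qed
    have "0 < K" using K1(1) Kw(1) D by (simp add: K_def add_pos_pos)
    from that[OF this main] show ?thesis .
  next
    case False
    then obtain b' where b: "b = ennreal b'" "0 \<le> b'" by (cases b) auto
    then obtain c' where c': "c = ennreal c'" "0 < c'" "c' \<le> b'" using c by (cases c) (auto simp: top_unique)
    with b c have b': "0 < b'" by auto
    have rb: "recip b = 1 / b'" using b b' by (subst recip_finite) auto
    have pb: "0 < p * b' / 2" using p b' by simp
    \<comment> \<open>The first summand comes from t \<ge> \<tau>, the second from t < \<tau>, where
      p b'/2 in the denominator is due to integrating t^(p b'/2 - 1).\<close>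
    define K0 where "K0 = K1 powr (b' - c') + (Kw * D) powr b' / (p * b' / 2)"
    have K0: "0 < K0" unfolding K0_def using K1 Kw D pb by (intro add_pos_pos divide_pos_pos) auto
    have main: "LZ_norm p b A h \<le> ennreal (K0 powr (1 / b') * (1 + \<bar>ln \<tau>\<bar>) powr (fst A - fst B)) * LZ_norm p c B h"
      if h: "antimono h" "h \<in> borel_measurable borel" "0 < \<tau>" "\<tau> \<le> 1"
       "\<And>t. 0 < t \<Longrightarrow> t < \<tau> \<Longrightarrow>
        h t \<le> ennreal (D * (\<tau> powr (- p) * (1 + \<bar>ln \<tau>\<bar>) powr (- fst B))) * LZ_norm p c B h" for h \<tau>
    proof -
      let ?N = "LZ_norm p c B h"
      note [measurable] = h(2)
      \<comment> \<open>Extracting the factor 1/t presents both norms as integrals against dt/t of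
        the same kind of weighted value; only then can powers be traded between b' and c'.\<close>
      have split_wt: "epowr (ennreal (lz_weight (p - 1 / r) E t) * h t) r = ennreal (1 / t) * epowr (ennreal (lz_weight p E t) * h t) r"
        if "0 < t" "0 < r" for t r E
      proof -
        have "lz_weight (p - 1 / r) E t = t powr (- 1 / r) * lz_weight p E t"
          by (simp add: lz_weight_def powr_add[symmetric] mult.assoc[symmetric])
        then have "ennreal (lz_weight (p - 1 / r) E t) * h t = ennreal (t powr (- 1 / r)) * (ennreal (lz_weight p E t) * h t)"
          using lz_weight_nonneg by (simp add: ennreal_mult mult.assoc)
        moreover have "epowr (ennreal (t powr (- 1 / r))) r = ennreal (1 / t)"
        proof -
          have "- 1 / r * r = - 1" using that by simp
          then show ?thesis using that
            by (simp only: epowr_ennreal[OF powr_ge_zero] powr_powr) (simp add: powr_minus_divide)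
        qed
        ultimately show ?thesis by (simp only: epowr_mult)
      qed
      define G where "G = (\<lambda>t. epowr (ennreal (lz_weight (p - 1 / c') B t) * h t) c')"
      have [measurable]: "G \<in> borel_measurable borel" unfolding G_def by measurable
      have GN: "(\<integral>\<^sup>+ t. G t * indicator {0<..} t \<partial>lborel) = epowr ?N c'"
        unfolding G_def c'(1) by (rule LZ_norm_finite[symmetric]) (use c' h in auto)
      define P where "P = ennreal (L \<tau> powr b')"
      define Q where "Q = ennreal ((Kw * D * L \<tau>) powr b' * \<tau> powr (- (p * b' / 2)))"
      have bound: "epowr (ennreal (lz_weight (p - 1 / b') A t) * h t) b' * indicator {0<..} t \<le>
          P * epowr (ennreal K1 * ?N) (b' - c') * (G t * indicator {0<..} t)
          + Q * epowr ?N b' * (ennreal (t powr (p * b' / 2 - 1)) * indicator {0<..<\<tau>} t)" for t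
      proof -
        consider "t \<le> 0" | "0 < t" "t < \<tau>" | "\<tau> \<le> t" by linarith
        then show ?thesis
        proof cases
          case 2
          have "ennreal (lz_weight p A t) * h t \<le> ennreal (lz_weight p A t) * (ennreal (D * (\<tau> powr (- p) * (1 + \<bar>ln \<tau>\<bar>) powr (- fst B))) * ?N)"
            by (intro mult_left_mono h(5) 2) auto
          also have "\<dots> = ennreal (D * (lz_weight p A t * (\<tau> powr (- p) * (1 + \<bar>ln \<tau>\<bar>) powr (- fst B)))) * ?N"
            using D by (intro ennreal_assoc_left) (auto simp: lz_weight_nonneg)
          also have "\<dots> \<le> ennreal (D * (Kw * L \<tau> * (t / \<tau>) powr (p / 2))) * ?N"
            using small 2 h D by (intro mult_right_mono ennreal_leI mult_left_mono) auto
          finally have "epowr (ennreal (lz_weight p A t) * h t) b' \<le> epowr (ennreal (D * (Kw * L \<tau> * (t / \<tau>) powr (p / 2))) * ?N) b'"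
            using b' by (rule_tac epowr_mono) auto
          also have "\<dots> = ennreal ((Kw * D * L \<tau>) powr b' * \<tau> powr (- (p * b' / 2)) * t powr (p * b' / 2)) * epowr ?N b'"
          proof -
            have "(D * (Kw * L \<tau> * (t / \<tau>) powr (p / 2))) powr b' = (Kw * D * L \<tau>) powr b' * \<tau> powr (- (p * b' / 2)) * t powr (p * b' / 2)"
            proof -
              have "D * (Kw * L \<tau> * (t / \<tau>) powr (p / 2)) = (Kw * D * L \<tau>) * (t / \<tau>) powr (p / 2)" by simp
              moreover have "((t / \<tau>) powr (p / 2)) powr b' = t powr (p * b' / 2) / \<tau> powr (p * b' / 2)"
                using 2 by (simp add: powr_powr powr_divide)
              ultimately show ?thesis using D Kw(1) L0[of \<tau>] by (simp add: powr_mult powr_minus_divide)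
            qed
            then show ?thesis using D Kw(1) L0[of \<tau>] by (simp add: epowr_mult)
          qed
          finally have "ennreal (1 / t) * epowr (ennreal (lz_weight p A t) * h t) b' \<le>
             ennreal (1 / t) * (ennreal ((Kw * D * L \<tau>) powr b' * \<tau> powr (- (p * b' / 2)) * t powr (p * b' / 2)) * epowr ?N b')"
            by (rule mult_left_mono) simp
          also have "\<dots> = Q * epowr ?N b' * ennreal (t powr (p * b' / 2 - 1))"
          proof -
            have "ennreal (1 / t) * ennreal ((Kw * D * L \<tau>) powr b' * \<tau> powr (- (p * b' / 2)) * t powr (p * b' / 2)) =
                Q * ennreal (t powr (p * b' / 2 - 1))"
              unfolding Q_def using 2 by (simp add: ennreal_mult[symmetric] powr_diff)
            then show ?thesis by (simp only: mult.assoc[symmetric]) (simp only: mult_ac)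
          qed
          also have "\<dots> \<le> P * epowr (ennreal K1 * ?N) (b' - c') * G t + Q * epowr ?N b' * ennreal (t powr (p * b' / 2 - 1))"
            by simp
          finally show ?thesis using 2 b' by (simp add: split_wt)
        next
          case 3
          then have t: "0 < t" using h by simp
          let ?Y = "ennreal (lz_weight p B t) * h t"
          have "ennreal (lz_weight p A t) * h t \<le> ennreal (L \<tau> * lz_weight p B t) * h t"
            using large 3 h by (intro mult_right_mono ennreal_leI) auto
          also have "\<dots> = ennreal (L \<tau>) * ?Y"
            using L0 lz_weight_nonneg by (simp add: ennreal_mult mult.assoc)
          finally have "epowr (ennreal (lz_weight p A t) * h t) b' \<le> epowr (ennreal (L \<tau>) * ?Y) b'"
            using b' by (rule_tac epowr_mono) auto
          \<comment> \<open>The exponent is split so that b' - c' copies are bounded by the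
            weak-type estimate while c' copies stay under the integral.\<close>
          also have "\<dots> = P * epowr ?Y (b' - c' + c')"
            using L0 by (simp add: epowr_mult P_def)
          also have "\<dots> = P * (epowr ?Y (b' - c') * epowr ?Y c')"
            by (simp only: epowr_add)
          also have "\<dots> \<le> P * (epowr (ennreal K1 * ?N) (b' - c') * epowr ?Y c')"
            using c'(3) by (intro mult_left_mono mult_right_mono epowr_mono K1(2) h t) auto
          finally have "ennreal (1 / t) * epowr (ennreal (lz_weight p A t) * h t) b' \<le>
              ennreal (1 / t) * (P * (epowr (ennreal K1 * ?N) (b' - c') * epowr ?Y c'))"
            by (rule mult_left_mono) simp
          also have "\<dots> = P * epowr (ennreal K1 * ?N) (b' - c') * (ennreal (1 / t) * epowr ?Y c')"
            by (simp only: mult_ac)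
          also have "\<dots> = P * epowr (ennreal K1 * ?N) (b' - c') * G t"
            unfolding G_def by (subst split_wt[OF t c'(2)]) simp
          finally show ?thesis using t 3 b' by (simp add: split_wt)
        qed simp
      qed
      have "epowr (LZ_norm p b A h) b' = (\<integral>\<^sup>+ t. epowr (ennreal (lz_weight (p - 1 / b') A t) * h t) b' * indicator {0<..} t \<partial>lborel)"
        unfolding b(1) by (rule LZ_norm_finite[OF b' h(2)])
      also have "\<dots> \<le> (\<integral>\<^sup>+ t. P * epowr (ennreal K1 * ?N) (b' - c') * (G t * indicator {0<..} t)
          + Q * epowr ?N b' * (ennreal (t powr (p * b' / 2 - 1)) * indicator {0<..<\<tau>} t) \<partial>lborel)"
        by (intro nn_integral_mono bound)
      also have "\<dots> = P * epowr (ennreal K1 * ?N) (b' - c') * (\<integral>\<^sup>+ t. G t * indicator {0<..} t \<partial>lborel)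
          + Q * epowr ?N b' * (\<integral>\<^sup>+ t. ennreal (t powr (p * b' / 2 - 1)) * indicator {0<..<\<tau>} t \<partial>lborel)"
        by (subst nn_integral_add, simp, simp, subst nn_integral_cmult, simp, subst nn_integral_cmult, simp, rule refl)
      also have "(\<integral>\<^sup>+ t. ennreal (t powr (p * b' / 2 - 1)) * indicator {0<..<\<tau>} t \<partial>lborel) = ennreal (\<tau> powr (p * b' / 2) / (p * b' / 2))"
        using nn_integral_powr_from_0[of "p * b' / 2 - 1" \<tau>] pb h(3) by simp
      also have "P * epowr (ennreal K1 * ?N) (b' - c') * (\<integral>\<^sup>+ t. G t * indicator {0<..} t \<partial>lborel) =
          ennreal (L \<tau> powr b' * K1 powr (b' - c')) * epowr ?N b'"
      proof -
        have "epowr ?N (b' - c') * epowr ?N c' = epowr ?N b'"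
          by (simp only: epowr_add[symmetric] diff_add_cancel)
        then show ?thesis
          unfolding GN epowr_mult P_def using K1(1) by (simp add: ennreal_mult mult.assoc)
      qed
      also have "Q * epowr ?N b' * ennreal (\<tau> powr (p * b' / 2) / (p * b' / 2)) =
          ennreal (L \<tau> powr b' * ((Kw * D) powr b' / (p * b' / 2))) * epowr ?N b'"
      proof -
        have "(Kw * D * L \<tau>) powr b' * \<tau> powr (- (p * b' / 2)) * (\<tau> powr (p * b' / 2) / (p * b' / 2)) =
            L \<tau> powr b' * ((Kw * D) powr b' / (p * b' / 2))"
        proof -
          have "\<tau> powr (- (p * b' / 2)) * \<tau> powr (p * b' / 2) = 1"
            using h(3) by (simp add: powr_add[symmetric])
          then show ?thesis using Kw(1) D L0[of \<tau>] by (simp add: powr_mult field_simps)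
        qed
        then have "Q * ennreal (\<tau> powr (p * b' / 2) / (p * b' / 2)) = ennreal (L \<tau> powr b' * ((Kw * D) powr b' / (p * b' / 2)))"
          unfolding Q_def using pb by (subst ennreal_mult[symmetric]) auto
        then show ?thesis by (metis mult.assoc mult.commute)
      qed
      also have "ennreal (L \<tau> powr b' * K1 powr (b' - c')) * epowr ?N b' +
          ennreal (L \<tau> powr b' * ((Kw * D) powr b' / (p * b' / 2))) * epowr ?N b' =
          ennreal (K0 * L \<tau> powr b') * epowr ?N b'"
        unfolding K0_def using pb
        by (subst distrib_right[symmetric], subst ennreal_plus[symmetric]) (auto simp: algebra_simps)
      also have "\<dots> = epowr (ennreal (K0 powr (1 / b') * L \<tau>) * ?N) b'"
        using K0 L0[of \<tau>] b' by (simp add: epowr_mult powr_mult powr_powr)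
      finally have "epowr (epowr (LZ_norm p b A h) b') (1 / b') \<le> epowr (epowr (ennreal (K0 powr (1 / b') * L \<tau>) * ?N) b') (1 / b')"
        using b' by (rule_tac epowr_mono) auto
      then show ?thesis unfolding epowr_inverse_cancel[OF b'] by (simp add: L_def \<theta>_def)
    qed
    have "0 < K0 powr (1 / b')" using K0 by simp
    from that[OF this main] show ?thesis .
  qed
qed

section \<open>Averages against dilates of a kernel\<close>

text \<open>The bound does not depend on the shift \<open>w\<close>. It thus serves as a majorant
  both for exchanging the box integral with the kernel integral and for the passage to fine
  scales.\<close>

lemma integrable_L1_bounded_box:
  fixes g g1 :: "'a::euclidean_space \<Rightarrow> complex"
  assumes [measurable]: "g \<in> borel_measurable borel" and g1: "integrable lborel g1"
    and le: "\<And>x. norm (g x) \<le> norm (g1 x) + \<sigma>"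
  shows "integrable lborel (\<lambda>x. indicator (box u v) x *\<^sub>R g (x + w))"
    and "(LINT x|lborel. norm (indicator (box u v) x *\<^sub>R g (x + w)))
      \<le> (LINT x|lborel. norm (g1 x)) + \<sigma> * measure lborel (box u v)"
proof -
  have i1: "integrable lborel (\<lambda>x. norm (g1 (w + 1 *\<^sub>R x)))"
    by (intro integrable_norm lborel_integrable_affine g1) simp
  have i2: "integrable lborel (\<lambda>x. norm (g1 (w + 1 *\<^sub>R x)) + \<sigma> * indicator (box u v) x)"
    by (intro Bochner_Integration.integrable_add i1 integrable_mult_right integrable_real_indicator)
       (auto simp: emeasure_lborel_box_eq)
  have b: "norm (indicator (box u v) x *\<^sub>R g (x + w)) \<le> norm (g1 (w + 1 *\<^sub>R x)) + \<sigma> * indicator (box u v) x" for x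
    using le[of "x + w"] by (auto simp: indicator_def add.commute)
  show i: "integrable lborel (\<lambda>x. indicator (box u v) x *\<^sub>R g (x + w))"
  proof (rule Bochner_Integration.integrable_bound[OF i2])
    show "AE x in lborel. norm (indicator (box u v) x *\<^sub>R g (x + w)) \<le>
        norm (norm (g1 (w + 1 *\<^sub>R x)) + \<sigma> * indicator (box u v) x)"
      using b by (intro AE_I2) (metis abs_ge_self order_trans real_norm_def)
  qed measurable
  have "(LINT x|lborel. norm (indicator (box u v) x *\<^sub>R g (x + w))) \<le>
      (LINT x|lborel. norm (g1 (w + 1 *\<^sub>R x)) + \<sigma> * indicator (box u v) x)"
    by (intro integral_mono integrable_norm i i2 b)
  also have "\<dots> = (LINT x|lborel. norm (g1 (w + 1 *\<^sub>R x))) + (LINT x|lborel. \<sigma> * indicator (box u v) x)"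
    by (intro Bochner_Integration.integral_add i1 integrable_mult_right integrable_real_indicator)
       (auto simp: emeasure_lborel_box_eq)
  also have "(LINT x|lborel. norm (g1 (w + 1 *\<^sub>R x))) = (LINT x|lborel. norm (g1 x))"
    using borel_measurable_integrable[OF g1] by (subst lborel_integral_affine[of _ 1 w]) auto
  finally show "(LINT x|lborel. norm (indicator (box u v) x *\<^sub>R g (x + w)))
      \<le> (LINT x|lborel. norm (g1 x)) + \<sigma> * measure lborel (box u v)" by simp
qed

text \<open>The bounded part of \<open>g\<close> is paired with the L_1 norm of the kernel and the
  integrable part with its sup norm; the power of r is the Jacobian of the dilation.\<close>

lemma kernel_average_bound:
  fixes g g1 \<Phi> :: "'a::euclidean_space \<Rightarrow> complex"
  assumes [measurable]: "g \<in> borel_measurable borel" and g1: "integrable lborel g1"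
    and le: "\<And>x. norm (g x) \<le> norm (g1 x) + \<sigma>"
    and \<Phi>: "integrable lborel \<Phi>" "\<And>z. norm (\<Phi> z) \<le> S" and "0 < r" "0 \<le> \<sigma>"
  shows "integrable lborel (\<lambda>z. g (a + r *\<^sub>R z) * \<Phi> z)"
    and "norm (LINT z|lborel. g (a + r *\<^sub>R z) * \<Phi> z)
      \<le> \<sigma> * (LINT z|lborel. norm (\<Phi> z)) + S * (LINT x|lborel. norm (g1 x)) / r ^ DIM('a)"
proof -
  have [measurable]: "\<Phi> \<in> borel_measurable borel" "g1 \<in> borel_measurable borel"
    using borel_measurable_integrable[OF \<Phi>(1)] borel_measurable_integrable[OF g1] by auto
  have S: "0 \<le> S" using \<Phi>(2)[of 0] norm_ge_zero order_trans by blast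
  have i1: "integrable lborel (\<lambda>z. norm (g1 (a + r *\<^sub>R z)))"
    using \<open>0 < r\<close> by (intro integrable_norm lborel_integrable_affine g1) simp
  let ?B = "\<lambda>z. \<sigma> * norm (\<Phi> z) + S * norm (g1 (a + r *\<^sub>R z))"
  have iB: "integrable lborel ?B"
    by (intro Bochner_Integration.integrable_add integrable_mult_right i1 integrable_norm \<Phi>)
  have b: "norm (g (a + r *\<^sub>R z) * \<Phi> z) \<le> ?B z" for z
  proof -
    have "norm (g (a + r *\<^sub>R z) * \<Phi> z) \<le> (norm (g1 (a + r *\<^sub>R z)) + \<sigma>) * norm (\<Phi> z)"
      unfolding norm_mult by (intro mult_right_mono le) auto
    moreover have "norm (g1 (a + r *\<^sub>R z)) * norm (\<Phi> z) \<le> norm (g1 (a + r *\<^sub>R z)) * S"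
      by (intro mult_left_mono \<Phi>(2)) auto
    ultimately show ?thesis by (simp add: algebra_simps)
  qed
  show i: "integrable lborel (\<lambda>z. g (a + r *\<^sub>R z) * \<Phi> z)"
  proof (rule Bochner_Integration.integrable_bound[OF iB])
    show "AE z in lborel. norm (g (a + r *\<^sub>R z) * \<Phi> z) \<le> norm (?B z)"
      using b by (intro AE_I2) (metis abs_ge_self order_trans real_norm_def)
  qed measurable
  have "norm (LINT z|lborel. g (a + r *\<^sub>R z) * \<Phi> z) \<le> (LINT z|lborel. ?B z)"
    by (intro Bochner_Integration.integral_norm_bound_integral i iB b)
  also have "\<dots> = \<sigma> * (LINT z|lborel. norm (\<Phi> z)) + S * (LINT z|lborel. norm (g1 (a + r *\<^sub>R z)))"
    by (subst Bochner_Integration.integral_add) (auto intro!: integrable_mult_right i1 integrable_norm \<Phi>)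
  also have "(LINT z|lborel. norm (g1 (a + r *\<^sub>R z))) = (LINT x|lborel. norm (g1 x)) / r ^ DIM('a)"
    using \<open>0 < r\<close> by (subst lborel_integral_affine[of "\<lambda>x. norm (g1 x)" r a]) auto
  finally show "norm (LINT z|lborel. g (a + r *\<^sub>R z) * \<Phi> z)
      \<le> \<sigma> * (LINT z|lborel. norm (\<Phi> z)) + S * (LINT x|lborel. norm (g1 x)) / r ^ DIM('a)" by simp
qed

lemma integral_box_kernel_average:
  fixes g g1 \<Phi> :: "'a::euclidean_space \<Rightarrow> complex"
  assumes [measurable]: "g \<in> borel_measurable borel" and g1: "integrable lborel g1"
    and le: "\<And>x. norm (g x) \<le> norm (g1 x) + \<sigma>"
    and \<Phi>: "integrable lborel \<Phi>"
  shows "(LINT a|lborel. indicator (box u v) a *\<^sub>R (LINT z|lborel. g (a + r *\<^sub>R z) * \<Phi> z)) =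
    (LINT z|lborel. (LINT a|lborel. indicator (box u v) a *\<^sub>R g (a + r *\<^sub>R z)) * \<Phi> z)"
proof -
  have [measurable]: "\<Phi> \<in> borel_measurable borel"
    using borel_measurable_integrable[OF \<Phi>] by auto
  define F where "F = (\<lambda>(z, a). indicator (box u v) a *\<^sub>R g (a + r *\<^sub>R z) * \<Phi> z)"
  have [measurable]: "F \<in> borel_measurable (lborel \<Otimes>\<^sub>M lborel)"
    unfolding F_def by measurable
  have F_eq: "F (z, a) = (indicator (box u v) a *\<^sub>R g (a + r *\<^sub>R z)) * \<Phi> z" for z a
    by (simp add: F_def)
  have iF: "integrable (lborel \<Otimes>\<^sub>M lborel) F"
  proof (rule lborel_pair.Fubini_integrable)
    let ?C = "(LINT x|lborel. norm (g1 x)) + \<sigma> * measure lborel (box u v)"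
    show "integrable lborel (\<lambda>z. LINT a|lborel. norm (F (z, a)))"
    proof (rule Bochner_Integration.integrable_bound)
      show "integrable lborel (\<lambda>z. ?C * norm (\<Phi> z))"
        by (intro integrable_mult_right integrable_norm \<Phi>)
      show "AE z in lborel. norm (LINT a|lborel. norm (F (z, a))) \<le> norm (?C * norm (\<Phi> z))"
      proof (intro AE_I2)
        fix z
        have "(LINT a|lborel. norm (F (z, a))) =
            (LINT a|lborel. norm (indicator (box u v) a *\<^sub>R g (a + r *\<^sub>R z))) * norm (\<Phi> z)"
          unfolding F_eq norm_mult[of "_ *\<^sub>R _"] by (rule integral_mult_left_zero)
        also have "\<dots> \<le> ?C * norm (\<Phi> z)"
          by (intro mult_right_mono integrable_L1_bounded_box(2)[OF assms(1) g1 le]) auto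
        finally have "(LINT a|lborel. norm (F (z, a))) \<le> ?C * norm (\<Phi> z)" .
        moreover have "0 \<le> (LINT a|lborel. norm (F (z, a)))" by (rule integral_nonneg_AE) auto
        ultimately show "norm (LINT a|lborel. norm (F (z, a))) \<le> norm (?C * norm (\<Phi> z))" by simp
      qed
    qed measurable
    show "AE z in lborel. integrable lborel (\<lambda>a. F (z, a))"
      unfolding F_eq
      by (intro AE_I2 integrable_mult_left integrable_L1_bounded_box(1)[OF assms(1) g1 le])
  qed measurable
  have "(LINT a|lborel. indicator (box u v) a *\<^sub>R (LINT z|lborel. g (a + r *\<^sub>R z) * \<Phi> z)) =
      (LINT a|lborel. LINT z|lborel. F (z, a))"
    unfolding F_eq by (intro Bochner_Integration.integral_cong refl) (simp flip: integral_scaleR_right)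
  also have "\<dots> = (LINT z|lborel. LINT a|lborel. F (z, a))"
    using lborel_pair.Fubini_integral[of "\<lambda>z a. F (z, a)"] iF by simp
  also have "\<dots> = (LINT z|lborel. (LINT a|lborel. indicator (box u v) a *\<^sub>R g (a + r *\<^sub>R z)) * \<Phi> z)"
    unfolding F_eq by (simp only: integral_mult_left_zero)
  finally show ?thesis .
qed

text \<open>The shift is transferred from \<open>g\<close> to the indicator of the box. Indicators
  of shifted boxes converge pointwise off the frontier, which is a null set, so dominated
  convergence takes the place of continuity of translations in L_1.\<close>

lemma integral_box_translate_tendsto:
  fixes g g1 :: "'a::euclidean_space \<Rightarrow> complex"
  assumes [measurable]: "g \<in> borel_measurable borel" and g1: "integrable lborel g1"
    and le: "\<And>x. norm (g x) \<le> norm (g1 x) + \<sigma>" and "0 \<le> \<sigma>" and w: "w \<longlonglongrightarrow> 0"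
  shows "(\<lambda>j. LINT a|lborel. indicator (box u v) a *\<^sub>R g (a + w j))
    \<longlonglongrightarrow> (LINT a|lborel. indicator (box u v) a *\<^sub>R g a)"
proof -
  obtain W where W: "\<And>j. norm (w j) \<le> W"
    using convergent_imp_Bseq[of w] w unfolding convergent_def Bseq_def by auto
  obtain R where R: "\<And>x. x \<in> box u v \<Longrightarrow> norm x \<le> R"
    using bounded_box[of u v] unfolding bounded_iff by auto
  have eq: "(LINT a|lborel. indicator (box u v) a *\<^sub>R g (a + w j)) =
      (LINT y|lborel. indicator (box u v) (y - w j) *\<^sub>R g y)" for j
    by (subst lborel_integral_affine[of _ 1 "w j"]) (auto simp: add.commute)
  have "(\<lambda>j. LINT y|lborel. indicator (box u v) (y - w j) *\<^sub>R g y)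
      \<longlonglongrightarrow> (LINT y|lborel. indicator (box u v) y *\<^sub>R g y)"
  proof (rule integral_dominated_convergence)
    let ?D = "\<lambda>y. norm (g1 y) + \<sigma> * indicator (cball 0 (R + W)) y"
    show "integrable lborel ?D"
      by (intro Bochner_Integration.integrable_add integrable_norm g1 integrable_mult_right integrable_real_indicator)
         (use emeasure_lborel_cball_finite in \<open>auto simp: infinity_ennreal_def\<close>)
    show "AE y in lborel. norm (indicator (box u v) (y - w j) *\<^sub>R g y) \<le> ?D y" for j
    proof (intro AE_I2)
      fix y
      show "norm (indicator (box u v) (y - w j) *\<^sub>R g y) \<le> ?D y"
      proof (cases "y - w j \<in> box u v")
        case True
        have "norm y \<le> norm (y - w j) + norm (w j)"
          using norm_triangle_ineq[of "y - w j" "w j"] by simp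
        also have "\<dots> \<le> R + W" using R[OF True] W[of j] by simp
        finally show ?thesis using True le[of y] by simp
      qed (use \<open>0 \<le> \<sigma>\<close> in auto)
    qed
    have "frontier (box u v) \<in> null_sets lborel"
      using negligible_convex_frontier[OF convex_box(2)[of u v]]
      by (auto simp: null_sets_completion_iff negligible_iff_null_sets)
    then have "AE y in lborel. y \<notin> frontier (box u v)" by (rule AE_not_in)
    then show "AE y in lborel. (\<lambda>j. indicator (box u v) (y - w j) *\<^sub>R g y)
        \<longlonglongrightarrow> indicator (box u v) y *\<^sub>R g y"
    proof eventually_elim
      case (elim y)
      have lim: "(\<lambda>j. y - w j) \<longlonglongrightarrow> y" using tendsto_diff[OF tendsto_const w, of y] by simp
      have "\<forall>\<^sub>F j in sequentially. indicator (box u v) (y - w j) = (indicator (box u v) y :: real)"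
      proof (cases "y \<in> box u v")
        case True
        then show ?thesis
          using topological_tendstoD[OF lim open_box True] by (auto elim!: eventually_mono)
      next
        case False
        then have "y \<in> - closure (box u v)"
          using elim interior_subset by (auto simp: frontier_def)
        moreover have "open (- closure (box u v))" by auto
        ultimately have "\<forall>\<^sub>F j in sequentially. y - w j \<in> - closure (box u v)"
          using topological_tendstoD[OF lim] by blast
        then have "\<forall>\<^sub>F j in sequentially. y - w j \<notin> box u v"
          by (rule eventually_mono) (use closure_subset in auto)
        then show ?thesis by (rule eventually_mono) (use False in simp)
      qed
      then show ?case
        by (intro tendsto_eventually) (auto elim!: eventually_mono)
    qed
  qed measurable
  then show ?thesis by (simp add: eq)
qed

text \<open>Within one fixed box \<open>f\<close> is integrable. Intersections of boxes are boxes,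
  so a Dynkin argument extends vanishing of the integral to all Borel sets, and countably many boxes
  exhaust the space.\<close>

lemma AE_eq_0_if_integral_box_eq_0:
  fixes f :: "'a::euclidean_space \<Rightarrow> complex"
  assumes int: "\<And>u v. integrable lborel (\<lambda>x. indicator (box u v) x *\<^sub>R f x)"
    and zero: "\<And>u v. (LINT x|lborel. indicator (box u v) x *\<^sub>R f x) = 0"
  shows "AE x in lborel. f x = 0"
proof -
  have "AE x in lborel. indicator (box u v) x *\<^sub>R f x = 0" for u v
  proof (rule sigma_finite_measure.density_zero[OF sigma_finite_lborel int])
    define h where "h = (\<lambda>x. indicator (box u v) x *\<^sub>R f x)"
    have ih: "integrable lborel h" unfolding h_def by (rule int)
    have si: "set_integrable lborel A h" if "A \<in> sets borel" for A
      unfolding set_integrable_def using that by (intro integrable_mult_indicator ih) auto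
    fix A :: "'a set" assume A: "A \<in> sets lborel"
    have "Int_stable (range (\<lambda>(a, b). box a b :: 'a set))"
      by (auto simp: Int_stable_def box_Int_box)
    moreover have "(range (\<lambda>(a, b). box a b :: 'a set)) \<subseteq> Pow UNIV" by auto
    moreover have "A \<in> sigma_sets UNIV (range (\<lambda>(a, b). box a b))"
      using A unfolding sets_lborel borel_eq_box by simp
    ultimately have "set_lebesgue_integral lborel A h = 0"
    proof (induction rule: sigma_sets_induct_disjoint)
      case (basic A)
      then obtain a b where "A = box a b" by auto
      then have "(\<lambda>x. indicator A x *\<^sub>R h x) =
          (\<lambda>x. indicator (box (\<Sum>i\<in>Basis. max (a \<bullet> i) (u \<bullet> i) *\<^sub>R i) (\<Sum>i\<in>Basis. min (b \<bullet> i) (v \<bullet> i) *\<^sub>R i)) x *\<^sub>R f x)"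
        by (auto simp: h_def fun_eq_iff indicator_inter_arith[symmetric] box_Int_box)
      then show ?case unfolding set_lebesgue_integral_def using zero by simp
    next
      case empty
      show ?case by (simp add: set_lebesgue_integral_def)
    next
      case (compl A)
      then have A: "A \<in> sets borel" by (simp add: borel_eq_box)
      have "(LINT x|lborel. h x) = (LINT x|lborel. indicator (UNIV - A) x *\<^sub>R h x + indicator A x *\<^sub>R h x)"
        by (intro Bochner_Integration.integral_cong refl) (auto simp: indicator_def)
      also have "\<dots> = set_lebesgue_integral lborel (UNIV - A) h + set_lebesgue_integral lborel A h"
        unfolding set_lebesgue_integral_def
        using A si[of A] si[of "UNIV - A"]
        by (intro Bochner_Integration.integral_add) (auto simp: set_integrable_def)
      finally show ?case using compl zero by (simp add: h_def)
    next
      case (union F)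
      then have F: "F i \<in> sets borel" for i by (auto simp: borel_eq_box subset_eq)
      have "(LINT x:(\<Union>i. F i)|lborel. h x) = (\<Sum>i. (LINT x:(F i)|lborel. h x))"
        using union F by (intro lebesgue_integral_countable_add si) (auto simp: disjoint_family_on_def)
      then show ?case using union by simp
    qed
    then show "set_lebesgue_integral lborel A (\<lambda>x. indicator (box u v) x *\<^sub>R f x) = 0"
      by (simp add: h_def)
  qed
  then have "AE x in lborel. \<forall>n::nat. indicator (box (- real n *\<^sub>R One) (real n *\<^sub>R One)) x *\<^sub>R f x = 0"
    by (subst AE_all_countable) blast
  then show ?thesis
  proof eventually_elim
    case (elim x)
    obtain n where "x \<in> box (- real n *\<^sub>R One) (real n *\<^sub>R One)"
      using UN_box_eq_UNIV by auto
    then show ?case using elim[rule_format, of n] by simp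
  qed
qed

text \<open>If averages of \<open>g\<close> against arbitrarily fine dilates of a kernel agree with the average at a
  fixed scale, then \<open>g\<close> itself is that average, and therefore bounded.\<close>

lemma AE_bounded_if_kernel_averages_stable:
  fixes g g1 \<Phi> :: "'a::euclidean_space \<Rightarrow> complex"
  assumes g: "g \<in> borel_measurable borel" and g1: "integrable lborel g1"
    and le: "\<And>x. norm (g x) \<le> norm (g1 x) + \<sigma>" and \<sigma>: "0 \<le> \<sigma>"
    and \<Phi>: "integrable lborel \<Phi>" "\<And>z. norm (\<Phi> z) \<le> S" "(LINT z|lborel. \<Phi> z) = 1"
    and r: "\<And>j. 0 < r j" "r \<longlonglongrightarrow> 0"
    and stable: "\<And>j a. (LINT z|lborel. g (a + r j *\<^sub>R z) * \<Phi> z) = (LINT z|lborel. g (a + r 0 *\<^sub>R z) * \<Phi> z)"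
  shows "AE x in lborel. norm (g x)
    \<le> \<sigma> * (LINT z|lborel. norm (\<Phi> z)) + S * (LINT x|lborel. norm (g1 x)) / r 0 ^ DIM('a)"
proof -
  have [measurable]: "\<Phi> \<in> borel_measurable borel" "g \<in> borel_measurable borel"
    using borel_measurable_integrable[OF \<Phi>(1)] g by auto
  let ?M = "\<sigma> * (LINT z|lborel. norm (\<Phi> z)) + S * (LINT x|lborel. norm (g1 x)) / r 0 ^ DIM('a)"
  define G where "G = (\<lambda>a. LINT z|lborel. g (a + r 0 *\<^sub>R z) * \<Phi> z)"
  have [measurable]: "G \<in> borel_measurable borel" unfolding G_def by measurable
  have GM: "norm (G a) \<le> ?M" for a
    unfolding G_def by (rule kernel_average_bound(2)[OF g g1 le \<Phi>(1,2) r(1) \<sigma>])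
  have ig: "integrable lborel (\<lambda>x. indicator (box u v) x *\<^sub>R g x)" for u v
    using integrable_L1_bounded_box(1)[OF g g1 le, of u v 0] by simp
  have iG: "integrable lborel (\<lambda>x. indicator (box u v) x *\<^sub>R G x)" for u v
  proof (rule Bochner_Integration.integrable_bound)
    show "integrable lborel (\<lambda>x. ?M * indicator (box u v) x)"
      by (intro integrable_mult_right integrable_real_indicator) (auto simp: emeasure_lborel_box_eq)
    show "AE x in lborel. norm (indicator (box u v) x *\<^sub>R G x) \<le> norm (?M * indicator (box u v) x)"
      using GM by (intro AE_I2) (force simp: indicator_def intro: order_trans[OF _ abs_ge_self])
  qed measurable
  have eq: "(LINT x|lborel. indicator (box u v) x *\<^sub>R g x) = (LINT x|lborel. indicator (box u v) x *\<^sub>R G x)" for u v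
  \<comment> \<open>The comparison is made after integrating over a box: the averages of
    \<open>g\<close> then tend to the integral of \<open>g\<close>, while by stability and Fubini
    they all equal the integral of \<open>G\<close>. No pointwise convergence of the averages is
    involved.\<close>
  proof (rule LIMSEQ_unique)
    let ?I = "\<lambda>w. LINT a|lborel. indicator (box u v) a *\<^sub>R g (a + w)"
    let ?C = "(LINT x|lborel. norm (g1 x)) + \<sigma> * measure lborel (box u v)"
    have "(\<lambda>j. LINT z|lborel. ?I (r j *\<^sub>R z) * \<Phi> z) \<longlonglongrightarrow> (LINT z|lborel. (LINT x|lborel. indicator (box u v) x *\<^sub>R g x) * \<Phi> z)"
    proof (rule integral_dominated_convergence)
      show "integrable lborel (\<lambda>z. ?C * norm (\<Phi> z))"
        by (intro integrable_mult_right integrable_norm \<Phi>)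
      show "AE z in lborel. norm (?I (r j *\<^sub>R z) * \<Phi> z) \<le> ?C * norm (\<Phi> z)" for j
        unfolding norm_mult
        by (intro AE_I2 mult_right_mono order_trans[OF integral_norm_bound integrable_L1_bounded_box(2)[OF g g1 le]]) auto
      show "AE z in lborel. (\<lambda>j. ?I (r j *\<^sub>R z) * \<Phi> z) \<longlonglongrightarrow> (LINT x|lborel. indicator (box u v) x *\<^sub>R g x) * \<Phi> z"
      proof (intro AE_I2 tendsto_mult tendsto_const integral_box_translate_tendsto[OF g g1 le \<sigma>])
        fix z :: 'a
        show "(\<lambda>j. r j *\<^sub>R z) \<longlonglongrightarrow> 0" using tendsto_scaleR[OF r(2) tendsto_const, of z] by simp
      qed
    qed measurable
    then show "(\<lambda>j. LINT z|lborel. ?I (r j *\<^sub>R z) * \<Phi> z) \<longlonglongrightarrow> (LINT x|lborel. indicator (box u v) x *\<^sub>R g x)"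
      by (simp add: \<Phi>(3))
    have "(LINT z|lborel. ?I (r j *\<^sub>R z) * \<Phi> z) = (LINT x|lborel. indicator (box u v) x *\<^sub>R G x)" for j
      unfolding integral_box_kernel_average[OF g g1 le \<Phi>(1), symmetric] G_def stable[of _ j] ..
    then show "(\<lambda>j. LINT z|lborel. ?I (r j *\<^sub>R z) * \<Phi> z) \<longlonglongrightarrow> (LINT x|lborel. indicator (box u v) x *\<^sub>R G x)"
      by simp
  qed
  have "AE x in lborel. g x - G x = 0"
  proof (rule AE_eq_0_if_integral_box_eq_0)
    fix u v :: 'a
    show "integrable lborel (\<lambda>x. indicator (box u v) x *\<^sub>R (g x - G x))"
      using Bochner_Integration.integrable_diff[OF ig iG] by (simp add: scaleR_diff_right)
    show "(LINT x|lborel. indicator (box u v) x *\<^sub>R (g x - G x)) = 0"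
      using Bochner_Integration.integral_diff[OF ig iG, of u v u v] eq by (simp add: scaleR_diff_right)
  qed
  then show ?thesis
    by eventually_elim (use GM in auto)
qed

section \<open>Frequency-localised pieces\<close>

lemma dyadic_resolution_eq_0:
  assumes "dyadic_resolution \<phi>" "norm \<xi> < 1 / 2 \<or> 2 < norm \<xi>"
  shows "\<phi> \<xi> = 0"
proof (rule ccontr)
  assume "\<phi> \<xi> \<noteq> 0"
  then have "\<xi> \<in> closure {\<xi>. \<phi> \<xi> \<noteq> 0}" by (intro subsetD[OF closure_subset]) simp
  moreover have "closure {\<xi>. \<phi> \<xi> \<noteq> 0} = {\<xi>. 1/2 \<le> norm \<xi> \<and> norm \<xi> \<le> 2}"
    using assms(1) unfolding dyadic_resolution_def by (elim conjE)
  ultimately show False using assms(2) by auto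
qed

lemma norm_powi_scaleR: "norm ((2::real) powi k *\<^sub>R (\<xi>::'a::real_normed_vector)) = 2 powi k * norm \<xi>"
  by simp

lemma dyadic_eq_0_high:
  fixes \<phi> :: "'a::euclidean_space \<Rightarrow> real"
  assumes "dyadic_resolution \<phi>" "2 ^ (k + 1) < norm \<xi>"
  shows "dyadic \<phi> (int k) \<xi> = 0"
proof -
  have "2 < 2 powi (- int k) * norm \<xi>"
    using assms(2) by (simp add: power_int_minus field_simps)
  then show ?thesis
    unfolding dyadic_def by (intro dyadic_resolution_eq_0[OF assms(1)]) (simp only: norm_powi_scaleR, simp)
qed

lemma dyadic_0: "dyadic \<phi> 0 \<xi> = \<phi> \<xi>"
  by (simp add: dyadic_def)

lemma dyadic_eq_0_neg:
  fixes \<phi> :: "'a::euclidean_space \<Rightarrow> real"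
  assumes "dyadic_resolution \<phi>" "1 < norm \<xi>" "k < 0"
  shows "dyadic \<phi> k \<xi> = 0"
proof -
  have "(2::real) powi 1 \<le> 2 powi (- k)" using assms(3) by (intro power_int_increasing) auto
  then have "2 * 1 < 2 powi (- k) * norm \<xi>" using assms(2) by (intro mult_le_less_imp_less) simp_all
  then show ?thesis
    unfolding dyadic_def by (intro dyadic_resolution_eq_0[OF assms(1)]) (simp only: norm_powi_scaleR, simp)
qed

lemma dyadic_eq_0_pos:
  fixes \<phi> :: "'a::euclidean_space \<Rightarrow> real"
  assumes "dyadic_resolution \<phi>" "norm \<xi> < 2 ^ j" "j < k"
  shows "dyadic \<phi> (int k) \<xi> = 0"
proof -
  have "(2::real) powi (- int k) \<le> 2 powi (- int (Suc j))" using assms(3) by (intro power_int_increasing) auto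
  then have "2 powi (- int k) * norm \<xi> \<le> 2 powi (- int (Suc j)) * norm \<xi>" by (intro mult_right_mono) auto
  also have "(2::real) powi (- int (Suc j)) = 1 / 2 / 2 ^ j"
    by (simp only: power_int_minus power_int_of_nat) (simp add: inverse_eq_divide)
  also have "\<dots> * norm \<xi> < 1 / 2" using assms(2) by (simp add: field_simps)
  finally have "2 powi (- int k) * norm \<xi> < 1 / 2" .
  then show ?thesis
    unfolding dyadic_def by (intro dyadic_resolution_eq_0[OF assms(1)]) (simp only: norm_powi_scaleR, simp)
qed

lemma low_freq_eq_1:
  fixes \<phi> :: "'a::euclidean_space \<Rightarrow> real"
  assumes "dyadic_resolution \<phi>" "norm \<xi> < 1"
  shows "low_freq \<phi> \<xi> = 1"
  unfolding low_freq_def using dyadic_eq_0_pos[OF assms(1), of \<xi> 0] assms(2) by (simp del: of_nat_Suc)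

text \<open>Below |\<xi>| = 2 only the summand of dyadic index 1 survives; in the shifted sum it is
  the term k = 0.\<close>

lemma low_freq_inner:
  fixes \<phi> :: "'a::euclidean_space \<Rightarrow> real"
  assumes "dyadic_resolution \<phi>" "norm \<xi> < 2"
  shows "low_freq \<phi> \<xi> = 1 - \<phi> ((1/2) *\<^sub>R \<xi>)"
proof -
  have "(\<Sum>k. dyadic \<phi> (int (Suc k)) \<xi>) = (\<Sum>k\<in>{0}. dyadic \<phi> (int (Suc k)) \<xi>)"
    using dyadic_eq_0_pos[OF assms(1), of \<xi> 1] assms(2)
    by (intro suminf_finite) (auto simp del: of_nat_Suc)
  then show ?thesis by (simp add: low_freq_def dyadic_def power_int_minus)
qed

text \<open>Beyond |\<xi>| = 1 the pieces of negative index vanish, so those of index at least 0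
  already sum to 1, and subtracting those of index at least 1 leaves the piece of index 0.\<close>

lemma low_freq_outer:
  fixes \<phi> :: "'a::euclidean_space \<Rightarrow> real"
  assumes d: "dyadic_resolution \<phi>" and \<xi>: "1 < norm \<xi>"
  shows "low_freq \<phi> \<xi> = \<phi> \<xi>"
proof -
  have "((\<lambda>k. dyadic \<phi> k \<xi>) has_sum 1) UNIV"
  proof -
    have "\<xi> \<noteq> 0" using \<xi> by auto
    then show ?thesis using d unfolding dyadic_resolution_def by blast
  qed
  also have "?this \<longleftrightarrow> ((\<lambda>k. dyadic \<phi> k \<xi>) has_sum 1) (range int)"
  proof (rule has_sum_cong_neutral)
    fix k :: int assume "k \<in> UNIV - range int"
    then have "k < 0" by (metis DiffD2 not_less rangeI zero_le_imp_eq_int)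
    then show "dyadic \<phi> k \<xi> = 0" by (rule dyadic_eq_0_neg[OF d \<xi>])
  qed auto
  also have "\<dots> \<longleftrightarrow> ((\<lambda>n. dyadic \<phi> (int n) \<xi>) has_sum 1) UNIV"
    by (subst has_sum_reindex) (auto simp: o_def)
  finally have s: "(\<lambda>n. dyadic \<phi> (int n) \<xi>) sums 1" by (rule has_sum_imp_sums)
  then have "(\<Sum>k. dyadic \<phi> (int (Suc k)) \<xi>) = 1 - dyadic \<phi> (int 0) \<xi>"
    using suminf_split_head[of "\<lambda>n. dyadic \<phi> (int n) \<xi>"] sums_summable[OF s] sums_unique[OF s] by simp
  then show ?thesis by (simp add: low_freq_def dyadic_0)
qed

text \<open>The open sets |\<xi>| < 2 and |\<xi>| > 1 cover the space, and on each of them the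
  infinite sum has collapsed to a single dilate of \<phi>. Smoothness is therefore local, with no
  differentiation of a series.\<close>

lemma test_fun_low_freq:
  fixes \<phi> :: "'a::euclidean_space \<Rightarrow> real"
  assumes d: "dyadic_resolution \<phi>"
  shows "test_fun (\<lambda>\<xi>. complex_of_real (low_freq \<phi> \<xi>))"
  unfolding test_fun_def
proof (intro conjI exI[of _ 2] allI impI smooth_local)
  have s: "smooth (\<lambda>\<xi>. complex_of_real (\<phi> \<xi>))"
    using d unfolding dyadic_resolution_def schwartz_def by blast
  fix \<xi> :: 'a
  show "\<exists>S g. open S \<and> \<xi> \<in> S \<and> smooth g \<and> (\<forall>y\<in>S. complex_of_real (low_freq \<phi> y) = g y)"
  proof (cases "norm \<xi> < 2")
    case True
    define g where "g = (\<lambda>\<xi>. 1 + - 1 * complex_of_real (\<phi> ((1/2) *\<^sub>R \<xi>)))"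
    have "smooth g"
      unfolding g_def by (intro smooth_add smooth_mult smooth_const smooth_dilation[OF s])
    moreover have "\<forall>y\<in>ball 0 2. complex_of_real (low_freq \<phi> y) = g y"
      using low_freq_inner[OF d] by (simp add: g_def)
    moreover have "\<xi> \<in> ball 0 2" using True by simp
    ultimately show ?thesis by (intro exI[of _ "ball 0 2"] exI[of _ g] conjI open_ball)
  next
    case False
    then have "\<xi> \<in> - cball 0 1" by simp
    moreover have "\<forall>y\<in>- cball 0 1. complex_of_real (low_freq \<phi> y) = complex_of_real (\<phi> y)"
      using low_freq_outer[OF d] by simp
    moreover have "open (- cball (0::'a) 1)" by (rule open_Compl) simp
    ultimately show ?thesis
      using s by (intro exI[of _ "- cball 0 1"] exI[of _ "\<lambda>\<xi>. complex_of_real (\<phi> \<xi>)"] conjI)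
  qed
  show "complex_of_real (low_freq \<phi> \<xi>) = 0" if "2 < norm \<xi>"
    using that low_freq_outer[OF d, of \<xi>] dyadic_resolution_eq_0[OF d, of \<xi>] by simp
qed

text \<open>Chosen so that its Fourier transform at x is r^(-n) times the transform of \<psi> at (x
  - a)/r: the kernel centred at \<open>a\<close>, at scale \<open>r\<close>, with L_1 norm
  independent of both.\<close>

definition modulated_dilate :: "('a::euclidean_space \<Rightarrow> complex) \<Rightarrow> real \<Rightarrow> 'a \<Rightarrow> 'a \<Rightarrow> complex" where
  "modulated_dilate \<psi> r a \<xi> = cis (2 * pi * (\<xi> \<bullet> a)) * \<psi> (r *\<^sub>R \<xi>)"

lemma test_fun_modulated_dilate:
  assumes "test_fun \<psi>" "0 < r"
  shows "test_fun (modulated_dilate \<psi> r a)"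
proof -
  obtain R where R: "\<And>x. norm x > R \<Longrightarrow> \<psi> x = 0" using assms by (auto simp: test_fun_def)
  have "\<psi> (r *\<^sub>R \<xi>) = 0" if "norm \<xi> > R / r" for \<xi>
    using that \<open>0 < r\<close> by (intro R) (simp add: pos_divide_less_eq mult.commute)
  moreover have "smooth (\<lambda>\<xi>. \<psi> (r *\<^sub>R \<xi>))"
    using assms by (intro smooth_dilation) (simp add: test_fun_def)
  ultimately have "test_fun (\<lambda>\<xi>. \<psi> (r *\<^sub>R \<xi>))"
    unfolding test_fun_def by blast
  then show ?thesis
    unfolding modulated_dilate_def[abs_def] by (intro test_fun_mult smooth_character)
qed

lemma fourier_modulated_dilate:
  fixes \<psi> :: "'a::euclidean_space \<Rightarrow> complex"
  assumes "test_fun \<psi>" "0 < r"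
  shows "r ^ DIM('a) *\<^sub>R fourier (modulated_dilate \<psi> r a) (a + r *\<^sub>R z) = fourier \<psi> z"
proof -
  note [measurable] = test_fun_borel[OF assms(1)]
  have "fourier \<psi> z = \<bar>r\<bar> ^ DIM('a) *\<^sub>R
      (LINT \<xi>|lborel. cis (- (2 * pi * ((0 + r *\<^sub>R \<xi>) \<bullet> z))) * \<psi> (0 + r *\<^sub>R \<xi>))"
    unfolding fourier_def
    by (rule lborel_integral_affine[of "\<lambda>\<xi>. cis (- (2 * pi * (\<xi> \<bullet> z))) * \<psi> \<xi>" r 0]) (use assms in auto)
  also have "(LINT \<xi>|lborel. cis (- (2 * pi * ((0 + r *\<^sub>R \<xi>) \<bullet> z))) * \<psi> (0 + r *\<^sub>R \<xi>)) =
      fourier (modulated_dilate \<psi> r a) (a + r *\<^sub>R z)"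
    unfolding fourier_def
  proof (intro Bochner_Integration.integral_cong refl)
    fix \<xi>
    have "cis (- (2 * pi * ((0 + r *\<^sub>R \<xi>) \<bullet> z))) =
        cis (- (2 * pi * (\<xi> \<bullet> (a + r *\<^sub>R z)))) * cis (2 * pi * (\<xi> \<bullet> a))"
      by (simp add: cis_mult inner_add_right algebra_simps)
    then show "cis (- (2 * pi * ((0 + r *\<^sub>R \<xi>) \<bullet> z))) * \<psi> (0 + r *\<^sub>R \<xi>) =
        cis (- (2 * pi * (\<xi> \<bullet> (a + r *\<^sub>R z)))) * modulated_dilate \<psi> r a \<xi>"
      unfolding modulated_dilate_def by simp
  qed
  finally show ?thesis using assms(2) by simp
qed

text \<open>The inverse transform inside \<open>freq_piece\<close> cancels the transform applied to
  \<open>w\<close>. The cut-off \<open>\<eta>\<close> can be arbitrary, since the right-hand side is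
  the very value that \<open>mult_dist\<close> assigns.\<close>

lemma freq_piece_fourier:
  assumes "test_fun w"
  shows "freq_piece \<eta> f (fourier w) = fourier_dist f (\<lambda>\<xi>. complex_of_real (\<eta> \<xi>) * w \<xi>)"
proof -
  have "inv_fourier (fourier w) = w" using inv_fourier_fourier[OF assms] by blast
  then show ?thesis
    using fourier_schwartz[OF assms] test_fun_schwartz[OF assms]
    by (simp add: freq_piece_def inv_fourier_dist_def mult_dist_def)
qed

text \<open>\<open>represents\<close> supplies Lebesgue measurability, whereas Fubini and the
  changes of variables are carried out with respect to \<open>lborel\<close>; a Borel version
  changes neither the rearrangement nor the pairings.\<close>

lemma borel_version_complex:
  fixes g :: "'a::euclidean_space \<Rightarrow> complex"
  assumes g: "g \<in> borel_measurable lebesgue"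
  obtains g' where "g' \<in> borel_measurable borel" "AE x in lebesgue. g x = g' x"
proof -
  have "(\<lambda>x. Re (g x)) \<in> borel_measurable lebesgue" "(\<lambda>x. Im (g x)) \<in> borel_measurable lebesgue"
    using g by measurable
  then obtain u v where u: "u \<in> borel_measurable lborel" "AE x in lborel. Re (g x) = u x"
    and v: "v \<in> borel_measurable lborel" "AE x in lborel. Im (g x) = v x"
    by (blast dest!: completion_ex_borel_measurable_real)
  have "(\<lambda>x. complex_of_real (u x) + \<i> * complex_of_real (v x)) \<in> borel_measurable borel"
    using u(1) v(1) by simp
  moreover have "AE x in lborel. g x = complex_of_real (u x) + \<i> * complex_of_real (v x)"
    using u(2) v(2) by eventually_elim (simp add: complex_eq_iff)
  then have "AE x in lebesgue. g x = complex_of_real (u x) + \<i> * complex_of_real (v x)"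
    by (rule AE_completion)
  ultimately show ?thesis by (rule that)
qed

text \<open>This is the reproducing formula in the form of scale independence: the right-hand side
  does not contain \<open>r\<close>. Wherever \<open>\<eta>\<close> may be nonzero, |r \<xi>| < 1,
  so \<psi> (r \<xi>) = 1 and the dilated cut-off is invisible to the distribution.\<close>

lemma represents_kernel_average:
  fixes g g' :: "'a::euclidean_space \<Rightarrow> complex"
  assumes \<psi>: "test_fun \<psi>" "\<And>\<xi>. norm \<xi> < 1 \<Longrightarrow> \<psi> \<xi> = 1"
    and rep: "represents g (freq_piece \<eta> f)"
    and g': "g' \<in> borel_measurable borel" "AE x in lebesgue. g x = g' x"
    and \<eta>: "\<And>\<xi>. R < norm \<xi> \<Longrightarrow> \<eta> \<xi> = 0" and r: "0 < r" "r * R < 1"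
  shows "(LINT z|lborel. g' (a + r *\<^sub>R z) * fourier \<psi> z) =
    fourier_dist f (\<lambda>\<xi>. complex_of_real (\<eta> \<xi>) * cis (2 * pi * (\<xi> \<bullet> a)))"
proof -
  let ?w = "modulated_dilate \<psi> r a"
  note tw = test_fun_modulated_dilate[OF \<psi>(1) r(1), of a]
  have [measurable]: "fourier ?w \<in> borel_measurable borel"
    by (intro borel_measurable_continuous_onI smooth_imp_continuous smooth_fourier tw)
  note [measurable] = g'(1)
  have eq: "complex_of_real (\<eta> \<xi>) * ?w \<xi> = complex_of_real (\<eta> \<xi>) * cis (2 * pi * (\<xi> \<bullet> a))" for \<xi>
  proof (cases "R < norm \<xi>")
    case False
    then have "r * norm \<xi> \<le> r * R" using r by (intro mult_left_mono) auto
    then have "r * norm \<xi> < 1" using r(2) by linarith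
    then have "norm (r *\<^sub>R \<xi>) < 1" using r(1) by simp
    then show ?thesis by (simp add: modulated_dilate_def \<psi>(2))
  qed (simp add: \<eta>)
  have "fourier_dist f (\<lambda>\<xi>. complex_of_real (\<eta> \<xi>) * cis (2 * pi * (\<xi> \<bullet> a))) = freq_piece \<eta> f (fourier ?w)"
    unfolding freq_piece_fourier[OF tw] eq ..
  also have "\<dots> = (LINT x|lebesgue. g x * fourier ?w x)"
    using rep fourier_schwartz[OF tw] by (auto simp: represents_def)
  also have "\<dots> = (LINT x|lebesgue. g' x * fourier ?w x)"
  proof (rule integral_cong_AE)
    have "g \<in> borel_measurable lebesgue" using rep by (simp add: represents_def)
    moreover have "fourier ?w \<in> borel_measurable lebesgue" "g' \<in> borel_measurable lebesgue"
      by (intro measurable_completion, simp)+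
    ultimately show "(\<lambda>x. g x * fourier ?w x) \<in> borel_measurable lebesgue"
      "(\<lambda>x. g' x * fourier ?w x) \<in> borel_measurable lebesgue" by measurable
    show "AE x in lebesgue. g x * fourier ?w x = g' x * fourier ?w x"
      using g'(2) by eventually_elim simp
  qed
  also have "\<dots> = (LINT x|lborel. g' x * fourier ?w x)"
    by (rule integral_completion) measurable
  also have "\<dots> = \<bar>r\<bar> ^ DIM('a) *\<^sub>R (LINT z|lborel. g' (a + r *\<^sub>R z) * fourier ?w (a + r *\<^sub>R z))"
    by (rule lborel_integral_affine) (use r in auto)
  also have "\<dots> = (LINT z|lborel. r ^ DIM('a) *\<^sub>R (g' (a + r *\<^sub>R z) * fourier ?w (a + r *\<^sub>R z)))"
    using r by simp
  also have "\<dots> = (LINT z|lborel. g' (a + r *\<^sub>R z) * fourier \<psi> z)"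
    by (simp only: mult_scaleR_right[symmetric] fourier_modulated_dilate[OF \<psi>(1) r(1)])
  finally show ?thesis ..
qed

section \<open>The embedding\<close>

lemma ennreal_absorb:
  assumes "x \<le> ennreal a * X" "X \<le> ennreal b * Y" "0 \<le> a" "0 \<le> b"
  shows "x \<le> ennreal (a * b) * Y"
proof -
  have "x \<le> ennreal a * (ennreal b * Y)"
    using assms(1) mult_left_mono[OF assms(2), of "ennreal a"] by (meson order_trans zero_le)
  then show ?thesis using assms(3,4) by (simp add: ennreal_mult mult.assoc)
qed

text \<open>A form of Bernstein's inequality: \<open>\<tau>\<close> is, up to a constant, the volume of the spatial cell
  dual to the ball of radius \<open>2\<^sup>m\<close> in frequency.\<close>

lemma band_limited_sup_bound:
  fixes \<phi> :: "'a::euclidean_space \<Rightarrow> real"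
  assumes \<phi>: "dyadic_resolution \<phi>"
  obtains D where "0 < D" "\<And>\<eta> f g m \<tau>. represents g (freq_piece \<eta> f) \<Longrightarrow>
    (\<And>\<xi>::'a. 2 ^ m < norm \<xi> \<Longrightarrow> \<eta> \<xi> = 0) \<Longrightarrow> \<tau> = 1 / (2 ^ m) ^ DIM('a) \<Longrightarrow>
    (\<integral>\<^sup>+ t. rearrangement g t * indicator {0<..<\<tau>} t \<partial>lborel) < \<infinity> \<Longrightarrow>
    AE x in lebesgue. ennreal (norm (g x)) \<le>
      ennreal (D / \<tau>) * (\<integral>\<^sup>+ t. rearrangement g t * indicator {0<..<\<tau>} t \<partial>lborel)"
proof -
  define \<psi> where "\<psi> = (\<lambda>\<xi>. complex_of_real (low_freq \<phi> \<xi>))"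
  have \<psi>: "test_fun \<psi>" unfolding \<psi>_def by (rule test_fun_low_freq[OF \<phi>])
  have \<psi>1: "\<psi> \<xi> = 1" if "norm \<xi> < 1" for \<xi>
    using low_freq_eq_1[OF \<phi> that] by (simp add: \<psi>_def)
  define \<Phi> where "\<Phi> = fourier \<psi>"
  define S where "S = (LINT x|lborel. norm (\<psi> x))"
  have \<Phi>: "integrable lborel \<Phi>" "\<And>z. norm (\<Phi> z) \<le> S" "(LINT z|lborel. \<Phi> z) = 1"
  proof -
    show "integrable lborel \<Phi>" unfolding \<Phi>_def by (rule integrable_fourier[OF \<psi>])
    show "norm (\<Phi> z) \<le> S" for z unfolding \<Phi>_def S_def by (rule norm_fourier_le)
    show "(LINT z|lborel. \<Phi> z) = 1"
      using inv_fourier_fourier[OF \<psi>, of 0] \<psi>1[of 0] by (simp add: inv_fourier_def \<Phi>_def)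
  qed
  have S0: "0 \<le> S" unfolding S_def by (rule integral_nonneg_AE) auto
  define A where "A = (LINT z|lborel. norm (\<Phi> z))"
  have A0: "0 \<le> A" unfolding A_def by (rule integral_nonneg_AE) auto
  \<comment> \<open>\<open>A\<close> is the price of the bounded part,
    \<open>S * 2 ^ DIM('a)\<close> that of the integrable part at the coarsest scale, whose n-th
    power is \<tau> / 2^n; the summand 1 ensures positivity.\<close>
  define D where "D = A + S * 2 ^ DIM('a) + 1"
  have D: "0 < D" using A0 S0 by (simp add: D_def add_nonneg_pos)
  have "AE x in lebesgue. ennreal (norm (g x)) \<le>
      ennreal (D / \<tau>) * (\<integral>\<^sup>+ t. rearrangement g t * indicator {0<..<\<tau>} t \<partial>lborel)"
    if rep: "represents g (freq_piece \<eta> f)" and \<eta>: "\<And>\<xi>::'a. 2 ^ m < norm \<xi> \<Longrightarrow> \<eta> \<xi> = 0"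
      and \<tau>: "\<tau> = 1 / (2 ^ m) ^ DIM('a)"
      and fin: "(\<integral>\<^sup>+ t. rearrangement g t * indicator {0<..<\<tau>} t \<partial>lborel) < \<infinity>" for \<eta> f g m \<tau>
  proof -
    have \<tau>0: "0 < \<tau>" by (simp add: \<tau>)
    have gl: "g \<in> borel_measurable lebesgue" using rep by (simp add: represents_def)
    obtain g' where g': "g' \<in> borel_measurable borel" "AE x in lebesgue. g x = g' x"
      using borel_version_complex[OF gl] by blast
    have g'l: "g' \<in> borel_measurable lebesgue"
      using g'(1) by (intro measurable_completion) simp
    have re: "rearrangement g = rearrangement g'"
      by (rule rearrangement_cong_AE[OF gl g'l g'(2)])
    note [measurable] = g'(1) borel_measurable_rearrangement[OF g'l]
    define I where "I = (\<integral>\<^sup>+ t. rearrangement g' t * indicator {0<..<\<tau>} t \<partial>lborel)"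
    have I: "I < \<infinity>" using fin by (simp add: I_def re)
    have "rearrangement g' \<tau> * ennreal \<tau> = (\<integral>\<^sup>+ t. rearrangement g' \<tau> * indicator {0<..<\<tau>} t \<partial>lborel)"
      using \<tau>0 by (simp add: nn_integral_cmult)
    also have "\<dots> \<le> I"
      unfolding I_def by (intro nn_integral_mono) (auto simp: indicator_def intro: rearrangement_antimono)
    finally have ht: "rearrangement g' \<tau> * ennreal \<tau> \<le> I" .
    then have "rearrangement g' \<tau> < \<infinity>"
      using I \<tau>0 by (cases "rearrangement g' \<tau>") (auto simp: ennreal_top_mult top_unique)
    then obtain \<sigma> where \<sigma>: "rearrangement g' \<tau> = ennreal \<sigma>" "0 \<le> \<sigma>"
      by (cases "rearrangement g' \<tau>") auto
    define g1 where "g1 = (\<lambda>x. indicator {x. \<sigma> < norm (g' x)} x *\<^sub>R g' x)"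
    have [measurable]: "g1 \<in> borel_measurable borel" unfolding g1_def by measurable
    have le: "norm (g' x) \<le> norm (g1 x) + \<sigma>" for x
      using \<sigma>(2) by (auto simp: g1_def indicator_def)
    have n1: "(\<integral>\<^sup>+ x. ennreal (norm (g1 x)) \<partial>lborel) \<le> I"
    proof -
      have "(\<integral>\<^sup>+ x. ennreal (norm (g1 x)) \<partial>lborel) = (\<integral>\<^sup>+ x. ennreal (norm (g' x)) *
          indicator {x. rearrangement g' \<tau> < ennreal (norm (g' x))} x \<partial>lborel)"
        using \<sigma> by (intro nn_integral_cong) (auto simp: g1_def indicator_def ennreal_less_iff)
      also have "\<dots> \<le> I"
        unfolding I_def by (rule nn_integral_above_rearrangement_le[OF g'(1) \<tau>0])
      finally show ?thesis .
    qed
    have g1: "integrable lborel g1"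
      using n1 I by (intro integrableI_bounded) auto
    define J where "J = (LINT x|lborel. norm (g1 x))"
    have J: "ennreal J \<le> I" "0 \<le> J"
      using n1 nn_integral_eq_integral[OF integrable_norm[OF g1]] unfolding J_def by auto
    \<comment> \<open>Starting at 2^-(m+1) rather than 2^-m gives r_j 2^m < 1 strictly, hence the
      kernel cut-off equals 1 on the whole closed ball of radius 2^m.\<close>
    define r :: "nat \<Rightarrow> real" where "r = (\<lambda>j. inverse (2 ^ (m + 1 + j)))"
    have r: "0 < r j" for j by (simp add: r_def)
    have rlim: "r \<longlonglongrightarrow> 0"
    proof -
      have "(\<lambda>j. inverse (2 ^ (m + 1)) * inverse 2 ^ j :: real) \<longlonglongrightarrow> inverse (2 ^ (m + 1)) * 0"
        by (intro tendsto_mult tendsto_const LIMSEQ_power_zero) simp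
      then show ?thesis by (simp add: r_def power_add power_inverse[symmetric])
    qed
    have rm: "r j * 2 ^ m < 1" for j
    proof -
      have "(2::real) ^ m < 2 ^ (m + 1 + j)" by (intro power_strict_increasing) auto
      then show ?thesis by (simp add: r_def field_simps)
    qed
    have stable: "(LINT z|lborel. g' (a + r j *\<^sub>R z) * \<Phi> z) = (LINT z|lborel. g' (a + r 0 *\<^sub>R z) * \<Phi> z)" for j a
      unfolding \<Phi>_def
      using represents_kernel_average[OF \<psi> \<psi>1 rep g' \<eta> r rm, where a = a] by simp
    have bnd: "AE x in lborel. norm (g' x) \<le> \<sigma> * A + S * J / r 0 ^ DIM('a)"
      unfolding A_def J_def
      by (rule AE_bounded_if_kernel_averages_stable[OF g'(1) g1 le \<sigma>(2) \<Phi> r rlim stable])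
    have r0: "r 0 ^ DIM('a) = \<tau> / 2 ^ DIM('a)"
      by (simp add: r_def \<tau> power_add power_mult_distrib power_inverse inverse_eq_divide power_divide)
    have bound: "ennreal (\<sigma> * A + S * J / r 0 ^ DIM('a)) \<le> ennreal (D / \<tau>) * I"
    proof -
      obtain i where i: "I = ennreal i" "0 \<le> i" using I by (cases I) auto
      have "\<sigma> * \<tau> \<le> i" using ht \<sigma> i \<tau>0 by (simp add: ennreal_mult[symmetric])
      then have s: "\<sigma> \<le> i / \<tau>" using \<tau>0 by (simp add: field_simps)
      have Ji: "J \<le> i" using J i by simp
      have "\<sigma> * A + S * J / r 0 ^ DIM('a) \<le> i / \<tau> * A + S * i / r 0 ^ DIM('a)"
        using s Ji A0 S0 r[of 0] by (intro add_mono mult_right_mono divide_right_mono mult_left_mono) auto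
      also have "\<dots> = (A + S * 2 ^ DIM('a)) / \<tau> * i"
        unfolding r0 using \<tau>0 by (simp add: field_simps)
      also have "\<dots> \<le> D / \<tau> * i"
        using \<tau>0 i by (intro mult_right_mono divide_right_mono) (auto simp: D_def)
      finally show ?thesis using i D \<tau>0 by (simp add: ennreal_mult[symmetric])
    qed
    have "AE x in lebesgue. norm (g' x) \<le> \<sigma> * A + S * J / r 0 ^ DIM('a)"
      using bnd by (rule AE_completion)
    with g'(2) show ?thesis
    proof eventually_elim
      case (elim x)
      then show ?case using order_trans[OF ennreal_leI bound] by (simp add: I_def re)
    qed
  qed
  with D show ?thesis by (rule that)
qed

text \<open>Here the logarithm of the dual volume becomes the frequency index: |ln \<tau>| = m n ln
  2 with ln 2 < 1.\<close>

lemma log_volume_scale_le: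
  assumes "0 \<le> \<theta>"
  shows "(1 + \<bar>ln (1 / (2 ^ m) ^ n)\<bar>) powr \<theta> \<le> (1 + real n) powr \<theta> * (1 + real m) powr \<theta>"
proof -
  have "ln (1 / (2 ^ m) ^ n) = - (real (m * n) * ln 2)"
    by (simp add: ln_div ln_realpow power_mult[symmetric])
  then have "\<bar>ln (1 / (2 ^ m) ^ n)\<bar> = real (m * n) * ln 2" by simp
  also have "\<dots> \<le> real (m * n) * 1"
    using ln_2_less_1 by (intro mult_left_mono) auto
  finally have le: "1 + \<bar>ln (1 / (2 ^ m) ^ n)\<bar> \<le> (1 + real n) * (1 + real m)"
    by (simp add: algebra_simps)
  have "(1 + \<bar>ln (1 / (2 ^ m) ^ n)\<bar>) powr \<theta> \<le> ((1 + real n) * (1 + real m)) powr \<theta>"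
    by (rule powr_mono2[OF assms _ le]) (rule add_nonneg_nonneg[OF zero_le_one abs_ge_zero])
  then show ?thesis by (simp add: powr_mult)
qed

text \<open>The estimate for a single frequency piece, with the dependence on the band made
  explicit. It is proved for each representing function through its rearrangement and then
  transferred to the infimum over representing functions.\<close>

lemma band_limited_LZ_embedding:
  fixes \<phi> :: "'a::euclidean_space \<Rightarrow> real"
  assumes \<phi>: "dyadic_resolution \<phi>" and q: "1 \<le> q" "q < \<infinity>" and c: "0 < c" "c \<le> b"
    and qB: "(q = 1 \<and> c = 1 \<and> B = (0, 0)) \<or> 1 < q" and AB: "fst B \<le> fst A" "snd A \<le> snd B"
  obtains K where "0 < K" "\<And>\<eta> f m. (\<And>\<xi>::'a. 2 ^ m < norm \<xi> \<Longrightarrow> \<eta> \<xi> = 0) \<Longrightarrow>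
    LZ_qnorm_dist q b A (freq_piece \<eta> f) \<le>
      ennreal (K * (1 + real m) powr (fst A - fst B)) * LZ_qnorm_dist q c B (freq_piece \<eta> f)"
proof -
  define p where "p = recip q"
  obtain q' where q': "q = ennreal q'" "0 < q'"
    using q by (cases q) (auto intro: less_le_trans[OF zero_less_one])
  have pq: "p = 1 / q'" unfolding p_def q'(1) using q'(2) by (subst recip_finite) auto
  have p0: "0 < p" using q'(2) by (simp add: pq)
  have pB: "(p = 1 \<and> c = 1 \<and> B = (0, 0)) \<or> p < 1"
  proof -
    have "1 < q \<longleftrightarrow> 1 < q'" "q = 1 \<longleftrightarrow> q' = 1"
      unfolding q'(1) using ennreal_less_iff[of 1 q'] q'(2) by simp_all
    then show ?thesis using qB by (auto simp: pq)
  qed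
  obtain D where D: "0 < D" "\<And>\<eta> f g m \<tau>. represents g (freq_piece \<eta> f) \<Longrightarrow>
    (\<And>\<xi>::'a. 2 ^ m < norm \<xi> \<Longrightarrow> \<eta> \<xi> = 0) \<Longrightarrow> \<tau> = 1 / (2 ^ m) ^ DIM('a) \<Longrightarrow>
    (\<integral>\<^sup>+ t. rearrangement g t * indicator {0<..<\<tau>} t \<partial>lborel) < \<infinity> \<Longrightarrow>
    AE x in lebesgue. ennreal (norm (g x)) \<le>
      ennreal (D / \<tau>) * (\<integral>\<^sup>+ t. rearrangement g t * indicator {0<..<\<tau>} t \<partial>lborel)"
    using band_limited_sup_bound[OF \<phi>] by blast
  obtain K1 where K1: "0 < K1" "\<And>h \<tau>. antimono h \<Longrightarrow> h \<in> borel_measurable borel \<Longrightarrow> 0 < \<tau> \<Longrightarrow> \<tau> \<le> 1 \<Longrightarrow>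
    (\<integral>\<^sup>+ t. h t * indicator {0<..<\<tau>} t \<partial>lborel) \<le>
      ennreal (K1 * (\<tau> powr (1 - p) * (1 + \<bar>ln \<tau>\<bar>) powr (- fst B))) * LZ_norm p c B h"
    using nn_integral_le_LZ_norm[OF c(1) pB] by blast
  have DK: "0 < D * K1" using D K1 by simp
  obtain K2 where K2: "0 < K2" "\<And>h \<tau>. antimono h \<Longrightarrow> h \<in> borel_measurable borel \<Longrightarrow> 0 < \<tau> \<Longrightarrow> \<tau> \<le> 1 \<Longrightarrow>
    (\<And>t. 0 < t \<Longrightarrow> t < \<tau> \<Longrightarrow>
      h t \<le> ennreal (D * K1 * (\<tau> powr (- p) * (1 + \<bar>ln \<tau>\<bar>) powr (- fst B))) * LZ_norm p c B h) \<Longrightarrow>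
    LZ_norm p b A h \<le> ennreal (K2 * (1 + \<bar>ln \<tau>\<bar>) powr (fst A - fst B)) * LZ_norm p c B h"
    using LZ_norm_embedding[OF c p0 AB DK] by blast
  define K where "K = K2 * (1 + real DIM('a)) powr (fst A - fst B)"
  have K: "0 < K" using K2 by (simp add: K_def)
  have "LZ_qnorm_dist q b A (freq_piece \<eta> f) \<le>
      ennreal (K * (1 + real m) powr (fst A - fst B)) * LZ_qnorm_dist q c B (freq_piece \<eta> f)"
    if \<eta>: "\<And>\<xi>::'a. 2 ^ m < norm \<xi> \<Longrightarrow> \<eta> \<xi> = 0" for \<eta> f m
  proof -
    define L where "L = K * (1 + real m) powr (fst A - fst B)"
    have L: "0 < L" using K by (simp add: L_def)
    have main: "LZ_qnorm q b A g \<le> ennreal L * LZ_qnorm q c B g" if rep: "represents g (freq_piece \<eta> f)" for g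
    \<comment> \<open>The sup bound presupposes a finite integral of the rearrangement over (0,
      \<tau>), which a finite source norm provides; an infinite one makes the claim trivial because
      L > 0.\<close>
    proof (cases "LZ_qnorm q c B g = \<infinity>")
      case True
      then show ?thesis using L by (simp add: ennreal_mult_top)
    next
      case False
      define \<tau> :: real where "\<tau> = 1 / (2 ^ m) ^ DIM('a)"
      have \<tau>: "0 < \<tau>" "\<tau> \<le> 1" by (simp_all add: \<tau>_def)
      define h where "h = rearrangement g"
      have gl: "g \<in> borel_measurable lebesgue" using rep by (simp add: represents_def)
      have h: "antimono h" "h \<in> borel_measurable borel"
        using borel_measurable_rearrangement[OF gl] rearrangement_antimono
        by (auto simp: h_def antimono_def)
      let ?N = "LZ_norm p c B h"
      have N: "?N < \<infinity>" using False by (simp add: LZ_qnorm_eq p_def h_def less_top)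
      have I: "(\<integral>\<^sup>+ t. h t * indicator {0<..<\<tau>} t \<partial>lborel) \<le>
          ennreal (K1 * (\<tau> powr (1 - p) * (1 + \<bar>ln \<tau>\<bar>) powr (- fst B))) * ?N"
        by (rule K1(2)[OF h \<tau>])
      also have "\<dots> < \<infinity>" using N by (simp add: ennreal_mult_less_top)
      finally have ae: "AE x in lebesgue. ennreal (norm (g x)) \<le>
          ennreal (D / \<tau>) * (\<integral>\<^sup>+ t. h t * indicator {0<..<\<tau>} t \<partial>lborel)"
        unfolding h_def by (intro D(2)[OF rep \<eta> \<tau>_def])
      have "h t \<le> ennreal (D * K1 * (\<tau> powr (- p) * (1 + \<bar>ln \<tau>\<bar>) powr (- fst B))) * ?N" for t
      proof -
        have "h t \<le> ennreal (D / \<tau>) * (\<integral>\<^sup>+ t. h t * indicator {0<..<\<tau>} t \<partial>lborel)"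
          using rearrangement_le_bound[OF gl ae] by (simp add: h_def)
        then have "h t \<le> ennreal (D / \<tau> * (K1 * (\<tau> powr (1 - p) * (1 + \<bar>ln \<tau>\<bar>) powr (- fst B)))) * ?N"
          using I by (rule ennreal_absorb) (use D(1) K1(1) \<tau> in auto)
        also have "D / \<tau> * (K1 * (\<tau> powr (1 - p) * (1 + \<bar>ln \<tau>\<bar>) powr (- fst B))) =
            D * K1 * (\<tau> powr (- p) * (1 + \<bar>ln \<tau>\<bar>) powr (- fst B))"
        proof -
          have "\<tau> powr (1 - p) = \<tau> * \<tau> powr (- p)" using \<tau> by (simp add: powr_diff powr_minus_divide)
          then show ?thesis using \<tau> by simp
        qed
        finally show ?thesis .
      qed
      then have "LZ_norm p b A h \<le> ennreal (K2 * (1 + \<bar>ln \<tau>\<bar>) powr (fst A - fst B)) * ?N"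
        by (intro K2(2)[OF h \<tau>])
      also have "\<dots> \<le> ennreal L * ?N"
      proof (intro mult_right_mono ennreal_leI)
        show "K2 * (1 + \<bar>ln \<tau>\<bar>) powr (fst A - fst B) \<le> L"
          using mult_left_mono[OF log_volume_scale_le[of "fst A - fst B" m "DIM('a)"], of K2] AB(1) K2(1)
          by (simp add: L_def K_def \<tau>_def mult.assoc)
      qed simp
      finally show ?thesis by (simp add: LZ_qnorm_eq p_def h_def)
    qed
    \<comment> \<open>With the constant moved to the left, the claim is a lower bound for an
      infimum, which also covers the case where no function represents the piece.\<close>
    have "ennreal (1 / L) * LZ_qnorm_dist q b A (freq_piece \<eta> f) \<le> LZ_qnorm_dist q c B (freq_piece \<eta> f)"
      unfolding LZ_qnorm_dist_def[of q c]
    proof (rule INF_greatest)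
      fix g assume g: "g \<in> {g. represents g (freq_piece \<eta> f)}"
      have "LZ_qnorm_dist q b A (freq_piece \<eta> f) \<le> LZ_qnorm q b A g"
        unfolding LZ_qnorm_dist_def by (rule INF_lower[OF g])
      also have "\<dots> \<le> ennreal L * LZ_qnorm q c B g" using main g by simp
      finally have "ennreal (1 / L) * LZ_qnorm_dist q b A (freq_piece \<eta> f) \<le> ennreal (1 / L) * (ennreal L * LZ_qnorm q c B g)"
        by (rule mult_left_mono) simp
      then show "ennreal (1 / L) * LZ_qnorm_dist q b A (freq_piece \<eta> f) \<le> LZ_qnorm q c B g"
        using L by (simp add: ennreal_mult[symmetric] mult.assoc[symmetric])
    qed
    then have "ennreal L * (ennreal (1 / L) * LZ_qnorm_dist q b A (freq_piece \<eta> f)) \<le> ennreal L * LZ_qnorm_dist q c B (freq_piece \<eta> f)"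
      by (rule mult_left_mono) simp
    then show ?thesis
      unfolding L_def[symmetric] using L by (simp add: ennreal_mult[symmetric] mult.assoc[symmetric])
  qed
  with K show ?thesis by (rule that)
qed

lemma lu_qnorm_le_cmult:
  assumes "0 < u" "\<And>k. 1 \<le> k \<Longrightarrow> x k \<le> ennreal C * y k" "0 \<le> C"
  shows "lu_qnorm u x \<le> ennreal C * lu_qnorm u y"
proof (cases "u = \<infinity>")
  case True
  have "(SUP k\<in>{1..}. x k) \<le> (SUP k\<in>{1..}. ennreal C * y k)"
    using assms(2) by (intro SUP_mono) auto
  then show ?thesis by (simp add: lu_qnorm_def True SUP_mult_left_ennreal)
next
  case False
  then obtain u' where u: "u = ennreal u'" "0 < u'" using assms(1) by (cases u) auto
  have ru: "recip u = 1 / u'" using u by (subst recip_finite) auto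
  have "(\<Sum>k. epowr (x (Suc k)) u') \<le> (\<Sum>k. epowr (ennreal C * y (Suc k)) u')"
    using assms(2) u(2) by (intro suminf_le epowr_mono) auto
  also have "\<dots> = epowr (ennreal C) u' * (\<Sum>k. epowr (y (Suc k)) u')"
    by (simp only: epowr_mult ennreal_suminf_cmult)
  finally have "epowr (\<Sum>k. epowr (x (Suc k)) u') (1 / u') \<le> epowr (epowr (ennreal C) u' * (\<Sum>k. epowr (y (Suc k)) u')) (1 / u')"
    using u(2) by (rule_tac epowr_mono) auto
  also have "\<dots> = ennreal C * epowr (\<Sum>k. epowr (y (Suc k)) u') (1 / u')"
    by (simp only: epowr_mult epowr_inverse_cancel[OF u(2)])
  finally show ?thesis using u ru by (simp add: lu_qnorm_def)
qed

theorem corollary24: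
  fixes \<phi> :: "real ^ 'n \<Rightarrow> real"
    and q c b u :: ennreal
    and \<beta>\<^sub>0 \<beta>\<^sub>i \<alpha>\<^sub>0 \<alpha>\<^sub>i \<sigma> \<gamma> :: real
  assumes "dyadic_resolution \<phi>"
    and "1 \<le> q" and "q < \<infinity>" and "0 < c"
    and "(q = 1 \<and> c = 1 \<and> \<beta>\<^sub>0 = 0 \<and> \<beta>\<^sub>i = 0) \<or> 1 < q"
    and "0 < u"
    and "c \<le> b"
    and "\<alpha>\<^sub>i < \<beta>\<^sub>i" and "\<alpha>\<^sub>0 \<ge> \<beta>\<^sub>0"
  shows "continuously_embedded
           (besov \<phi> \<sigma> (\<gamma> + (\<alpha>\<^sub>0 - \<beta>\<^sub>0)) q c (\<beta>\<^sub>0, \<beta>\<^sub>i) u)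
           (besov_qnorm \<phi> \<sigma> (\<gamma> + (\<alpha>\<^sub>0 - \<beta>\<^sub>0)) q c (\<beta>\<^sub>0, \<beta>\<^sub>i) u)
           (besov \<phi> \<sigma> \<gamma> q b (\<alpha>\<^sub>0, \<alpha>\<^sub>i) u)
           (besov_qnorm \<phi> \<sigma> \<gamma> q b (\<alpha>\<^sub>0, \<alpha>\<^sub>i) u)"
proof -
  let ?A = "(\<alpha>\<^sub>0, \<alpha>\<^sub>i)" and ?B = "(\<beta>\<^sub>0, \<beta>\<^sub>i)" and ?\<theta> = "\<alpha>\<^sub>0 - \<beta>\<^sub>0"
  have qB: "(q = 1 \<and> c = 1 \<and> ?B = (0, 0)) \<or> 1 < q" using assms(5) by auto
  have AB: "fst ?B \<le> fst ?A" "snd ?A \<le> snd ?B" using assms(8,9) by auto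
  obtain K where K: "0 < K" "\<And>\<eta> f m. (\<And>\<xi>::real ^ 'n. 2 ^ m < norm \<xi> \<Longrightarrow> \<eta> \<xi> = 0) \<Longrightarrow>
    LZ_qnorm_dist q b ?A (freq_piece \<eta> f) \<le>
      ennreal (K * (1 + real m) powr (fst ?A - fst ?B)) * LZ_qnorm_dist q c ?B (freq_piece \<eta> f)"
    using band_limited_LZ_embedding[OF assms(1-4,7) qB AB] by blast
  \<comment> \<open>The k-th piece lives in |\<xi>| \<le> 2^(k+1), so the band index is m = k + 1
    and 1 + m \<le> 2 (1 + k); the low-frequency piece has m = 1 and contributes exactly 2^\<theta>,
    where \<theta> is the difference of the exponents at 0.\<close>
  define C where "C = K * 2 powr ?\<theta>"
  have C: "0 < C" using K by (simp add: C_def)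
  have low: "LZ_qnorm_dist q b ?A (freq_piece (low_freq \<phi>) f) \<le>
      ennreal C * LZ_qnorm_dist q c ?B (freq_piece (low_freq \<phi>) f)" for f
    using K(2)[of 1 "low_freq \<phi>" f] low_freq_outer[OF assms(1)] dyadic_resolution_eq_0[OF assms(1)]
    by (simp add: C_def)
  have high: "LZ_qnorm_dist q b ?A (freq_piece (dyadic \<phi> (int k)) f) \<le>
      ennreal (C * (1 + real k) powr ?\<theta>) * LZ_qnorm_dist q c ?B (freq_piece (dyadic \<phi> (int k)) f)" for k f
  proof -
    have "(1 + real (k + 1)) powr ?\<theta> \<le> (2 * (1 + real k)) powr ?\<theta>"
      using assms(9) by (intro powr_mono2) auto
    also have "\<dots> = 2 powr ?\<theta> * (1 + real k) powr ?\<theta>" by (rule powr_mult)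
    finally have "K * (1 + real (k + 1)) powr ?\<theta> \<le> C * (1 + real k) powr ?\<theta>"
      using K(1) by (simp add: C_def mult.assoc)
    moreover have "LZ_qnorm_dist q b ?A (freq_piece (dyadic \<phi> (int k)) f) \<le>
        ennreal (K * (1 + real (k + 1)) powr (fst ?A - fst ?B)) * LZ_qnorm_dist q c ?B (freq_piece (dyadic \<phi> (int k)) f)"
      by (rule K(2)[OF dyadic_eq_0_high[OF assms(1)]])
    ultimately show ?thesis
      by (auto elim!: order_trans intro!: mult_right_mono ennreal_leI)
  qed
  have main: "besov_qnorm \<phi> \<sigma> \<gamma> q b ?A u f \<le> ennreal C * besov_qnorm \<phi> \<sigma> (\<gamma> + ?\<theta>) q c ?B u f" for f
  proof -
    have "lu_qnorm u (\<lambda>k. ennreal (2 powr (\<sigma> * real k) * (1 + real k) powr \<gamma>) *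
          LZ_qnorm_dist q b ?A (freq_piece (dyadic \<phi> (int k)) f)) \<le>
        ennreal C * lu_qnorm u (\<lambda>k. ennreal (2 powr (\<sigma> * real k) * (1 + real k) powr (\<gamma> + ?\<theta>)) *
          LZ_qnorm_dist q c ?B (freq_piece (dyadic \<phi> (int k)) f))"
    proof (rule lu_qnorm_le_cmult[OF assms(6)])
      fix k :: nat
      define W where "W = 2 powr (\<sigma> * real k) * (1 + real k) powr \<gamma>"
      have "ennreal W * LZ_qnorm_dist q b ?A (freq_piece (dyadic \<phi> (int k)) f) \<le>
          ennreal W * (ennreal (C * (1 + real k) powr ?\<theta>) * LZ_qnorm_dist q c ?B (freq_piece (dyadic \<phi> (int k)) f))"
        by (intro mult_left_mono high) simp
      also have "\<dots> = ennreal (C * (W * (1 + real k) powr ?\<theta>)) * LZ_qnorm_dist q c ?B (freq_piece (dyadic \<phi> (int k)) f)"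
        using C by (intro ennreal_assoc_left) (auto simp: W_def)
      also have "\<dots> = ennreal C * (ennreal (W * (1 + real k) powr ?\<theta>) * LZ_qnorm_dist q c ?B (freq_piece (dyadic \<phi> (int k)) f))"
        using C by (simp add: ennreal_mult W_def mult.assoc)
      also have "W * (1 + real k) powr ?\<theta> = 2 powr (\<sigma> * real k) * (1 + real k) powr (\<gamma> + ?\<theta>)"
        by (simp only: W_def powr_add mult.assoc)
      finally show "ennreal (2 powr (\<sigma> * real k) * (1 + real k) powr \<gamma>) *
            LZ_qnorm_dist q b ?A (freq_piece (dyadic \<phi> (int k)) f) \<le>
          ennreal C * (ennreal (2 powr (\<sigma> * real k) * (1 + real k) powr (\<gamma> + ?\<theta>)) *
            LZ_qnorm_dist q c ?B (freq_piece (dyadic \<phi> (int k)) f))"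
        unfolding W_def .
    qed (use C in simp)
    then show ?thesis
      unfolding besov_qnorm_def distrib_left by (intro add_mono low)
  qed
  show ?thesis
    unfolding continuously_embedded_def
  proof (intro conjI exI[of _ C] ballI main subsetI)
    fix f assume f: "f \<in> besov \<phi> \<sigma> (\<gamma> + ?\<theta>) q c ?B u"
    then have "ennreal C * besov_qnorm \<phi> \<sigma> (\<gamma> + ?\<theta>) q c ?B u f < \<infinity>"
      by (simp add: besov_def ennreal_mult_less_top)
    then show "f \<in> besov \<phi> \<sigma> \<gamma> q b ?A u"
      using f le_less_trans[OF main] by (auto simp: besov_def)
  qed
qed

end
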